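(* Let $N_T,N_R\ge 1$ be integers, $P>0$, $\sigma^2>0$ and $0\le\alpha<1$. Consider the MIMO Gauss-Markov Rayleigh fading channel with receiver channel state information $W_{\mathbf G^n}$ (defined in the context) with parameters $N_T,N_R,\sigma^2,\alpha$, and let $C(P,N_R\times N_T)$ be its capacity under average power constraint $P$, i.e. the supremum of all achievable rates (defined in the context). Let $\mathbf G\in\mathbb C^{N_R\times N_T}$ be any random matrix with i.i.d. entries such that $\mathrm{vec}(\mathbf G)\sim\mathcal N_{\mathbb C}(\boldsymbol 0_{N_RN_T},\mathbf I_{N_RN_T})$. Then $$C(P,N_R\times N_T)=\max_{\mathbf Q\in\mathcal Q_{(P,N_T)}}\mathbb E\left[\log\det\left(\mathbf I_{N_R}+\frac{1}{\sigma^2}\mathbf G\mathbf Q\mathbf G^{H}\right)\right].$$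
   Context: $\log$ is to base 2. $\mathcal N_{\mathbb C}(\boldsymbol 0,\mathbf K)$ is the circularly symmetric complex Gaussian law with mean $\boldsymbol 0$ and covariance $\mathbf K$; $\mathrm{vec}$ is vectorization; $^H$ is Hermitian transpose. $\mathcal Q_{(P,m)}$ is the set of positive semi-definite Hermitian matrices in $\mathbb C^{m\times m}$ with trace at most $P$. Channel. For block-length $n$, the channel $W_{\mathbf G^n}$ maps an input block $\boldsymbol t^n=(\boldsymbol t_1,\dots,\boldsymbol t_n)\in\mathbb C^{N_T\times n}$ to the output block $\boldsymbol z^n=(\boldsymbol z_1,\dots,\boldsymbol z_n)\in\mathbb C^{N_R\times n}$ with $$\boldsymbol z_i=\mathbf G_i\boldsymbol t_i+\boldsymbol\xi_i,\quad i=1,\dots,n,$$ where $\mathbf G_i=\sqrt\alpha\,\mathbf G_{i-1}+\sqrt{1-\alpha}\,\mathbf W_i$ for $i=2,\dots,n$. The random matrices $\mathbf G_1,\mathbf W_2,\dots,\mathbf W_n\in\mathbb C^{N_R\times N_T}$ are i.i.d. with i.i.d. entries, and $\mathrm{vec}(\mathbf G_1),\mathrm{vec}(\mathbf W_i)\sim\mathcal N_{\mathbb C}(\boldsymbol 0_{N_RN_T},\mathbf I_{N_RN_T})$. The noise vectors $\boldsymbol\xi_i\sim\mathcal N_{\mathbb C}(\boldsymbol 0_{N_R},\sigma^2\mathbf I_{N_R})$ are i.i.d.; $\mathbf G^n=(\mathbf G_1,\dots,\mathbf G_n)$ and $\boldsymbol\xi^n$ are independent, and $(\mathbf G^n,\boldsymbol\xi^n)$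 is independent of the channel input. The receiver knows the realization of $\mathbf G^n$; the sender knows only its statistics. For a realization $\mathbf g^n$ of $\mathbf G^n$, an input block $\mathbf t\in\mathbb C^{N_T\times n}$ and a (measurable) set $D\subset\mathbb C^{N_R\times n}$, $W_{\mathbf g^n}(D|\mathbf t)$ is the conditional probability that the output block lies in $D$ given that the input is $\mathbf t$ and the gains are $\mathbf g^n$. Codes. A transmission-code $\Gamma$ of length $n$ and size $\lVert\Gamma\rVert$ with average power constraint $P$ is a family of pairs $(\mathbf t_\ell,\mathcal D_\ell^{(\mathbf g^n)})$, $\ell=1,\dots,\lVert\Gamma\rVert$, indexed also by all gain sequences $\mathbf g^n\in(\mathbb C^{N_R\times N_T})^n$, where the codewords $\mathbf t_\ell=(\boldsymbol t_{\ell,1},\dots,\boldsymbol t_{\ell,n})\in\mathbb C^{N_T\times n}$ do not depend on $\mathbf g^n$ and satisfy $\frac1n\sum_{i=1}^n\boldsymbol t_{\ell,i}^H\boldsymbol t_{\ell,i}\le P$, and the decoding regions $\mathcal D_\ell^{(\mathbf g^n)}\subset\mathbb C^{N_R\times n}$ satisfy $\mathcal D_\ell^{(\mathbf g^n)}\cap\mathcal D_j^{(\mathbf g^n)}=\varnothing$ for $\ell\ne j$ (with decoding regions jointly measurable in output and gains so that the error probabilities below are defined). Its maximal error probability is $e_{\max}(\Gamma)=\max_{\ell}\mathbb E\left[W_{\mathbf G^n}\big((\mathcal D_\ell^{(\mathbf G^n)})^c\,\big|\,\mathbf t_\ell\big)\right]$, the expectation being over $\mathbf G^n$. Achievable rate.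 A real number $R$ is an achievable rate if for every $\theta,\delta>0$ there is a sequence $(\Gamma_n)_{n\ge1}$ of such codes, $\Gamma_n$ of length $n$, with $\frac{\log\lVert\Gamma_n\rVert}{n}\ge R-\delta$ and $e_{\max}(\Gamma_n)\le\theta$ for all sufficiently large $n$. The capacity $C(P,N_R\times N_T)$ is the supremum of all achievable rates. *)

theory Defs
  imports "HOL-Probability.Probability"
begin

section \<open>Hermitian matrices\<close>

definition cdot :: "complex^'n \<Rightarrow> complex^'n \<Rightarrow> complex" where
  "cdot x y = (\<Sum>k\<in>UNIV. cnj (x $ k) * y $ k)"

definition herm :: "complex^'n^'m \<Rightarrow> complex^'m^'n" where
  "herm A = (\<chi> i j. cnj (A $ j $ i))"

definition hermitian_psd :: "complex^'m^'m \<Rightarrow> bool" where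
  "hermitian_psd Q \<longleftrightarrow> herm Q = Q \<and> (\<forall>x. 0 \<le> Re (cdot x (Q *v x)))"

definition power_covariances :: "real \<Rightarrow> (complex^'m^'m) set" where
  "power_covariances P = {Q. hermitian_psd Q \<and> Re (trace Q) \<le> P}"

definition vectorize :: "'a^'c^'r \<Rightarrow> 'a^('c \<times> 'r)" where
  "vectorize A = (\<chi> k. A $ snd k $ fst k)"


section \<open>Circularly symmetric complex Gaussian laws\<close>

text \<open>The law with mean \<open>0\<close> and covariance \<open>K = E[Z Z\<^sup>H]\<close>, for positive definite Hermitian \<open>K\<close>
  (the only case used; the formula is meaningless for singular \<open>K\<close>). The density is with respect
  to Lebesgue measure on the real vector space \<open>complex^'n\<close> of dimension \<open>2 CARD('n)\<close>; real and
  imaginary parts of a component of variance \<open>v\<close> thus have variance \<open>v / 2\<close> each.\<close>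

definition complex_gaussian_density :: "complex^'n^'n \<Rightarrow> complex^'n \<Rightarrow> real" where
  "complex_gaussian_density K z =
     exp (- Re (cdot z (matrix_inv K *v z))) / (pi ^ CARD('n) * Re (det K))"

definition complex_gaussian :: "'w measure \<Rightarrow> ('w \<Rightarrow> complex^'n) \<Rightarrow> complex^'n^'n \<Rightarrow> bool" where
  "complex_gaussian M X K \<longleftrightarrow>
     distributed M lborel X (\<lambda>z. ennreal (complex_gaussian_density K z))"

text \<open>The first two conjuncts (i.i.d. entries) also follow from the third.\<close>

definition rayleigh_matrix :: "'w measure \<Rightarrow> ('w \<Rightarrow> complex^'t^'r) \<Rightarrow> bool" where
  "rayleigh_matrix M G \<longleftrightarrow>
     prob_space.indep_vars M (\<lambda>_. borel) (\<lambda>(i, j) \<omega>. G \<omega> $ i $ j) UNIV \<and>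
     (\<forall>i j i' j'. distr M borel (\<lambda>\<omega>. G \<omega> $ i $ j) = distr M borel (\<lambda>\<omega>. G \<omega> $ i' $ j')) \<and>
     complex_gaussian M (\<lambda>\<omega>. vectorize (G \<omega>)) (mat 1)"


section \<open>The channel\<close>

text \<open>A block of length \<open>n\<close> of elements of \<open>'a\<close> is an element of the space of this measurable
  space, that is, a function on \<open>{1..n}\<close> which is \<open>undefined\<close> elsewhere.\<close>

abbreviation blocks :: "nat \<Rightarrow> (nat \<Rightarrow> 'a :: topological_space) measure" where
  "blocks n \<equiv> Pi\<^sub>M {1..n} (\<lambda>_. borel)"

definition block :: "nat \<Rightarrow> (nat \<Rightarrow> 'w \<Rightarrow> 'a) \<Rightarrow> 'w \<Rightarrow> nat \<Rightarrow> 'a" where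
  "block n X \<omega> = (\<lambda>i\<in>{1..n}. X i \<omega>)"

text \<open>The random variables for all block-lengths live on one probability space; time starts at
  \<open>1\<close>, and \<open>W\<close> is only used from time \<open>2\<close> on. The independence of \<open>G\<^sup>n\<close> and \<open>\<xi>\<^sup>n\<close> is stated for the
  generated \<open>\<sigma>\<close>-algebras, since \<open>indep_var\<close> requires both variables to have the same type.\<close>

locale gauss_markov_channel = prob_space M
  for M :: "'w measure" +
  fixes \<alpha> \<sigma> :: real
    and G W :: "nat \<Rightarrow> 'w \<Rightarrow> complex^'t^'r"
    and \<xi> :: "nat \<Rightarrow> 'w \<Rightarrow> complex^'r"
  assumes initial_rayleigh: "rayleigh_matrix M (G 1)"
    and innovation_rayleigh: "\<And>i. i \<ge> 2 \<Longrightarrow> rayleigh_matrix M (W i)"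
    and initial_innovations_indep:
      "indep_vars (\<lambda>_. borel) (\<lambda>i. if i = 1 then G 1 else W i) {1..}"
    and gain_recursion:
      "\<And>i \<omega>. i \<ge> 2 \<Longrightarrow> \<omega> \<in> space M \<Longrightarrow>
         G i \<omega> = sqrt \<alpha> *\<^sub>R G (i - 1) \<omega> + sqrt (1 - \<alpha>) *\<^sub>R W i \<omega>"
    and noise_gaussian: "\<And>i. i \<ge> 1 \<Longrightarrow> complex_gaussian M (\<xi> i) (\<sigma>\<^sup>2 *\<^sub>R mat 1)"
    and noise_indep: "indep_vars (\<lambda>_. borel) \<xi> {1..}"
    and gains_noise_indep:
      "\<And>n. indep_set {block n G -` A \<inter> space M | A. A \<in> sets (blocks n)}
                      {block n \<xi> -` B \<inter> space M | B. B \<in> sets (blocks n)}"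

text \<open>Conditional law of the output block given input \<open>t\<close> and gains \<open>g\<close>: as the noise is
  independent of input and gains, it is the law of the block \<open>g\<^sub>i t\<^sub>i + \<xi>\<^sub>i\<close> with \<open>g\<close> and \<open>t\<close> fixed.\<close>

definition channel_law ::
  "'w measure \<Rightarrow> (nat \<Rightarrow> 'w \<Rightarrow> complex^'r) \<Rightarrow> nat \<Rightarrow>
   (nat \<Rightarrow> complex^'t^'r) \<Rightarrow> (nat \<Rightarrow> complex^'t) \<Rightarrow> (nat \<Rightarrow> complex^'r) measure" where
  "channel_law M \<xi> n g t = distr M (blocks n) (block n (\<lambda>i \<omega>. g i *v t i + \<xi> i \<omega>))"


section \<open>Codes, achievable rates and capacity\<close>

text \<open>Messages are \<open>1, \<dots>, code_size\<close>; the second argument of \<open>decoding_region\<close> is the gain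
  sequence. Codewords are only evaluated at the times \<open>1, \<dots>, n\<close>.\<close>

record ('t :: finite, 'r :: finite) code =
  code_size :: nat
  codeword :: "nat \<Rightarrow> nat \<Rightarrow> complex^'t"
  decoding_region :: "nat \<Rightarrow> (nat \<Rightarrow> complex^'t^'r) \<Rightarrow> (nat \<Rightarrow> complex^'r) set"

definition is_code :: "nat \<Rightarrow> real \<Rightarrow> ('t :: finite, 'r :: finite) code \<Rightarrow> bool" where
  "is_code n P \<Gamma> \<longleftrightarrow>
     code_size \<Gamma> \<ge> 1 \<and>
     (\<forall>l\<in>{1..code_size \<Gamma>}.
        (1 / real n) * (\<Sum>i=1..n. Re (cdot (codeword \<Gamma> l i) (codeword \<Gamma> l i))) \<le> P) \<and>
     (\<forall>l\<in>{1..code_size \<Gamma>}. \<forall>g\<in>space (blocks n). decoding_region \<Gamma> l g \<subseteq> space (blocks n)) \<and>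
     (\<forall>l\<in>{1..code_size \<Gamma>}. \<forall>j\<in>{1..code_size \<Gamma>}. l \<noteq> j \<longrightarrow>
        (\<forall>g\<in>space (blocks n). decoding_region \<Gamma> l g \<inter> decoding_region \<Gamma> j g = {})) \<and>
     (\<forall>l\<in>{1..code_size \<Gamma>}.
        (SIGMA g : space (blocks n). decoding_region \<Gamma> l g) \<in> sets (blocks n \<Otimes>\<^sub>M blocks n))"

definition max_error ::
  "'w measure \<Rightarrow> (nat \<Rightarrow> 'w \<Rightarrow> complex^'t^'r) \<Rightarrow> (nat \<Rightarrow> 'w \<Rightarrow> complex^'r) \<Rightarrow>
   nat \<Rightarrow> ('t, 'r) code \<Rightarrow> real" where
  "max_error M G \<xi> n \<Gamma> =
     (MAX l\<in>{1..code_size \<Gamma>}.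
        \<integral>\<omega>. measure (channel_law M \<xi> n (block n G \<omega>) (codeword \<Gamma> l))
               (space (blocks n) - decoding_region \<Gamma> l (block n G \<omega>)) \<partial>M)"

definition achievable_rate ::
  "'w measure \<Rightarrow> (nat \<Rightarrow> 'w \<Rightarrow> complex^'t^'r) \<Rightarrow> (nat \<Rightarrow> 'w \<Rightarrow> complex^'r) \<Rightarrow>
   real \<Rightarrow> real \<Rightarrow> bool" where
  "achievable_rate M G \<xi> P R \<longleftrightarrow>
     (\<forall>\<theta>>0. \<forall>\<delta>>0. \<exists>\<Gamma> :: nat \<Rightarrow> ('t, 'r) code.
        (\<forall>n\<ge>1. is_code n P (\<Gamma> n)) \<and>
        (\<forall>\<^sub>F n in sequentially.
           log 2 (real (code_size (\<Gamma> n))) / real n \<ge> R - \<delta> \<and> max_error M G \<xi> n (\<Gamma> n) \<le> \<theta>))"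

text \<open>The supremum is taken in \<open>ereal\<close>, so that its finiteness is not presupposed.\<close>

definition capacity ::
  "'w measure \<Rightarrow> (nat \<Rightarrow> 'w \<Rightarrow> complex^'t^'r) \<Rightarrow> (nat \<Rightarrow> 'w \<Rightarrow> complex^'r) \<Rightarrow>
   real \<Rightarrow> ereal" where
  "capacity M G \<xi> P = (SUP R\<in>{R. achievable_rate M G \<xi> P R}. ereal R)"

text \<open>The determinant is a positive real number when \<open>Q\<close> is positive semi-definite.\<close>

definition log_det_rate :: "real \<Rightarrow> complex^'t^'t \<Rightarrow> complex^'t^'r \<Rightarrow> real" where
  "log_det_rate \<sigma> Q G = log 2 (Re (det (mat 1 + (1 / \<sigma>\<^sup>2) *\<^sub>R (G ** Q ** herm G))))"

end

(*
  The optimal covariance is Q* = (P/N_T) I, because the law of G is invariant under signed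
  permutations of its columns: averaging kills the off-diagonal entries of E[G^H K_G^-1 G], where
  K_G = sigma^2 I + (P/N_T) G G^H, and makes the diagonal ones equal.  With Gibbs' inequality for
  Gaussian laws (a tangent plane inequality for ln det) this shows that Q* is a maximiser, and the
  same identity bounds the mean information density of any codeword of power P by n times the
  maximum.  Applying ln x <= x - 1 to the likelihood ratio of the true output law and the Gaussian
  output law on and off the decoding regions then gives the weak converse; only the marginal laws of
  the gains enter.  Achievability is Feinstein's maximal code argument with Gaussian inputs of power
  slightly below P.  The quadratic forms in the information density concentrate by Chernoff bounds,
  and the ln det terms obey a weak law because G_{j+d} - alpha^(d/2) G_j is independent of G_j, so
  that covariances along the gain process tend to 0.
*)

theory Submission
  imports Defs
begin

section \<open>Hermitian linear algebra\<close>

text \<open>Receiver knowledge of the gains is modelled by treating the pair (gains, output block)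
  as the channel output, with densities relative to the product of the gain law and Lebesgue measure
  (\<open>base\<close>). Both halves of the proof rest on one likelihood ratio,
  \<open>ln_density_ratio\<close>: a sum of rates plus the difference of two quadratic forms, each
  of which has mean \<open>n\<close> times the number of receive antennas under Gaussian input, so
  that they cancel to first order. Nothing is diagonalised. Covariances are generated from scalar
  matrices by rank-one updates (\<open>cov\<close>); determinants, normalising constants and
  convolutions then come from the matrix determinant lemma and from integrating one Gaussian kernel
  in both orders, and second moments come from sign flips of coordinates. Power below
  \<open>P\<close> leaves room for fluctuation: a Gaussian block violates the constraint with
  exponentially small probability, and selecting only blocks that obey it costs no more than that.
  Feinstein's argument controls each message separately, as a maximal error requires.\<close>

lemma cdot_add_left: "cdot (x + y) z = cdot x z + cdot y z"
  and cdot_add_right: "cdot x (y + z) = cdot x y + cdot x z"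
  and cdot_diff_left: "cdot (x - y) z = cdot x z - cdot y z"
  and cdot_diff_right: "cdot x (y - z) = cdot x y - cdot x z"
  by (simp_all add: cdot_def algebra_simps sum.distrib sum_subtractf)

lemma cdot_scaleR_left: "cdot (r *\<^sub>R x) y = r *\<^sub>R cdot x y"
  and cdot_scaleR_right: "cdot x (r *\<^sub>R y) = r *\<^sub>R cdot x y"
  by (simp_all add: cdot_def scaleR_sum_right)

lemma cdot_mult_left: "cdot (c *s x) y = cnj c * cdot x y"
  and cdot_mult_right: "cdot x (c *s y) = c * cdot x y"
  by (simp_all add: cdot_def sum_distrib_left algebra_simps)

lemma cdot_zero [simp]: "cdot 0 x = 0" "cdot x 0 = 0"
  by (simp_all add: cdot_def)

lemma cdot_commute: "cdot x y = cnj (cdot y x)"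
  by (simp add: cdot_def mult.commute)

lemma Re_cdot_commute: "Re (cdot x y) = Re (cdot y x)"
  by (subst cdot_commute) simp

lemma cdot_self: "cdot x x = complex_of_real ((norm x)\<^sup>2)"
  by (simp add: cdot_def norm_vec_def L2_set_def sum_nonneg complex_norm_square mult.commute del: of_real_power)

lemma Re_cdot_self: "Re (cdot x x) = (norm x)\<^sup>2"
  by (simp add: cdot_self)

lemma cdot_herm: "cdot x (A *v y) = cdot (herm A *v x) y"
  unfolding cdot_def matrix_vector_mult_def herm_def
  by (simp add: sum_distrib_left sum_distrib_right, subst sum.swap) (simp add: ac_simps)

lemma herm_add: "herm (A + B) = herm A + herm B"
  by (simp add: herm_def vec_eq_iff)

lemma herm_scaleR: "herm (r *\<^sub>R A) = r *\<^sub>R herm A"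
  by (simp add: herm_def vec_eq_iff)

lemma herm_herm [simp]: "herm (herm A) = A"
  by (simp add: herm_def vec_eq_iff)

lemma herm_mat_1 [simp]: "herm (mat 1) = mat 1"
  by (simp add: herm_def mat_def vec_eq_iff)

lemma herm_mult: "herm (A ** B) = herm B ** herm A"
  by (simp add: herm_def matrix_matrix_mult_def vec_eq_iff mult.commute)

lemma scaleR_matrix_mult: "(r *\<^sub>R A) ** B = r *\<^sub>R (A ** (B :: complex^'k^'n))"
  and matrix_mult_scaleR: "C ** (r *\<^sub>R B) = r *\<^sub>R (C ** (B :: complex^'k^'n))"
  by (simp_all add: matrix_matrix_mult_def vec_eq_iff scaleR_sum_right)

lemma scaleR_matrix_vector: "(r *\<^sub>R A) *v x = r *\<^sub>R (A *v (x :: complex^'n))"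
  by (simp add: matrix_vector_mult_def vec_eq_iff scaleR_sum_right)

lemma matrix_vector_scaleR: "A *v (r *\<^sub>R x) = r *\<^sub>R (A *v (x :: complex^'n))"
  by (simp add: matrix_vector_mult_def vec_eq_iff scaleR_sum_right)

lemma matrix_add_vector: "(A + B) *v x = A *v x + B *v (x :: complex^'n)"
  by (rule matrix_vector_mult_add_rdistrib)

section \<open>Positive definite matrices and the completed square\<close>

definition pos_def :: "complex^'n^'n \<Rightarrow> bool" where
  "pos_def K \<longleftrightarrow> herm K = K \<and> (\<forall>x. x \<noteq> 0 \<longrightarrow> 0 < Re (cdot x (K *v x)))"

text \<open>The squared Mahalanobis length of \<open>z\<close>, that is, the exponent of the
  Gaussian density with covariance \<open>K\<close>.\<close>

definition quad :: "complex^'n^'n \<Rightarrow> complex^'n \<Rightarrow> real" where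
  "quad K z = Re (cdot z (matrix_inv K *v z))"

lemma pos_def_det_nz: "pos_def K \<Longrightarrow> det K \<noteq> 0"
proof -
  assume K: "pos_def K"
  have "inj ((*v) K)"
  proof (rule injI)
    fix x y assume "K *v x = K *v y"
    then have "K *v (x - y) = 0"
      by (simp add: matrix_vector_mult_diff_distrib)
    then have "x - y = 0"
      using K unfolding pos_def_def by (metis cdot_zero(2) less_irrefl zero_complex.sel(1))
    then show "x = y" by simp
  qed
  then show ?thesis
    using det_nz_iff_inj_gen[of "(*v) K"]
    by (simp add: matrix_vector_mul_linear_gen)
qed

lemma matrix_inv_right: "det (K :: complex^'n^'n) \<noteq> 0 \<Longrightarrow> K ** matrix_inv K = mat 1"
  and matrix_inv_left: "det (K :: complex^'n^'n) \<noteq> 0 \<Longrightarrow> matrix_inv K ** K = mat 1"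
  unfolding invertible_det_nz[symmetric] invertible_def matrix_inv_def
  by (drule someI_ex, simp)+

lemma matrix_inv_vector:
  "det (K :: complex^'n^'n) \<noteq> 0 \<Longrightarrow> K *v (matrix_inv K *v z) = z"
  "det (K :: complex^'n^'n) \<noteq> 0 \<Longrightarrow> matrix_inv K *v (K *v z) = z"
  by (simp_all add: matrix_vector_mul_assoc matrix_inv_right matrix_inv_left)

lemma matrix_inv_eqI: "A ** B = mat 1 \<Longrightarrow> matrix_inv (A :: complex^'n^'n) = B"
proof -
  assume AB: "A ** B = mat 1"
  then have "det A \<noteq> 0" by (metis det_I det_mul mult_zero_left zero_neq_one)
  then have "matrix_inv A = matrix_inv A ** (A ** B)" by (simp add: AB)
  also have "\<dots> = B" by (simp add: matrix_mul_assoc matrix_inv_left \<open>det A \<noteq> 0\<close>)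
  finally show ?thesis .
qed

lemma herm_matrix_inv:
  assumes "pos_def K" shows "herm (matrix_inv K) = matrix_inv K"
proof -
  have "K ** herm (matrix_inv K) = mat 1"
  proof -
    have "herm (matrix_inv K ** K) = mat 1"
      by (simp add: matrix_inv_left[OF pos_def_det_nz[OF assms]])
    then show ?thesis
      using assms by (simp add: herm_mult pos_def_def)
  qed
  then show ?thesis by (rule matrix_inv_eqI[symmetric])
qed

text \<open>Writing a vector as \<open>K *v y\<close> removes the inverse from \<open>quad\<close>;
  the nonnegativity of \<open>quad\<close> and the completed square rest on this
  substitution.\<close>

lemma quad_image: "pos_def K \<Longrightarrow> quad K (K *v y) = Re (cdot y (K *v y))"
  by (simp add: quad_def matrix_inv_vector pos_def_det_nz Re_cdot_commute)

lemma quad_nonneg: assumes "pos_def K" shows "0 \<le> quad K z"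
proof -
  have "quad K z = Re (cdot (matrix_inv K *v z) (K *v (matrix_inv K *v z)))"
    using quad_image[OF assms, of "matrix_inv K *v z"] assms
    by (simp add: matrix_inv_vector pos_def_det_nz)
  also have "\<dots> \<ge> 0"
    using assms by (cases "matrix_inv K *v z = 0") (auto simp: pos_def_def less_imp_le)
  finally show ?thesis .
qed

lemma pos_def_add_gram:
  assumes "pos_def K" shows "pos_def (K + h ** herm h)"
proof -
  have "Re (cdot x ((K + h ** herm h) *v x)) = Re (cdot x (K *v x)) + (norm (herm h *v x))\<^sup>2" for x
    by (simp add: matrix_add_vector cdot_add_right cdot_herm matrix_vector_mul_assoc[symmetric] Re_cdot_self[symmetric])
  then show ?thesis
    using assms by (simp add: pos_def_def herm_add herm_mult add_pos_nonneg)
qed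

lemma pos_def_scaleR_mat_1: "0 < v \<Longrightarrow> pos_def (v *\<^sub>R mat 1)"
  by (simp add: pos_def_def herm_scaleR scaleR_matrix_vector cdot_scaleR_right Re_cdot_self)

text \<open>The point \<open>\<mu>\<close> is the conditional mean of \<open>s\<close> given \<open>z = h s + \<xi>\<close> when \<open>s\<close> and \<open>\<xi>\<close> are
  Gaussian with covariances \<open>1\<close> and \<open>K\<close>.\<close>

lemma complete_square:
  assumes K: "pos_def K"
  obtains \<mu> where "\<And>d. (norm (\<mu> + d))\<^sup>2 + quad K (z - h *v (\<mu> + d)) =
      ((norm d)\<^sup>2 + quad K (h *v d)) + quad (K + h ** herm h) z"
proof -
  define K' where "K' = K + h ** herm h"
  \<comment> \<open>In terms of \<open>y\<close> the residual is \<open>K *v y - e\<close> with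
    \<open>e = h *v d\<close>, and \<open>quad K e\<close> is the only form that keeps an inverse.
    The cross terms \<open>2 * Re (cdot y e)\<close> of the two squares cancel.\<close>
  define y where "y = matrix_inv K' *v z"
  define \<mu> where "\<mu> = herm h *v y"
  have z: "z = K' *v y"
    using pos_def_det_nz[OF pos_def_add_gram[OF K, of h]] by (simp add: y_def K'_def matrix_inv_vector)
  have hK: "herm K = K" using K by (simp add: pos_def_def)
  have "(norm (\<mu> + d))\<^sup>2 + quad K (z - h *v (\<mu> + d)) = ((norm d)\<^sup>2 + quad K (h *v d)) + quad K' z" for d
  proof -
    define e where "e = h *v d"
    have 1: "z - h *v (\<mu> + d) = K *v y - e"
      by (simp add: z K'_def matrix_add_vector matrix_vector_right_distrib \<mu>_def e_def
          matrix_vector_mul_assoc[symmetric])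
    have "cdot (K *v y) (matrix_inv K *v e) = cdot y e"
      using cdot_herm[of y K "matrix_inv K *v e"] hK
      by (simp add: matrix_inv_vector pos_def_det_nz[OF K])
    then have 2: "quad K (K *v y - e) = Re (cdot y (K *v y)) - 2 * Re (cdot y e) + quad K e"
      by (simp add: quad_def matrix_vector_mult_diff_distrib matrix_inv_vector pos_def_det_nz[OF K]
          cdot_diff_left cdot_diff_right Re_cdot_commute[of e y] Re_cdot_commute[of "K *v y" y])
    have 3: "(norm (\<mu> + d))\<^sup>2 = (norm \<mu>)\<^sup>2 + 2 * Re (cdot y e) + (norm d)\<^sup>2"
      by (simp add: Re_cdot_self[symmetric] cdot_add_left cdot_add_right Re_cdot_commute[of d \<mu>])
         (simp add: \<mu>_def e_def cdot_herm)
    have 4: "quad K' z = Re (cdot y (K *v y)) + (norm \<mu>)\<^sup>2"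
      unfolding z using quad_image[of K' y] pos_def_add_gram[OF K, of h]
      by (simp add: K'_def matrix_add_vector cdot_add_right Re_cdot_self[symmetric] \<mu>_def
          matrix_vector_mul_assoc[symmetric] cdot_herm)
    show ?thesis unfolding 1 2 3 4 e_def[symmetric] by simp
  qed
  then show ?thesis using that unfolding K'_def by blast
qed

text \<open>Complete the square at \<open>z = h *v s\<close> and choose \<open>d\<close> with
  \<open>\<mu> + d = s\<close>: the residual vanishes, so the left side is
  \<open>(norm s)\<^sup>2\<close>, while the part in \<open>d\<close> on the right is
  nonnegative.\<close>

lemma quad_gram_le:
  assumes "pos_def K" shows "quad (K + h ** herm h) (h *v s) \<le> (norm s)\<^sup>2"
proof -
  obtain \<mu> where *: "\<And>d. (norm (\<mu> + d))\<^sup>2 + quad K (h *v s - h *v (\<mu> + d)) =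
      ((norm d)\<^sup>2 + quad K (h *v d)) + quad (K + h ** herm h) (h *v s)"
    using complete_square[OF assms] by metis
  have "0 \<le> quad K (h *v (s - \<mu>))" by (rule quad_nonneg[OF assms])
  then show ?thesis using *[of "s - \<mu>"] by (simp add: quad_def[of K 0] sum_power2_ge_zero)
qed

section \<open>Rank-one updates and determinants\<close>

definition outer :: "complex^'n \<Rightarrow> complex^'n^'n" where
  "outer v = (\<chi> i j. v $ i * cnj (v $ j))"

lemma outer_vector: "outer v *v x = cdot v x *s v"
  by (simp add: outer_def matrix_vector_mult_def vec_eq_iff cdot_def sum_distrib_left sum_distrib_right ac_simps)

lemma gram_outer: "h ** herm h = (\<Sum>k\<in>UNIV. outer (column k h))"
  by (simp add: vec_eq_iff matrix_matrix_mult_def outer_def herm_def column_def)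

text \<open>A vector as a matrix with a single column, so that results on \<open>h ** herm h\<close>
  specialise to rank-one updates and the integral over the input becomes one over
  \<open>complex^1\<close>.\<close>

definition col :: "complex^'n \<Rightarrow> complex^1^'n" where "col v = (\<chi> i j. v $ i)"

lemma col_gram: "col v ** herm (col v) = outer v"
  by (simp add: col_def herm_def outer_def matrix_matrix_mult_def vec_eq_iff)

lemma col_vector: "col v *v d = d $ 1 *s v"
  by (simp add: col_def matrix_vector_mult_def vec_eq_iff mult.commute)

lemma pos_def_outer: "pos_def K \<Longrightarrow> pos_def (K + outer v)"
  using pos_def_add_gram[of K "col v"] by (simp add: col_gram)

text \<open>The rows are modified one at a time.\<close>

lemma det_mat_1_plus_rank_one:
  fixes u w :: "'a :: field^'n"
  shows "det (mat 1 + (\<chi> i j. u $ i * w $ j)) = 1 + (\<Sum>i\<in>UNIV. u $ i * w $ i)"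
proof -
  let ?E = "\<lambda>i. row i (mat 1 :: 'a^'n^'n)"
  let ?M = "\<lambda>S. (\<chi> i. if i \<in> S then ?E i + u $ i *s w else ?E i) :: 'a^'n^'n"
  \<comment> \<open>With \<open>w\<close> itself in row \<open>k\<close>, the multiples of
    \<open>w\<close> added to the rows in \<open>S\<close> are undone by row operations, one row per
    induction step. What remains is the identity with row \<open>k\<close> replaced by
    \<open>w\<close>.\<close>
  have row_w: "det (\<chi> i. if i = k then w else if i \<in> S then ?E i + u $ i *s w else ?E i) = w $ k"
    if "finite S" "k \<notin> S" for S k
    using that
  proof (induction S)
    case empty
    \<comment> \<open>The coordinates of \<open>w\<close> other than the \<open>k\<close>-th
      contribute a combination of the remaining rows, which leaves the determinant
      unchanged.\<close>
    have x: "(\<Sum>j\<in>UNIV - {k}. w $ j *s ?E j) \<in> vec.span {row j (mat 1 :: 'a^'n^'n) |j. j \<noteq> k}"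
      by (intro vec.span_sum vec.span_scale vec.span_base) auto
    have w: "w = w $ k *s ?E k + (\<Sum>j\<in>UNIV - {k}. w $ j *s ?E j)"
    proof -
      have "w = (\<Sum>j\<in>UNIV. w $ j *s ?E j)"
        by (rule vec_eq_iff[THEN iffD2]) (simp add: row_def mat_def mult_delta_right)
      also have "\<dots> = w $ k *s ?E k + (\<Sum>j\<in>UNIV - {k}. w $ j *s ?E j)"
        by (simp add: sum.remove)
      finally show ?thesis .
    qed
    let ?A = "(\<chi> i. if i = k then w $ k *s ?E k else ?E i) :: 'a^'n^'n"
    have rows: "{row j ?A |j. j \<noteq> k} = {row j (mat 1 :: 'a^'n^'n) |j. j \<noteq> k}"
      by (auto simp: row_def)
    have "det (\<chi> i. if i = k then w else ?E i) =
        det (\<chi> i. if i = k then row k ?A + (\<Sum>j\<in>UNIV - {k}. w $ j *s ?E j) else row i ?A)"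
    proof (intro arg_cong[where f=det] vec_eq_iff[THEN iffD2] allI)
      fix i j
      have "row k ?A = w $ k *s ?E k" by (auto simp: vec_eq_iff row_def)
      then show "(\<chi> i. if i = k then w else ?E i) $ i $ j = (\<chi> i. if i = k then
          row k ?A + (\<Sum>j\<in>UNIV - {k}. w $ j *s ?E j) else row i ?A) $ i $ j"
        using arg_cong[OF w, of "\<lambda>v. v $ j"] by (simp add: row_def)
    qed
    also have "\<dots> = det ?A"
      by (rule det_row_span) (use x rows in simp)
    also have "\<dots> = w $ k * det (\<chi> i. if i = k then ?E k else ?E i)"
      by (rule det_row_mul)
    also have "(\<chi> i. if i = k then ?E k else ?E i) = (mat 1 :: 'a^'n^'n)"
      by (auto simp: vec_eq_iff row_def)
    finally show ?case by (simp add: if_distrib cong: if_cong)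
  next
    case (insert l S)
    let ?A = "(\<chi> i. if i = k then w else if i \<in> S then ?E i + u $ i *s w else ?E i) :: 'a^'n^'n"
    have kl: "l \<noteq> k" using insert by auto
    have "det (\<chi> i. if i = l then row l ?A + u $ l *s row k ?A else row i ?A) = det ?A"
      using kl by (rule det_row_operation)
    moreover have "(\<chi> i. if i = l then row l ?A + u $ l *s row k ?A else row i ?A) =
       (\<chi> i. if i = k then w else if i \<in> insert l S then ?E i + u $ i *s w else ?E i)"
      using insert kl by (auto simp: vec_eq_iff row_def)
    ultimately show ?case using insert by auto
  qed
  have main: "det (?M S) = 1 + (\<Sum>i\<in>S. u $ i * w $ i)" if "finite S" for S
    using that
  proof (induction S)
    case empty
    have "?M {} = mat 1" by (simp add: vec_eq_iff row_def)
    then show ?case by simp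
  next
    case (insert k S)
    let ?c = "\<lambda>i. if i \<in> S then ?E i + u $ i *s w else ?E i"
    have "?M (insert k S) = (\<chi> i. if i = k then ?E k + u $ k *s w else ?c i)"
      by (auto simp: vec_eq_iff)
    then have "det (?M (insert k S)) = det (\<chi> i. if i = k then ?E k else ?c i)
        + det (\<chi> i. if i = k then u $ k *s w else ?c i)"
      by (simp add: det_row_add)
    also have "(\<chi> i. if i = k then ?E k else ?c i) = ?M S"
      using insert by (auto simp: vec_eq_iff)
    also have "det (\<chi> i. if i = k then u $ k *s w else ?c i) = u $ k * w $ k"
      using row_w[OF insert(1,2)] by (simp add: det_row_mul)
    finally show ?case using insert by (simp add: algebra_simps)
  qed
  have "?M UNIV = mat 1 + (\<chi> i j. u $ i * w $ j)"
    by (simp add: vec_eq_iff row_def)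
  then show ?thesis using main[of UNIV] by simp
qed

lemma cdot_inv_real: assumes "pos_def K" shows "cdot v (matrix_inv K *v v) = complex_of_real (quad K v)"
proof -
  have "cdot v (matrix_inv K *v v) = cnj (cdot v (matrix_inv K *v v))"
    using cdot_herm[of v "matrix_inv K" v] herm_matrix_inv[OF assms] cdot_commute by metis
  then have "Im (cdot v (matrix_inv K *v v)) = 0" by (simp add: complex_eq_iff)
  then show ?thesis by (simp add: quad_def complex_eq_iff)
qed

text \<open>The matrix determinant lemma: take \<open>K\<close> out on the left, which leaves the
  identity plus the rank-one matrix with factors \<open>matrix_inv K *v v\<close> and the conjugate
  of \<open>v\<close>.\<close>

lemma det_add_outer:
  assumes K: "pos_def K"
  shows "det (K + outer v) = det K * complex_of_real (1 + quad K v)"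
proof -
  let ?u = "matrix_inv K *v v"
  have "K + outer v = K ** (mat 1 + (\<chi> i j. ?u $ i * (\<chi> j. cnj (v $ j)) $ j))"
  proof -
    have "K ** (\<chi> i j. ?u $ i * cnj (v $ j)) = (\<chi> i j. (K *v ?u) $ i * cnj (v $ j))"
      by (simp add: vec_eq_iff matrix_matrix_mult_def matrix_vector_mult_def[of K] sum_distrib_right mult.assoc)
    also have "\<dots> = outer v"
      by (simp add: matrix_inv_vector pos_def_det_nz[OF K] outer_def)
    finally show ?thesis by (simp add: matrix_add_ldistrib)
  qed
  moreover have "(\<Sum>i\<in>UNIV. ?u $ i * cnj (v $ i)) = cdot v ?u"
    by (simp add: cdot_def mult.commute)
  ultimately show ?thesis
    using cdot_inv_real[OF K, of v] det_mat_1_plus_rank_one[of ?u "\<chi> j. cnj (v $ j)"]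
    by (simp add: det_mul)
qed


section \<open>Factorisation of positive semi-definite matrices\<close>

lemma form_add_axis:
  assumes "herm Q = Q"
  shows "Re (cdot (x + axis k c) (Q *v (x + axis k c))) =
    Re (cdot x (Q *v x)) + 2 * Re (cnj c * (Q *v x) $ k) + (cmod c)\<^sup>2 * Re (Q $ k $ k)"
proof -
  have ax: "cdot (axis k c) y = cnj c * y $ k" for y :: "complex^'a"
    by (simp add: cdot_def axis_def if_distrib if_distribR cong: if_cong)
  have "cdot x (Q *v axis k c) = cdot (Q *v x) (axis k c)"
    using cdot_herm[of x Q] assms by simp
  also have "\<dots> = cnj (cnj c * (Q *v x) $ k)"
    by (subst cdot_commute) (simp add: ax)
  finally have 1: "Re (cdot x (Q *v axis k c)) = Re (cnj c * (Q *v x) $ k)"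
    by simp
  have "(Q *v axis k c) $ k = c * Q $ k $ k"
    by (simp add: matrix_vector_mult_def axis_def if_distrib cong: if_cong)
  then have "cnj c * (Q *v axis k c) $ k = complex_of_real ((cmod c)\<^sup>2) * Q $ k $ k"
    by (simp add: complex_norm_square mult_ac del: of_real_power)
  then have 2: "Re (cdot (axis k c) (Q *v axis k c)) = (cmod c)\<^sup>2 * Re (Q $ k $ k)"
    by (simp add: ax del: of_real_power)
  show ?thesis
    using 1 2 by (simp add: cdot_add_left cdot_add_right matrix_vector_right_distrib ax)
qed

text \<open>Cholesky elimination, with \<open>S\<close> the set of rows that may still be nonzero. A
  positive pivot \<open>Q $ k $ k\<close> is cleared by subtracting \<open>outer v\<close> for a
  scaled column \<open>v\<close>, which leaves the Schur complement; a zero pivot forces its whole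
  row to vanish.\<close>

lemma hermitian_psd_sum_outer:
  fixes Q :: "complex^'n^'n"
  assumes "finite S" "hermitian_psd Q" "\<And>i j. i \<notin> S \<Longrightarrow> Q $ i $ j = 0"
  shows "\<exists>f. Q = (\<Sum>k\<in>S. outer (f k))"
  using assms
proof (induction S arbitrary: Q)
  case empty
  then show ?case by (auto simp: vec_eq_iff)
next
  case (insert k S)
  have hQ: "herm Q = Q" and psd: "\<And>x. 0 \<le> Re (cdot x (Q *v x))"
    using insert.prems by (auto simp: hermitian_psd_def)
  have cn: "Q $ j $ i = cnj (Q $ i $ j)" for i j
    using arg_cong[OF hQ, of "\<lambda>A. A $ j $ i"] by (simp add: herm_def)
  define a where "a = Re (Q $ k $ k)"
  have Qkk: "Q $ k $ k = complex_of_real a"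
    using cn[of k k] by (simp add: a_def complex_eq_iff)
  have a0: "0 \<le> a"
    using psd[of "axis k 1"] form_add_axis[OF hQ, of 0 k 1] by (simp add: a_def)
  show ?case
  proof (cases "a = 0")
    case True
    have "Q $ k $ j = 0" for j
    proof (rule ccontr)
      assume nz: "Q $ k $ j \<noteq> 0"
      define x :: "complex^'n" where "x = axis j 1"
      have Qx: "(Q *v x) $ k = Q $ k $ j"
        by (simp add: x_def matrix_vector_mult_def axis_def if_distrib cong: if_cong)
      define A where "A = Re (cdot x (Q *v x))"
      \<comment> \<open>As the pivot is 0, the form changes linearly along the axis
        \<open>k\<close>. This \<open>t\<close> makes its value \<open>A - (A + 1)\<close>, which is
        negative.\<close>
      define t where "t = (A + 1) / (2 * (cmod (Q $ k $ j))\<^sup>2)"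
      have "0 \<le> A + 2 * Re (cnj (- complex_of_real t * Q $ k $ j) * Q $ k $ j)"
        using psd[of "x + axis k (- complex_of_real t * Q $ k $ j)"] True
        by (simp add: form_add_axis[OF hQ] Qx A_def a_def)
      also have "cnj (- complex_of_real t * Q $ k $ j) * Q $ k $ j
          = complex_of_real (- t * (cmod (Q $ k $ j))\<^sup>2)"
        by (simp add: complex_norm_square mult_ac del: of_real_power)
      finally show False
        using nz by (simp add: t_def field_simps)
    qed
    then have "\<And>i j. i \<notin> S \<Longrightarrow> Q $ i $ j = 0"
      using insert.prems(2) by (metis insert_iff)
    then obtain f where f: "Q = (\<Sum>k\<in>S. outer (f k))"
      using insert.IH insert.prems(1) by blast
    have "outer (0 :: complex^'n) = 0" by (simp add: outer_def vec_eq_iff)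
    moreover have "(\<Sum>l\<in>S. outer ((f(k := 0)) l)) = (\<Sum>l\<in>S. outer (f l))"
      using insert.hyps by (intro sum.cong) auto
    ultimately have "Q = (\<Sum>l\<in>insert k S. outer ((f(k := 0)) l))"
      using insert.hyps f by simp
    then show ?thesis by blast
  next
    case False
    then have a: "0 < a" using a0 by simp
    define v where "v = (1 / sqrt a) *\<^sub>R column k Q"
    define Q' where "Q' = Q - outer v"
    have outv: "outer v $ i $ j = Q $ i $ k * Q $ k $ j / complex_of_real a" for i j
    proof -
      have vi: "v $ i = Q $ i $ k / complex_of_real (sqrt a)" for i
        by (simp add: v_def column_def scaleR_conv_of_real[of _ "Q $ i $ k"])
      have "outer v $ i $ j = Q $ i $ k * cnj (Q $ j $ k) / (complex_of_real (sqrt a) * complex_of_real (sqrt a))"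
        unfolding outer_def by (simp add: vi)
      also have "complex_of_real (sqrt a) * complex_of_real (sqrt a) = complex_of_real a"
        unfolding of_real_mult[symmetric] using a by simp
      finally show ?thesis by (simp add: cn[of k j, symmetric])
    qed
    have ho: "herm (outer v) = outer v"
      by (simp add: herm_def outer_def vec_eq_iff mult.commute)
    have "hermitian_psd Q'"
      unfolding hermitian_psd_def
    proof (intro conjI allI)
      show "herm Q' = Q'"
        using hQ ho by (simp add: Q'_def herm_def vec_eq_iff)
      fix x
      \<comment> \<open>This \<open>c\<close> minimises the form of \<open>Q\<close> at
        \<open>x + axis k c\<close>. The minimum is the form of the Schur complement at
        \<open>x\<close>, which is therefore nonnegative.\<close>
      define c where "c = - (Q *v x) $ k / complex_of_real a"
      have qx: "cdot (column k Q) x = (Q *v x) $ k"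
        by (simp add: cdot_def column_def matrix_vector_mult_def cn[of k _, symmetric])
      have "cdot x (outer v *v x) = cdot v x * cnj (cdot v x)"
        by (simp add: outer_vector cdot_mult_right cdot_commute[symmetric])
      also have "\<dots> = complex_of_real ((cmod (cdot v x))\<^sup>2)"
        by (rule complex_norm_square[symmetric])
      also have "cmod (cdot v x) = cmod ((Q *v x) $ k) / sqrt a"
        using a by (simp add: v_def cdot_scaleR_left qx)
      also have "(cmod ((Q *v x) $ k) / sqrt a)\<^sup>2 = (cmod ((Q *v x) $ k))\<^sup>2 / a"
        using a by (simp add: power_divide)
      finally have 1: "Re (cdot x (outer v *v x)) = (cmod ((Q *v x) $ k))\<^sup>2 / a" by simp
      have "cnj c * (Q *v x) $ k = complex_of_real (- (cmod ((Q *v x) $ k))\<^sup>2 / a)"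
        by (simp add: c_def complex_norm_square mult_ac del: of_real_power)
      then have 2: "Re (cnj c * (Q *v x) $ k) = - (cmod ((Q *v x) $ k))\<^sup>2 / a"
        by (simp only: Re_complex_of_real)
      have 3: "(cmod c)\<^sup>2 * Re (Q $ k $ k) = (cmod ((Q *v x) $ k))\<^sup>2 / a"
        using a by (simp add: c_def norm_divide power_divide Qkk power2_eq_square)
      have "0 \<le> Re (cdot x (Q *v x)) - (cmod ((Q *v x) $ k))\<^sup>2 / a"
        using psd[of "x + axis k c"] unfolding form_add_axis[OF hQ] 2 3 by simp
      also have "\<dots> = Re (cdot x (Q' *v x))"
        by (simp add: Q'_def matrix_vector_mult_diff_rdistrib cdot_diff_right 1)
      finally show "0 \<le> Re (cdot x (Q' *v x))" .
    qed
    moreover have "Q' $ i $ j = 0" if "i \<notin> S" for i j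
      using that a insert.prems(2)[of i] by (cases "i = k") (auto simp: Q'_def outv Qkk)
    ultimately obtain f where f: "Q' = (\<Sum>k\<in>S. outer (f k))"
      using insert.IH by blast
    moreover have "(\<Sum>l\<in>S. outer ((f(k := v)) l)) = (\<Sum>l\<in>S. outer (f l))"
      using insert.hyps by (intro sum.cong) auto
    ultimately have "Q = (\<Sum>l\<in>insert k S. outer ((f(k := v)) l))"
      using insert.hyps by (simp add: Q'_def algebra_simps)
    then show ?thesis by blast
  qed
qed

lemma hermitian_psd_factor:
  fixes Q :: "complex^'n^'n"
  assumes "hermitian_psd Q" obtains V :: "complex^'n^'n" where "Q = V ** herm V"
proof -
  have "\<exists>f. Q = (\<Sum>k\<in>(UNIV :: 'n set). outer (f k))"
    by (rule hermitian_psd_sum_outer) (use assms in auto)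
  then obtain f where f: "Q = (\<Sum>k\<in>(UNIV :: 'n set). outer (f k))" ..
  let ?V = "\<chi> i k. f k $ i"
  have "column k ?V = f k" for k
    by (simp add: column_def vec_eq_iff)
  then have "Q = ?V ** herm ?V"
    by (simp add: f gram_outer)
  then show ?thesis by (rule that)
qed

text \<open>Scalar noise followed by rank-one updates covers every covariance that occurs. The
  inductive form lets positivity of the determinant and the value of the Gaussian integral be proved
  one update at a time, without eigenvalues.\<close>

inductive cov :: "complex^'n^'n \<Rightarrow> bool" where
  scalar: "0 < v \<Longrightarrow> cov (v *\<^sub>R mat 1)"
| outer: "cov K \<Longrightarrow> cov (K + outer v)"

lemma cov_pos_def: "cov K \<Longrightarrow> pos_def K"
  by (induction rule: cov.induct) (auto simp: pos_def_scaleR_mat_1 pos_def_outer)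

lemma det_scaleR_mat: "det (v *\<^sub>R A :: complex^'n^'n) = complex_of_real v ^ CARD('n) * det A"
proof -
  have "v *\<^sub>R A = (\<chi> i. complex_of_real v *s (A $ i))"
    by (simp add: vec_eq_iff scaleR_conv_of_real[symmetric])
  then show ?thesis
    using det_rows_mul[of "\<lambda>_. complex_of_real v" "\<lambda>i. A $ i"] by simp
qed

lemma cov_det: assumes "cov K" shows "0 < Re (det K)" "det K = complex_of_real (Re (det K))"
proof -
  have "\<exists>r>0. det K = complex_of_real r"
    using assms
  proof (induction rule: cov.induct)
    case (scalar v)
    then show ?case by (intro exI[of _ "v ^ CARD('a)"]) (simp add: det_scaleR_mat)
  next
    case (outer K v)
    then obtain r where "r > 0" "det K = complex_of_real r" by blast
    then show ?case
      using det_add_outer[OF cov_pos_def[OF outer(1)], of v] quad_nonneg[OF cov_pos_def[OF outer(1)], of v]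
      by (intro exI[of _ "r * (1 + quad K v)"]) (simp add: add_pos_nonneg)
  qed
  then show "0 < Re (det K)" "det K = complex_of_real (Re (det K))" by auto
qed

lemma Re_det_add_outer:
  assumes "cov K" shows "Re (det (K + outer v)) = Re (det K) * (1 + quad K v)"
  using det_add_outer[OF cov_pos_def[OF assms], of v] by simp

text \<open>Each update multiplies the determinant by \<open>1 + quad K v\<close>, a factor of at
  least 1. The monotonicity later yields nonnegative rates and the comparison of rates at two
  powers.\<close>

lemma cov_add_outers:
  assumes "finite S" "cov K"
  shows "cov (K + (\<Sum>k\<in>S. outer (f k))) \<and> Re (det K) \<le> Re (det (K + (\<Sum>k\<in>S. outer (f k))))"
  using assms
proof (induction S)
  case (insert k S)
  let ?K = "K + (\<Sum>k\<in>S. outer (f k))"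
  have K: "cov ?K" "Re (det K) \<le> Re (det ?K)" using insert by auto
  have eq: "K + (\<Sum>k\<in>insert k S. outer (f k)) = ?K + outer (f k)"
    using insert by (simp add: add_ac)
  have "Re (det ?K) \<le> Re (det (?K + outer (f k)))"
    using K(1) quad_nonneg[OF cov_pos_def[OF K(1)], of "f k"] cov_det(1)[OF K(1)]
    by (simp add: Re_det_add_outer)
  then show ?case unfolding eq using K cov.outer[OF K(1)] by auto
qed simp

lemma cov_add_gram: "cov K \<Longrightarrow> cov (K + h ** herm h)"
  and det_le_det_add_gram: "cov K \<Longrightarrow> Re (det K) \<le> Re (det (K + h ** herm h))"
  unfolding gram_outer by (simp_all add: cov_add_outers)


section \<open>Gaussian integrals\<close>

lemma measurable_vec_nth [measurable (raw)]:
  assumes "f \<in> borel_measurable M"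
  shows "(\<lambda>x. f x $ i :: 'a :: real_normed_vector) \<in> borel_measurable M"
  using assms
  by (rule measurable_compose) (intro borel_measurable_continuous_onI continuous_intros)

lemma measurable_vec_lambda [measurable (raw)]:
  fixes f :: "'x \<Rightarrow> 'n :: finite \<Rightarrow> 'a :: euclidean_space"
  assumes [measurable]: "\<And>i. (\<lambda>x. f x i) \<in> borel_measurable M"
  shows "(\<lambda>x. \<chi> i. f x i) \<in> borel_measurable M"
proof (rule borel_measurable_euclidean_space[THEN iffD2], rule ballI)
  fix b :: "'a^'n" assume "b \<in> Basis"
  then obtain i u where "b = axis i u" by (auto simp: Basis_vec_def)
  then show "(\<lambda>x. (\<chi> i. f x i) \<bullet> b) \<in> borel_measurable M"
    by (simp add: inner_axis)
qed

lemma measurable_cnj [measurable]: "cnj \<in> borel_measurable borel"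
  by (intro borel_measurable_continuous_onI continuous_intros)

lemma measurable_cdot [measurable (raw)]:
  assumes [measurable]: "f \<in> borel_measurable M" "g \<in> borel_measurable M"
  shows "(\<lambda>x. cdot (f x) (g x)) \<in> borel_measurable M"
  unfolding cdot_def by measurable

lemma measurable_matrix_vector [measurable (raw)]:
  assumes [measurable]: "f \<in> borel_measurable M" "g \<in> borel_measurable M"
  shows "(\<lambda>x. f x *v g x :: complex^'n) \<in> borel_measurable M"
  unfolding matrix_vector_mult_def by measurable

lemma measurable_matrix_mult [measurable (raw)]:
  assumes [measurable]: "f \<in> borel_measurable M" "g \<in> borel_measurable M"
  shows "(\<lambda>x. f x ** g x :: complex^'n^'m) \<in> borel_measurable M"
  unfolding matrix_matrix_mult_def by measurable

lemma measurable_herm [measurable (raw)]: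
  "f \<in> borel_measurable M \<Longrightarrow> (\<lambda>x. herm (f x)) \<in> borel_measurable M"
  unfolding herm_def by measurable

lemma measurable_det [measurable (raw)]:
  "f \<in> borel_measurable M \<Longrightarrow> (\<lambda>x. det (f x :: complex^'n^'n)) \<in> borel_measurable M"
  unfolding det_def by measurable

text \<open>\<open>matrix_inv\<close> is defined by choice; Cramer's rule expresses it through
  determinants and so makes it measurable in \<open>K\<close>.\<close>

lemma matrix_inv_cramer:
  "det K \<noteq> 0 \<Longrightarrow> matrix_inv K *v (z :: complex^'n) =
    (\<chi> k. det (\<chi> i j. if j = k then z $ i else K $ i $ j) / det K)"
  by (simp add: cramer[symmetric] matrix_inv_vector)

lemma measurable_matrix_inv_vector:
  assumes [measurable]: "K \<in> borel_measurable M" "z \<in> borel_measurable M"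
    and "\<And>x. det (K x) \<noteq> 0"
  shows "(\<lambda>x. matrix_inv (K x) *v (z x :: complex^'n)) \<in> borel_measurable M"
  unfolding matrix_inv_cramer[OF assms(3)] by measurable

lemma measurable_quad [measurable]: "quad K \<in> borel_measurable borel"
  unfolding quad_def[abs_def] by measurable

lemma measurable_quad_family:
  assumes [measurable]: "K \<in> borel_measurable M" "z \<in> borel_measurable M" and "\<And>x. cov (K x)"
  shows "(\<lambda>x. quad (K x) (z x)) \<in> borel_measurable M"
proof -
  have [measurable]: "(\<lambda>x. matrix_inv (K x) *v z x) \<in> borel_measurable M"
    by (rule measurable_matrix_inv_vector) (use assms pos_def_det_nz cov_pos_def in auto)
  show ?thesis unfolding quad_def by measurable
qed

section \<open>Integrals of scalar Gaussian kernels\<close>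

lemma nn_integral_lborel_translate:
  fixes f :: "'a::euclidean_space \<Rightarrow> ennreal"
  assumes [measurable]: "f \<in> borel_measurable borel"
  shows "(\<integral>\<^sup>+x. f (c + x) \<partial>lborel) = (\<integral>\<^sup>+x. f x \<partial>lborel)"
proof -
  have "(\<integral>\<^sup>+x. f x \<partial>lborel) = (\<integral>\<^sup>+x. f x \<partial>distr lborel borel ((+) c))"
    by (simp add: lborel_distr_plus)
  then show ?thesis by (simp add: nn_integral_distr)
qed

lemma nn_integral_gauss_real:
  fixes a :: real assumes a: "0 < a"
  shows "(\<integral>\<^sup>+x. ennreal (exp (- a * x\<^sup>2)) \<partial>lborel) = ennreal (sqrt (pi / a))"
    and "(\<integral>\<^sup>+x. ennreal (exp (- a * x\<^sup>2) * x\<^sup>2) \<partial>lborel) = ennreal (sqrt (pi / a) / (2 * a))"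
proof -
  define s where "s = 1 / sqrt (2 * a)"
  have s: "0 < s" "s\<^sup>2 = 1 / (2 * a)" using a by (simp_all add: s_def power_divide)
  have nd: "exp (- a * x\<^sup>2) = sqrt (pi / a) * normal_density 0 s x" for x
    using a by (simp add: normal_density_def s real_sqrt_divide)
  have "(\<integral>\<^sup>+x. ennreal (normal_density 0 s x) \<partial>lborel) = 1"
    using prob_space.emeasure_space_1[OF prob_space_normal_density[OF s(1), of 0]]
    by (simp add: emeasure_density)
  then show "(\<integral>\<^sup>+x. ennreal (exp (- a * x\<^sup>2)) \<partial>lborel) = ennreal (sqrt (pi / a))"
    using a unfolding nd by (simp add: ennreal_mult nn_integral_cmult)
  have "has_bochner_integral lborel (\<lambda>x. normal_density 0 s x * x\<^sup>2) (s\<^sup>2)"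
    using normal_moment_even[OF s(1), of 0 1] by simp
  then have "(\<integral>\<^sup>+x. ennreal (normal_density 0 s x * x\<^sup>2) \<partial>lborel) = ennreal (s\<^sup>2)"
    by (subst nn_integral_eq_integral) (auto simp: has_bochner_integral_iff)
  then show "(\<integral>\<^sup>+x. ennreal (exp (- a * x\<^sup>2) * x\<^sup>2) \<partial>lborel) = ennreal (sqrt (pi / a) / (2 * a))"
    using a unfolding nd by (simp add: ennreal_mult nn_integral_cmult mult.assoc s)
       (simp add: ennreal_mult[symmetric])
qed

lemma norm_power2_Basis: "(norm (x :: 'a :: euclidean_space))\<^sup>2 = (\<Sum>b\<in>Basis. (x \<bullet> b)\<^sup>2)"
  by (simp add: norm_eq_sqrt_inner euclidean_inner[of x x] sum_nonneg power2_eq_square)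

lemma nn_integral_gauss:
  fixes a :: real assumes a: "0 < a"
  shows "(\<integral>\<^sup>+x. ennreal (exp (- a * (norm (x :: 'a :: euclidean_space))\<^sup>2)) \<partial>lborel) =
    ennreal (sqrt (pi / a) ^ DIM('a))"
proof -
  have "ennreal (exp (- a * (norm x)\<^sup>2)) = (\<Prod>b\<in>Basis. ennreal (exp (- a * (x \<bullet> b)\<^sup>2)))" for x :: 'a
    by (simp add: norm_power2_Basis sum_distrib_left prod_ennreal exp_sum[symmetric] sum_negf)
  then have "(\<integral>\<^sup>+x. ennreal (exp (- a * (norm (x :: 'a))\<^sup>2)) \<partial>lborel) =
      (\<Prod>b\<in>(Basis :: 'a set). \<integral>\<^sup>+y. ennreal (exp (- a * y\<^sup>2)) \<partial>lborel)"
    by (simp only:) (subst nn_integral_lborel_prod, auto)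
  then show ?thesis
    unfolding nn_integral_gauss_real[OF a] using a by (simp add: ennreal_power)
qed

lemma nn_integral_gauss_second_moment:
  fixes a :: real and i :: "'a :: euclidean_space"
  assumes a: "0 < a" and i: "i \<in> Basis"
  shows "(\<integral>\<^sup>+x. ennreal (exp (- a * (norm x)\<^sup>2) * (x \<bullet> i)\<^sup>2) \<partial>lborel) =
    ennreal (sqrt (pi / a) ^ DIM('a) / (2 * a))"
proof -
  let ?f = "\<lambda>b y. ennreal (exp (- a * y\<^sup>2) * (if b = i then y\<^sup>2 else 1))"
  have "ennreal (exp (- a * (norm x)\<^sup>2) * (x \<bullet> i)\<^sup>2) = (\<Prod>b\<in>Basis. ?f b (x \<bullet> b))" for x
    using i by (simp add: norm_power2_Basis sum_distrib_left prod_ennreal exp_sum[symmetric]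
        sum_negf prod.distrib prod.delta)
  then have "(\<integral>\<^sup>+x. ennreal (exp (- a * (norm x)\<^sup>2) * (x \<bullet> i)\<^sup>2) \<partial>lborel) =
      (\<Prod>b\<in>Basis. \<integral>\<^sup>+y. ?f b y \<partial>lborel)"
    by (simp only:) (subst nn_integral_lborel_prod, auto)
  also have "\<dots> = (\<Prod>b\<in>Basis. ennreal (sqrt (pi / a) * (if b = i then 1 / (2 * a) else 1)))"
    by (intro prod.cong refl) (use nn_integral_gauss_real[OF a] in auto)
  also have "\<dots> = ennreal (\<Prod>b\<in>(Basis :: 'a set). sqrt (pi / a) * (if b = i then 1 / (2 * a) else 1))"
    using a by (intro prod_ennreal) auto
  also have "\<dots> = ennreal (sqrt (pi / a) ^ DIM('a) / (2 * a))"
    using i by (simp add: prod.distrib prod.delta)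
  finally show ?thesis .
qed


section \<open>Gaussian laws of general covariance\<close>

lemma matrix_inv_scaleR_mat_1: "v \<noteq> 0 \<Longrightarrow> matrix_inv (v *\<^sub>R mat 1 :: complex^'n^'n) = (1 / v) *\<^sub>R mat 1"
  by (rule matrix_inv_eqI) (simp add: scaleR_matrix_mult matrix_mult_scaleR)

lemma quad_scalar: "v \<noteq> 0 \<Longrightarrow> quad (v *\<^sub>R mat 1) z = (norm z)\<^sup>2 / v"
  by (simp add: quad_def matrix_inv_scaleR_mat_1 scaleR_matrix_vector cdot_scaleR_right Re_cdot_self)

lemma quad_mat_1: "quad (mat 1) z = (norm z)\<^sup>2"
  using quad_scalar[of 1 z] by simp

lemma quad_scaleR_mult: "quad K (c *s z) = (cmod c)\<^sup>2 * quad K z"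
proof -
  have "cdot (c *s z) (matrix_inv K *v (c *s z)) = complex_of_real ((cmod c)\<^sup>2) * cdot z (matrix_inv K *v z)"
    by (simp add: cdot_mult_left cdot_mult_right matrix_vector_mult_scaleR vector_scalar_commute
        complex_norm_square mult_ac del: of_real_power)
  then show ?thesis by (simp add: quad_def del: of_real_power)
qed

lemma complex_gaussian_density_quad:
  "complex_gaussian_density K z = exp (- quad K z) / (pi ^ CARD('n) * Re (det K))"
  for K :: "complex^'n^'n"
  by (simp add: complex_gaussian_density_def quad_def)

lemma DIM_complex_vec: "DIM(complex^'n) = 2 * CARD('n)"
  by simp

lemma sqrt_power_double: "0 \<le> x \<Longrightarrow> sqrt x ^ (2 * n) = x ^ n"
  by (simp add: power_mult)

lemma nn_integral_gauss_complex:
  assumes "0 < a"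
  shows "(\<integral>\<^sup>+x. ennreal (exp (- a * (norm (x :: complex^'n))\<^sup>2)) \<partial>lborel) = ennreal ((pi / a) ^ CARD('n))"
  using nn_integral_gauss[OF assms, where 'a="complex^'n"] assms
  by (simp only: DIM_complex_vec) (simp add: sqrt_power_double)

text \<open>Translating \<open>s\<close> by the point \<open>\<mu>\<close> of the completed square
  separates the variables. The factor in \<open>d\<close> is independent of \<open>z\<close> and is
  left unevaluated; \<open>gaussian_swap\<close> determines it.\<close>

lemma gaussian_fibre_integral:
  fixes h :: "complex^'t^'r"
  assumes "pos_def K"
  shows "(\<integral>\<^sup>+s. ennreal (exp (- ((norm s)\<^sup>2 + quad K (z - h *v s)))) \<partial>lborel) =
    (\<integral>\<^sup>+d. ennreal (exp (- ((norm d)\<^sup>2 + quad K (h *v d)))) \<partial>lborel) * ennreal (exp (- quad (K + h ** herm h) z))"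
proof -
  obtain \<mu> where \<mu>: "\<And>d. (norm (\<mu> + d))\<^sup>2 + quad K (z - h *v (\<mu> + d)) =
      ((norm d)\<^sup>2 + quad K (h *v d)) + quad (K + h ** herm h) z"
    using complete_square[OF assms] by metis
  have "(\<integral>\<^sup>+s. ennreal (exp (- ((norm s)\<^sup>2 + quad K (z - h *v s)))) \<partial>lborel) =
      (\<integral>\<^sup>+d. ennreal (exp (- ((norm (\<mu> + d))\<^sup>2 + quad K (z - h *v (\<mu> + d))))) \<partial>lborel)"
    by (rule nn_integral_lborel_translate[symmetric]) measurable
  also have "\<dots> = (\<integral>\<^sup>+d. ennreal (exp (- ((norm d)\<^sup>2 + quad K (h *v d)))) * ennreal (exp (- quad (K + h ** herm h) z)) \<partial>lborel)"
    unfolding \<mu> by (simp add: exp_add exp_diff exp_minus divide_inverse ennreal_mult)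
  finally show ?thesis by (simp add: nn_integral_multc)
qed

text \<open>The kernel \<open>exp (- ((norm s)\<^sup>2 + quad K (z - h *v s)))\<close> is integrated
  over \<open>s\<close> and \<open>z\<close> in both orders. This links the Gaussian integrals for
  \<open>K\<close> and \<open>K + h ** herm h\<close>.\<close>

lemma gaussian_swap:
  fixes h :: "complex^'t^'r"
  assumes "pos_def K"
  shows "(\<integral>\<^sup>+z. ennreal (exp (- quad K z)) \<partial>lborel) * ennreal (pi ^ CARD('t)) =
    (\<integral>\<^sup>+d. ennreal (exp (- ((norm d)\<^sup>2 + quad K (h *v d)))) \<partial>lborel) *
    (\<integral>\<^sup>+z. ennreal (exp (- quad (K + h ** herm h) z)) \<partial>lborel)"
proof -
  have tr: "(\<integral>\<^sup>+z. ennreal (exp (- quad K (z - h *v s))) \<partial>lborel) = (\<integral>\<^sup>+z. ennreal (exp (- quad K z)) \<partial>lborel)" for s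
    using nn_integral_lborel_translate[of "\<lambda>z. ennreal (exp (- quad K z))" "- (h *v s)"]
    by simp
  have "(\<integral>\<^sup>+z. ennreal (exp (- quad K z)) \<partial>lborel) * ennreal (pi ^ CARD('t)) =
      (\<integral>\<^sup>+z. ennreal (exp (- quad K z)) \<partial>lborel) * (\<integral>\<^sup>+s. ennreal (exp (- (norm (s :: complex^'t))\<^sup>2)) \<partial>lborel)"
    using nn_integral_gauss_complex[of 1, where 'n='t] by simp
  also have "\<dots> = (\<integral>\<^sup>+s. (\<integral>\<^sup>+z. ennreal (exp (- quad K z)) \<partial>lborel) * ennreal (exp (- (norm (s :: complex^'t))\<^sup>2)) \<partial>lborel)"
    by (rule nn_integral_cmult[symmetric]) measurable
  also have "\<dots> = (\<integral>\<^sup>+s. (\<integral>\<^sup>+z. ennreal (exp (- quad K (z - h *v s))) * ennreal (exp (- (norm (s :: complex^'t))\<^sup>2)) \<partial>lborel) \<partial>lborel)"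
    by (simp add: tr nn_integral_multc)
  also have "\<dots> = (\<integral>\<^sup>+s. (\<integral>\<^sup>+z. ennreal (exp (- ((norm (s :: complex^'t))\<^sup>2 + quad K (z - h *v s)))) \<partial>lborel) \<partial>lborel)"
    by (simp add: ennreal_mult[symmetric] exp_add[symmetric] exp_diff[symmetric] algebra_simps)
  also have "\<dots> = (\<integral>\<^sup>+z. (\<integral>\<^sup>+s. ennreal (exp (- ((norm (s :: complex^'t))\<^sup>2 + quad K (z - h *v s)))) \<partial>lborel) \<partial>lborel)"
    by (rule lborel_pair.Fubini') measurable
  also have "\<dots> = (\<integral>\<^sup>+d. ennreal (exp (- ((norm d)\<^sup>2 + quad K (h *v d)))) \<partial>lborel) *
    (\<integral>\<^sup>+z. ennreal (exp (- quad (K + h ** herm h) z)) \<partial>lborel)"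
    unfolding gaussian_fibre_integral[OF assms] by (rule nn_integral_cmult) measurable
  finally show ?thesis .
qed

text \<open>Induction over the updates: for \<open>h = col v\<close> the remaining factor of
  \<open>gaussian_swap\<close> is an integral over one complex variable, equal to
  \<open>pi / (1 + quad K v)\<close>, and \<open>1 + quad K v\<close> is exactly the factor by which
  the determinant grows.\<close>

lemma nn_integral_exp_quad:
  fixes K :: "complex^'n^'n"
  assumes "cov K"
  shows "(\<integral>\<^sup>+z. ennreal (exp (- quad K z)) \<partial>lborel) = ennreal (pi ^ CARD('n) * Re (det K))"
  using assms
proof (induction rule: cov.induct)
  case (scalar v)
  then show ?case
    using nn_integral_gauss_complex[of "1 / v", where 'n='n]
    by (simp add: quad_scalar det_scaleR_mat power_mult_distrib)
next
  case (outer K v)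
  let ?q = "quad K v"
  have K: "pos_def K" and q: "0 \<le> ?q" using outer cov_pos_def quad_nonneg by auto
  have "(norm d)\<^sup>2 + quad K (col v *v d) = (1 + ?q) * (norm d)\<^sup>2" for d :: "complex^1"
    by (simp add: col_vector quad_scaleR_mult norm_vec_def L2_set_def UNIV_1 algebra_simps)
  then have I: "(\<integral>\<^sup>+d. ennreal (exp (- ((norm d)\<^sup>2 + quad K (col v *v d)))) \<partial>lborel) = ennreal (pi / (1 + ?q))"
    using nn_integral_gauss_complex[of "1 + ?q", where 'n=1] q by (simp only: mult_minus_left) simp
  have "ennreal (pi ^ CARD('n) * Re (det K)) * ennreal pi =
     ennreal (pi / (1 + ?q)) * (\<integral>\<^sup>+z. ennreal (exp (- quad (K + outer v) z)) \<partial>lborel)"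
    using gaussian_swap[OF K, of "col v"] by (simp only: I col_gram outer.IH) simp
  then have "ennreal ((1 + ?q) / pi) * (ennreal (pi ^ CARD('n) * Re (det K)) * ennreal pi) =
     ennreal ((1 + ?q) / pi) * ennreal (pi / (1 + ?q)) * (\<integral>\<^sup>+z. ennreal (exp (- quad (K + outer v) z)) \<partial>lborel)"
    by (simp only: mult.assoc)
  also have "ennreal ((1 + ?q) / pi) * ennreal (pi / (1 + ?q)) = 1"
    using q by (simp add: ennreal_mult[symmetric])
  finally show ?case
    using q cov_det(1)[OF outer(1)] Re_det_add_outer[OF outer(1), of v]
    by (simp add: ennreal_mult[symmetric] mult_ac)
qed

lemma measurable_cgd [measurable]: "complex_gaussian_density K \<in> borel_measurable borel"
  unfolding complex_gaussian_density_quad[abs_def] by measurable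

lemma cgd_pos: "cov K \<Longrightarrow> 0 < complex_gaussian_density K z"
  using cov_det(1)[of K] by (simp add: complex_gaussian_density_quad)

lemma nn_integral_cgd: "cov K \<Longrightarrow> (\<integral>\<^sup>+z. ennreal (complex_gaussian_density K z) \<partial>lborel) = 1"
  for K :: "complex^'n^'n"
proof -
  assume K: "cov K"
  let ?c = "pi ^ CARD('n) * Re (det K)"
  have c: "0 < ?c" using cov_det(1)[OF K] by simp
  have "(\<integral>\<^sup>+z. ennreal (complex_gaussian_density K z) \<partial>lborel) = (\<integral>\<^sup>+z. ennreal (exp (- quad K z)) * ennreal (1 / ?c) \<partial>lborel)"
    using c by (simp add: complex_gaussian_density_quad ennreal_mult[symmetric] less_imp_le)
  also have "\<dots> = ennreal ?c * ennreal (1 / ?c)"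
    by (simp only: nn_integral_exp_quad[OF K, symmetric]) (rule nn_integral_multc, measurable)
  also have "\<dots> = 1" using c cov_det(1)[OF K] by (simp add: ennreal_mult[symmetric] less_imp_le del: mult_pos_pos)
  finally show ?thesis .
qed

lemma cov_mat_1 [simp]: "cov (mat 1)"
  using cov.scalar[of 1] by simp

text \<open>The output of the matrix \<open>h\<close> with standard Gaussian input and noise
  covariance \<open>K\<close>. Now that both normalising integrals are known,
  \<open>gaussian_swap\<close> is solved for the constant \<open>I\<close>.\<close>

lemma cgd_convolution:
  fixes h :: "complex^'t^'r"
  assumes K: "cov K"
  shows "(\<integral>\<^sup>+s. ennreal (complex_gaussian_density (mat 1) s) * ennreal (complex_gaussian_density K (z - h *v s)) \<partial>lborel) =
    ennreal (complex_gaussian_density (K + h ** herm h) z)"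
proof -
  let ?K = "K + h ** herm h"
  let ?t = "pi ^ CARD('t)" and ?r = "pi ^ CARD('r)"
  define I where "I = (\<integral>\<^sup>+d. ennreal (exp (- ((norm d)\<^sup>2 + quad K (h *v d)))) \<partial>lborel)"
  have K': "cov ?K" by (rule cov_add_gram[OF K])
  note d = cov_det(1)[OF K] cov_det(1)[OF K']
  have "ennreal (?r * Re (det K)) * ennreal ?t = I * ennreal (?r * Re (det ?K))"
    using gaussian_swap[OF cov_pos_def[OF K], of h] unfolding I_def nn_integral_exp_quad[OF K] nn_integral_exp_quad[OF K'] .
  then have "ennreal (?r * Re (det K)) * ennreal ?t * ennreal (1 / (?r * Re (det ?K))) =
      I * (ennreal (?r * Re (det ?K)) * ennreal (1 / (?r * Re (det ?K))))"
    by (simp only: mult.assoc)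
  also have "ennreal (?r * Re (det ?K)) * ennreal (1 / (?r * Re (det ?K))) = 1"
    using d by (simp add: ennreal_mult[symmetric] less_imp_le)
  finally have I: "I = ennreal (?t * Re (det K) / Re (det ?K))"
    using d by (simp add: ennreal_mult[symmetric] less_imp_le field_simps)
  have "(\<integral>\<^sup>+s. ennreal (complex_gaussian_density (mat 1) s) * ennreal (complex_gaussian_density K (z - h *v s)) \<partial>lborel) =
     (\<integral>\<^sup>+s. ennreal (exp (- ((norm s)\<^sup>2 + quad K (z - h *v s)))) * ennreal (1 / (?t * ?r * Re (det K))) \<partial>lborel)"
    using d by (intro nn_integral_cong)
      (simp add: ennreal_mult[symmetric] less_imp_le complex_gaussian_density_quad quad_mat_1 exp_add exp_diff exp_minus field_simps)
  also have "\<dots> = I * ennreal (exp (- quad ?K z)) * ennreal (1 / (?t * ?r * Re (det K)))"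
    unfolding I_def gaussian_fibre_integral[OF cov_pos_def[OF K], symmetric] by (rule nn_integral_multc) measurable
  also have "\<dots> = ennreal (complex_gaussian_density ?K z)"
    using d by (simp add: I ennreal_mult[symmetric] less_imp_le complex_gaussian_density_quad field_simps)
  finally show ?thesis .
qed

lemma cov_scaleR: "cov K \<Longrightarrow> 0 < r \<Longrightarrow> cov (r *\<^sub>R K)"
proof (induction rule: cov.induct)
  case (scalar v)
  then show ?case using cov.scalar[of "r * v"] by simp
next
  case (outer K v)
  have "outer (sqrt r *\<^sub>R v) = r *\<^sub>R outer v"
    using outer.prems by (simp add: outer_def vec_eq_iff)
  then have "r *\<^sub>R (K + outer v) = r *\<^sub>R K + outer (sqrt r *\<^sub>R v)"
    by (simp add: scaleR_add_right)
  then show ?case using cov.outer outer by metis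
qed

text \<open>Tilting the density by \<open>exp (- s * quad K z)\<close> only rescales the covariance
  to \<open>K\<close> divided by \<open>1 + s\<close>. The value is the Laplace transform of a Gamma
  law of shape \<open>CARD('n)\<close>, the same for all \<open>K\<close>; it feeds the Chernoff
  bounds.\<close>

lemma nn_integral_cgd_exp_quad:
  fixes K :: "complex^'n^'n"
  assumes K: "cov K" and s: "-1 < s"
  shows "(\<integral>\<^sup>+z. ennreal (complex_gaussian_density K z) * ennreal (exp (- s * quad K z)) \<partial>lborel) =
    ennreal ((1 / (1 + s)) ^ CARD('n))"
proof -
  let ?r = "1 / (1 + s)"
  have K': "cov (?r *\<^sub>R K)" using cov_scaleR[OF K] s by simp
  have "(?r *\<^sub>R K) ** ((1 + s) *\<^sub>R matrix_inv K) = mat 1"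
    using s by (simp add: scaleR_matrix_mult matrix_mult_scaleR matrix_inv_right pos_def_det_nz cov_pos_def K)
  then have q: "quad (?r *\<^sub>R K) z = (1 + s) * quad K z" for z
    by (simp add: quad_def matrix_inv_eqI scaleR_matrix_vector cdot_scaleR_right)
  have d: "Re (det (?r *\<^sub>R K)) = ?r ^ CARD('n) * Re (det K)"
    by (subst det_scaleR_mat) (simp only: of_real_power[symmetric] Re_complex_of_real times_complex.sel Im_complex_of_real)
  have "complex_gaussian_density K z * exp (- s * quad K z) =
     complex_gaussian_density (?r *\<^sub>R K) z * ?r ^ CARD('n)" for z
    using cov_det(1)[OF K] s by (simp add: complex_gaussian_density_quad q d exp_add[symmetric] field_simps)
  then have "(\<integral>\<^sup>+z. ennreal (complex_gaussian_density K z) * ennreal (exp (- s * quad K z)) \<partial>lborel) =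
     (\<integral>\<^sup>+z. ennreal (complex_gaussian_density (?r *\<^sub>R K) z) * ennreal (?r ^ CARD('n)) \<partial>lborel)"
    using s cgd_pos[OF K] cgd_pos[OF K'] by (intro nn_integral_cong) (simp add: ennreal_mult[symmetric] less_imp_le)
  also have "\<dots> = ennreal (?r ^ CARD('n))"
    by (subst nn_integral_multc) (auto simp: nn_integral_cgd[OF K'])
  finally show ?thesis .
qed


section \<open>Coordinate symmetries and second moments\<close>

text \<open>The preimage of a box is a box with the same side lengths, its endpoints being exchanged
  and negated where \<open>c i = -1\<close>. Two enumerations \<open>a\<close> and \<open>b\<close>
  of the bases over one index set allow different types on the two sides, as needed to undo
  \<open>vectorize\<close>.\<close>

lemma lborel_distr_signed_permutation:
  fixes T :: "'a :: euclidean_space \<Rightarrow> 'b :: euclidean_space"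
  assumes a: "bij_betw a I Basis" and b: "bij_betw b I Basis"
    and c: "\<And>i. i \<in> I \<Longrightarrow> c i = 1 \<or> c i = (-1 :: real)"
    and T: "\<And>i x. i \<in> I \<Longrightarrow> T x \<bullet> b i = c i * (x \<bullet> a i)"
    and [measurable]: "T \<in> borel_measurable borel"
  shows "distr lborel borel T = lborel"
proof (rule lborel_eqI[symmetric])
  fix l u :: 'b assume lu: "\<And>i. i \<in> Basis \<Longrightarrow> l \<bullet> i \<le> u \<bullet> i"
  have bI: "b i \<in> Basis" "a i \<in> Basis" if "i \<in> I" for i
    using that a b by (auto simp: bij_betw_def)
  have fin: "finite I" using bij_betw_finite[OF a] by simp
  define lo where "lo i = (if c i = 1 then l \<bullet> b i else - (u \<bullet> b i))" for i
  define hi where "hi i = (if c i = 1 then u \<bullet> b i else - (l \<bullet> b i))" for i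
  define l' where "l' = (\<Sum>i\<in>I. lo i *\<^sub>R a i)"
  define u' where "u' = (\<Sum>i\<in>I. hi i *\<^sub>R a i)"
  have inn: "(\<Sum>j\<in>I. f j *\<^sub>R a j) \<bullet> a i = f i" if "i \<in> I" for i and f :: "'c \<Rightarrow> real"
  proof -
    have "(\<Sum>j\<in>I. f j *\<^sub>R a j) \<bullet> a i = (\<Sum>j\<in>I. if j = i then f j else 0)"
      unfolding inner_sum_left
      using that a bI by (intro sum.cong refl) (auto simp: inner_Basis bij_betw_def inj_on_eq_iff)
    then show ?thesis using that fin by simp
  qed
  have "T -` box l u \<inter> space lborel = box l' u'"
  proof -
    have "T x \<in> box l u \<longleftrightarrow> (\<forall>i\<in>I. l \<bullet> b i < T x \<bullet> b i \<and> T x \<bullet> b i < u \<bullet> b i)" for x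
      by (simp add: mem_box bij_betw_imp_surj_on[OF b, symmetric])
    moreover have "x \<in> box l' u' \<longleftrightarrow> (\<forall>i\<in>I. lo i < x \<bullet> a i \<and> x \<bullet> a i < hi i)" for x
      by (simp add: mem_box bij_betw_imp_surj_on[OF a, symmetric] l'_def u'_def inn)
    ultimately show ?thesis
      using c by (fastforce simp: T lo_def hi_def)
  qed
  moreover have "\<And>j. j \<in> Basis \<Longrightarrow> l' \<bullet> j \<le> u' \<bullet> j"
  proof -
    fix j :: 'a assume "j \<in> Basis"
    then obtain i where i: "i \<in> I" "j = a i" using a by (auto simp: bij_betw_def)
    then show "l' \<bullet> j \<le> u' \<bullet> j"
      using lu[of "b i"] bI[of i] by (auto simp: l'_def u'_def inn lo_def hi_def)
  qed
  ultimately have "emeasure (distr lborel borel T) (box l u) = (\<Prod>j\<in>Basis. (u' - l') \<bullet> j)"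
    by (simp add: emeasure_distr)
  also have "(\<Prod>j\<in>Basis. (u' - l') \<bullet> j) = (\<Prod>i\<in>I. hi i - lo i)"
    by (subst prod.reindex_bij_betw[OF a, symmetric]) (intro prod.cong refl, simp add: inner_diff_left l'_def u'_def inn)
  also have "\<dots> = (\<Prod>i\<in>I. (u - l) \<bullet> b i)"
    using c by (intro prod.cong refl) (auto simp: hi_def lo_def inner_diff_left)
  also have "\<dots> = (\<Prod>j\<in>Basis. (u - l) \<bullet> j)"
    by (rule prod.reindex_bij_betw[OF b])
  finally show "emeasure (distr lborel borel T) (box l u) = (\<Prod>j\<in>Basis. (u - l) \<bullet> j)" .
qed simp


lemma norm_signed_permutation:
  fixes T :: "'a :: euclidean_space \<Rightarrow> 'b :: euclidean_space"
  assumes a: "bij_betw a I Basis" and b: "bij_betw b I Basis"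
    and c: "\<And>i. i \<in> I \<Longrightarrow> c i = 1 \<or> c i = (-1 :: real)"
    and T: "\<And>i x. i \<in> I \<Longrightarrow> T x \<bullet> b i = c i * (x \<bullet> a i)"
  shows "norm (T x) = norm x"
proof -
  have "(norm (T x))\<^sup>2 = (\<Sum>i\<in>I. (T x \<bullet> b i)\<^sup>2)"
    unfolding norm_power2_Basis by (rule sum.reindex_bij_betw[OF b, symmetric])
  also have "\<dots> = (\<Sum>i\<in>I. (x \<bullet> a i)\<^sup>2)"
    by (intro sum.cong refl) (use c in \<open>force simp: T\<close>)
  also have "\<dots> = (norm x)\<^sup>2"
    unfolding norm_power2_Basis by (rule sum.reindex_bij_betw[OF a])
  finally show ?thesis by simp
qed

lemma bij_betw_axis: "bij \<pi> \<Longrightarrow> bij_betw (\<lambda>(k, u). axis (\<pi> k) u) (UNIV \<times> Basis) (Basis :: ('a::euclidean_space^'n) set)"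
proof -
  assume \<pi>: "bij \<pi>"
  have "inj_on (\<lambda>(k, u). axis (\<pi> k) u) (UNIV \<times> (Basis :: 'a set))"
    using \<pi> by (auto simp: inj_on_def axis_eq_axis bij_def)
  moreover have "(\<lambda>(k, u). axis (\<pi> k) u) ` (UNIV \<times> (Basis :: 'a set)) = (Basis :: ('a^'n) set)"
  proof safe
    fix x :: "'a^'n" assume "x \<in> Basis"
    then obtain i u where "x = axis i u" "u \<in> Basis" by (auto simp: Basis_vec_def)
    moreover obtain k where "i = \<pi> k" using \<pi> by (metis bij_pointE)
    ultimately show "x \<in> (\<lambda>(k, u). axis (\<pi> k) u) ` (UNIV \<times> (Basis :: 'a set))" by auto
  qed (auto simp: Basis_vec_def)
  ultimately show ?thesis by (simp add: bij_betw_def)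
qed

lemma bij_betw_axis_axis:
  assumes "bij \<pi>"
  shows "bij_betw (\<lambda>(i, k, u). axis i (axis (\<pi> k) u)) (UNIV \<times> UNIV \<times> Basis) (Basis :: ('a::euclidean_space^'t^'r) set)"
proof -
  have "bij_betw (map_prod id (\<lambda>(k, u). axis (\<pi> k) u)) (UNIV \<times> UNIV \<times> Basis) (UNIV \<times> (Basis :: ('a^'t) set))"
    by (intro bij_betw_map_prod bij_betw_axis assms bij_id)
  from bij_betw_trans[OF this bij_betw_axis[of id]]
  show ?thesis by (simp add: comp_def case_prod_unfold)
qed

lemma inner_axis_axis': "(x :: 'a::euclidean_space^'t^'r) \<bullet> axis i (axis k u) = x $ i $ k \<bullet> u"
  by (simp add: inner_axis)

text \<open>For a bijection \<open>\<pi>\<close> and signs \<open>e\<close>, multiplication of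
  \<open>g\<close> on the right by a signed permutation matrix, written entrywise.\<close>

definition column_action :: "('t \<Rightarrow> real) \<Rightarrow> ('t \<Rightarrow> 't) \<Rightarrow> complex^'t^'r \<Rightarrow> complex^'t^'r" where
  "column_action e \<pi> g = (\<chi> i k. e k *\<^sub>R g $ i $ \<pi> k)"

lemma measurable_column_action [measurable]: "column_action e \<pi> \<in> borel_measurable borel"
  unfolding column_action_def[abs_def] by measurable

lemma
  fixes e :: "'t::finite \<Rightarrow> real"
  assumes "bij \<pi>" and "\<And>k. e k = 1 \<or> e k = -1"
  shows lborel_distr_column_action: "distr lborel borel (column_action e \<pi> :: complex^'t^'r \<Rightarrow> _) = lborel"
    and norm_column_action: "norm (column_action e \<pi> (g :: complex^'t^'r)) = norm g"
proof -
  note sp = bij_betw_axis_axis[OF assms(1)] bij_betw_axis_axis[OF bij_id, unfolded id_apply]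
  show "distr lborel borel (column_action e \<pi> :: complex^'t^'r \<Rightarrow> _) = lborel"
    by (rule lborel_distr_signed_permutation[OF sp, where c="\<lambda>(i, k, u). e k"])
       (use assms(2) in \<open>auto simp: inner_axis_axis' column_action_def\<close>)
  show "norm (column_action e \<pi> g) = norm g"
    by (rule norm_signed_permutation[OF sp, where c="\<lambda>(i, k, u). e k"])
       (use assms(2) in \<open>auto simp: inner_axis_axis' column_action_def\<close>)
qed

definition flip :: "'n \<Rightarrow> complex^'n \<Rightarrow> complex^'n" where
  "flip k x = (\<chi> j. (if j = k then -1 else 1) *\<^sub>R x $ j)"

lemma measurable_flip [measurable]: "flip k \<in> borel_measurable borel"
  unfolding flip_def[abs_def] by measurable

lemma lborel_distr_flip: "distr lborel borel (flip k) = (lborel :: (complex^'n) measure)"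
  and norm_flip: "norm (flip k x) = norm (x :: complex^'n)"
proof -
  note sp = bij_betw_axis[OF bij_id, unfolded id_apply]
  show "distr lborel borel (flip k) = (lborel :: (complex^'n) measure)"
    by (rule lborel_distr_signed_permutation[OF sp sp, where c="\<lambda>(j, u). if j = k then -1 else 1"])
       (auto simp: inner_axis flip_def)
  show "norm (flip k x) = norm x"
    by (rule norm_signed_permutation[OF sp sp, where c="\<lambda>(j, u). if j = k then -1 else 1"])
       (auto simp: inner_axis flip_def)
qed

text \<open>Characterised by the parallelogram law and homogeneity instead of a matrix: both
  conditions are linear in \<open>f\<close> and hence survive averaging over the gains.\<close>

definition hermitian_form :: "(complex^'n \<Rightarrow> real) \<Rightarrow> bool" where
  "hermitian_form f \<longleftrightarrow> (\<forall>x y. f (x + y) + f (x - y) = 2 * f x + 2 * f y) \<and>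
     (\<forall>c x. f (c *s x) = (cmod c)\<^sup>2 * f x)"

lemma hermitian_form_quad: "hermitian_form (\<lambda>x. quad K (h *v x))"
  unfolding hermitian_form_def
  by (auto simp: vector_scalar_commute quad_scaleR_mult matrix_vector_right_distrib matrix_vector_mult_diff_distrib)
     (simp add: quad_def matrix_vector_right_distrib matrix_vector_mult_diff_distrib
        cdot_add_left cdot_add_right cdot_diff_left cdot_diff_right)

lemma hermitian_form_zero: "hermitian_form f \<Longrightarrow> f 0 = 0"
proof -
  assume "hermitian_form f"
  then have "f (0 + 0) + f (0 - 0) = 2 * f 0 + 2 * f 0"
    unfolding hermitian_form_def by blast
  then show ?thesis by simp
qed

definition zero_on :: "'n set \<Rightarrow> complex^'n \<Rightarrow> complex^'n" where
  "zero_on S x = (\<chi> j. if j \<in> S then 0 else x $ j)"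

lemma measurable_zero_on [measurable]: "zero_on S \<in> borel_measurable borel"
  unfolding zero_on_def[abs_def] by measurable

text \<open>The parallelogram law for the vector without coordinate \<open>k\<close> and for
  coordinate \<open>k\<close> alone: the flip turns their sum into their difference.\<close>

lemma hermitian_form_flip:
  assumes f: "hermitian_form f" and k: "k \<notin> S"
  shows "f (zero_on S x) + f (zero_on S (flip k x)) =
    2 * f (zero_on (insert k S) x) + 2 * ((cmod (x $ k))\<^sup>2 * f (axis k 1))"
proof -
  let ?y = "zero_on (insert k S) x" and ?z = "x $ k *s axis k 1"
  have "zero_on S x = ?y + ?z" "zero_on S (flip k x) = ?y - ?z"
    using k by (auto simp: vec_eq_iff zero_on_def flip_def axis_def)
  then show ?thesis using f by (simp add: hermitian_form_def)
qed

text \<open>Averaging over sign flips of the coordinates removes the off-diagonal terms of a form.\<close>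

lemma hermitian_form_flip_invariant:
  assumes f: "hermitian_form f" and inv: "\<And>k x. f (flip k x) = f x"
  shows "f x = (\<Sum>k\<in>UNIV. (cmod (x $ k))\<^sup>2 * f (axis k 1))"
proof -
  have "f x = f (zero_on S x) + (\<Sum>k\<in>S. (cmod (x $ k))\<^sup>2 * f (axis k 1))" if "finite S" for S
    using that
  proof (induction S)
    case empty
    have "zero_on {} x = x" by (simp add: zero_on_def)
    then show ?case by simp
  next
    case (insert k S)
    have "zero_on S (flip k x) = flip k (zero_on S x)"
      by (auto simp: vec_eq_iff zero_on_def flip_def)
    then show ?case
      using insert hermitian_form_flip[OF f insert(2), of x] inv[of k "zero_on S x"] by simp
  qed
  moreover have "zero_on UNIV x = 0" by (simp add: zero_on_def vec_eq_iff)
  ultimately show ?thesis using hermitian_form_zero[OF f] by (metis add_0 finite)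
qed

lemma nn_integral_cgd_coordinate:
  fixes k :: "'n::finite"
  assumes v: "0 < v"
  shows "(\<integral>\<^sup>+x. ennreal (complex_gaussian_density (v *\<^sub>R mat 1) x) * ennreal ((cmod ((x :: complex^'n) $ k))\<^sup>2) \<partial>lborel) = ennreal v"
proof -
  let ?c = "1 / (pi * v) ^ CARD('n)" and ?e = "\<lambda>x :: complex^'n. exp (- ((norm x)\<^sup>2 / v))"
  have c: "0 \<le> ?c" using v by simp
  have d: "complex_gaussian_density (v *\<^sub>R mat 1) x = ?c * ?e x" for x :: "complex^'n"
    using v by (simp add: complex_gaussian_density_quad quad_scalar det_scaleR_mat power_mult_distrib)
  have m: "(\<integral>\<^sup>+x. ennreal (?e x * (x \<bullet> i)\<^sup>2) \<partial>lborel) = ennreal ((pi * v) ^ CARD('n) * (v / 2))" if "i \<in> Basis" for i :: "complex^'n"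
    using nn_integral_gauss_second_moment[of "1 / v", OF _ that] v
    unfolding DIM_complex_vec by (simp add: sqrt_power_double)
  have s: "(cmod (x $ k))\<^sup>2 = (x \<bullet> axis k 1)\<^sup>2 + (x \<bullet> axis k \<i>)\<^sup>2" for x :: "complex^'n"
    by (simp add: inner_axis cmod_power2 inner_complex_def)
  have b: "axis k 1 \<in> (Basis :: (complex^'n) set)" "axis k \<i> \<in> (Basis :: (complex^'n) set)"
    by (auto simp: Basis_vec_def Basis_complex_def)
  have "ennreal (complex_gaussian_density (v *\<^sub>R mat 1) x) * ennreal ((cmod (x $ k))\<^sup>2) =
      ennreal ?c * (ennreal (?e x * (x \<bullet> axis k 1)\<^sup>2) + ennreal (?e x * (x \<bullet> axis k \<i>)\<^sup>2))" for x :: "complex^'n"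
    using c unfolding d s by (simp add: ennreal_mult[symmetric] ennreal_plus[symmetric] algebra_simps add_divide_distrib del: ennreal_plus)
  then have "(\<integral>\<^sup>+x. ennreal (complex_gaussian_density (v *\<^sub>R mat 1) x) * ennreal ((cmod ((x :: complex^'n) $ k))\<^sup>2) \<partial>lborel) =
      ennreal ?c * (ennreal ((pi * v) ^ CARD('n) * (v / 2)) + ennreal ((pi * v) ^ CARD('n) * (v / 2)))"
    by (simp only:) (simp add: nn_integral_cmult nn_integral_add m[OF b(1)] m[OF b(2)] del: ennreal_plus)
  also have "\<dots> = ennreal v"
    using v by (simp add: ennreal_mult[symmetric] ennreal_plus[symmetric] del: ennreal_plus)
  finally show ?thesis .
qed

text \<open>The sum is the trace of the form. As the density is invariant under sign flips,
  coordinates can be split off one at a time without cross terms; \<open>S\<close> holds those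
  already split off.\<close>

lemma nn_integral_cgd_form:
  fixes f :: "complex^'n \<Rightarrow> real"
  assumes v: "0 < v" and f: "hermitian_form f" and nonneg: "\<And>x. 0 \<le> f x"
    and [measurable]: "f \<in> borel_measurable borel"
  shows "(\<integral>\<^sup>+x. ennreal (complex_gaussian_density (v *\<^sub>R mat 1) x) * ennreal (f x) \<partial>lborel) =
    ennreal (v * (\<Sum>k\<in>UNIV. f (axis k 1)))"
proof -
  let ?D = "\<lambda>x :: complex^'n. ennreal (complex_gaussian_density (v *\<^sub>R mat 1) x)"
  have flip_inv: "(\<integral>\<^sup>+x. ?D x * F (flip k x) \<partial>lborel) = (\<integral>\<^sup>+x. ?D x * F x \<partial>lborel)"
    if [measurable]: "F \<in> borel_measurable borel" for F :: "complex^'n \<Rightarrow> ennreal" and k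
  proof -
    have "(\<integral>\<^sup>+x. ?D x * F x \<partial>lborel) = (\<integral>\<^sup>+x. ?D x * F x \<partial>distr lborel borel (flip k))"
      by (simp add: lborel_distr_flip)
    also have "\<dots> = (\<integral>\<^sup>+x. ?D (flip k x) * F (flip k x) \<partial>lborel)"
      by (simp add: nn_integral_distr)
    also have "\<dots> = (\<integral>\<^sup>+x. ?D x * F (flip k x) \<partial>lborel)"
      using v by (simp add: complex_gaussian_density_quad quad_scalar norm_flip)
    finally show ?thesis by simp
  qed
  have "(\<integral>\<^sup>+x. ?D x * ennreal (f x) \<partial>lborel) =
      (\<integral>\<^sup>+x. ?D x * ennreal (f (zero_on S x)) \<partial>lborel) + ennreal (v * (\<Sum>k\<in>S. f (axis k 1)))" if "finite S" for S
    using that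
  proof (induction S)
    case empty
    have "zero_on {} x = x" for x :: "complex^'n" by (simp add: zero_on_def)
    then show ?case by simp
  next
    case (insert k S)
    let ?A = "\<integral>\<^sup>+x. ?D x * ennreal (f (zero_on S x)) \<partial>lborel"
    let ?B = "\<integral>\<^sup>+x. ?D x * ennreal (f (zero_on (insert k S) x)) \<partial>lborel"
    \<comment> \<open>Doubling the integral makes room for the parallelogram law and avoids
      subtraction in \<open>ennreal\<close>; the factor 2 is cancelled at the end.\<close>
    have "2 * ?A = ?A + (\<integral>\<^sup>+x. ?D x * ennreal (f (zero_on S (flip k x))) \<partial>lborel)"
      using flip_inv[of "\<lambda>x. ennreal (f (zero_on S x))" k] by (simp add: mult_2)
    also have "\<dots> = (\<integral>\<^sup>+x. ?D x * ennreal (f (zero_on S x) + f (zero_on S (flip k x))) \<partial>lborel)"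
      by (simp add: nonneg distrib_left nn_integral_add)
    also have "\<dots> = (\<integral>\<^sup>+x. 2 * (?D x * ennreal (f (zero_on (insert k S) x))) +
        2 * ((?D x * ennreal ((cmod (x $ k))\<^sup>2)) * ennreal (f (axis k 1))) \<partial>lborel)"
      unfolding hermitian_form_flip[OF f insert(2)]
      by (simp add: nonneg distrib_left ennreal_mult mult_ac)
    also have "\<dots> = 2 * ?B + 2 * (ennreal v * ennreal (f (axis k 1)))"
      by (simp add: nn_integral_add nn_integral_cmult nn_integral_multc nn_integral_cgd_coordinate[OF v])
    also have "\<dots> = 2 * (?B + ennreal (v * f (axis k 1)))"
      using v nonneg by (simp add: distrib_left ennreal_mult)
    finally have "?A = ?B + ennreal (v * f (axis k 1))"
      by (simp only: ennreal_mult_cancel_left) simp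
    then show ?case
      using insert v nonneg by (simp add: distrib_left sum_nonneg add_ac)
  qed
  from this[of UNIV] show ?thesis
    using hermitian_form_zero[OF f] by (simp add: zero_on_def zero_vec_def[symmetric])
qed


section \<open>Single-letter information quantities\<close>

text \<open>The noise law is invariant under \<open>z \<mapsto> - z\<close>, so
  \<open>quad K (a + z)\<close> may be averaged with \<open>quad K (a - z)\<close>; the
  parallelogram law then removes the cross term.\<close>

lemma nn_integral_cgd_shift_quad:
  fixes K :: "complex^'n^'n"
  assumes v: "0 < v" and K: "pos_def K"
  shows "(\<integral>\<^sup>+z. ennreal (complex_gaussian_density (v *\<^sub>R mat 1) (z - a)) * ennreal (quad K z) \<partial>lborel) =
    ennreal (quad K a + v * (\<Sum>i\<in>UNIV. quad K (axis i 1)))"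
proof -
  let ?D = "\<lambda>z :: complex^'n. ennreal (complex_gaussian_density (v *\<^sub>R mat 1) z)"
  have cv: "cov (v *\<^sub>R mat 1 :: complex^'n^'n)" using v by (rule cov.scalar)
  have nn: "0 \<le> quad K z" for z by (rule quad_nonneg[OF K])
  let ?L = "\<integral>\<^sup>+z. ?D (z - a) * ennreal (quad K z) \<partial>lborel"
  have 1: "?L = (\<integral>\<^sup>+z. ?D z * ennreal (quad K (a + z)) \<partial>lborel)"
    using nn_integral_lborel_translate[of "\<lambda>z. ?D (z - a) * ennreal (quad K z)" a] by simp
  have "distr lborel borel uminus = (lborel :: (complex^'n) measure)"
    by (rule lborel_distr_signed_permutation[of id Basis id "\<lambda>_. -1"]) auto
  then have "(\<integral>\<^sup>+z. ?D z * ennreal (quad K (a + z)) \<partial>lborel) =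
      (\<integral>\<^sup>+z. ?D z * ennreal (quad K (a + z)) \<partial>distr lborel borel uminus)"
    by simp
  also have "\<dots> = (\<integral>\<^sup>+z. ?D z * ennreal (quad K (a - z)) \<partial>lborel)"
    by (subst nn_integral_distr) (auto simp: complex_gaussian_density_quad quad_scalar v[THEN less_imp_neq, symmetric])
  finally have 2: "?L = (\<integral>\<^sup>+z. ?D z * ennreal (quad K (a - z)) \<partial>lborel)" using 1 by simp
  have qf: "hermitian_form (quad K)" using hermitian_form_quad[of K "mat 1"] by simp
  have "2 * ?L = (\<integral>\<^sup>+z. ?D z * ennreal (quad K (a + z)) \<partial>lborel) + (\<integral>\<^sup>+z. ?D z * ennreal (quad K (a - z)) \<partial>lborel)"
    using 1 2 by (simp add: mult_2)
  also have "\<dots> = (\<integral>\<^sup>+z. ?D z * ennreal (quad K (a + z)) + ?D z * ennreal (quad K (a - z)) \<partial>lborel)"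
    by (rule nn_integral_add[symmetric]) measurable
  also have "\<dots> = (\<integral>\<^sup>+z. 2 * (?D z * ennreal (quad K a) + ?D z * ennreal (quad K z)) \<partial>lborel)"
  proof (intro nn_integral_cong)
    fix z
    have "ennreal (quad K (a + z)) + ennreal (quad K (a - z)) = ennreal (2 * quad K a + 2 * quad K z)"
      using qf nn by (simp add: hermitian_form_def ennreal_plus[symmetric] del: ennreal_plus)
    also have "\<dots> = 2 * (ennreal (quad K a) + ennreal (quad K z))"
      using nn by (simp add: distrib_left ennreal_mult)
    finally show "?D z * ennreal (quad K (a + z)) + ?D z * ennreal (quad K (a - z)) =
        2 * (?D z * ennreal (quad K a) + ?D z * ennreal (quad K z))"
      by (simp only: distrib_left[symmetric] mult.left_commute)
  qed
  also have "\<dots> = 2 * ((\<integral>\<^sup>+z. ?D z * ennreal (quad K a) \<partial>lborel) + (\<integral>\<^sup>+z. ?D z * ennreal (quad K z) \<partial>lborel))"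
    by (subst nn_integral_cmult) (auto simp: nn_integral_add)
  also have "(\<integral>\<^sup>+z. ?D z * ennreal (quad K a) \<partial>lborel) = ennreal (quad K a)"
    by (simp add: nn_integral_multc nn_integral_cgd[OF cv])
  also have "(\<integral>\<^sup>+z. ?D z * ennreal (quad K z) \<partial>lborel) = ennreal (v * (\<Sum>i\<in>UNIV. quad K (axis i 1)))"
    by (rule nn_integral_cgd_form[OF v qf nn]) measurable
  finally show ?thesis
    using v nn by (simp only: ennreal_mult_cancel_left) (simp add: sum_nonneg)
qed

text \<open>The density is written as a mixture over a standard Gaussian input by
  \<open>cgd_convolution\<close>; after exchanging the integrals, the inner mean is a shifted noise
  mean and the outer one the mean of a form.\<close>

lemma nn_integral_cgd_quad:
  fixes h :: "complex^'t^'r"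
  assumes v: "0 < v" and K: "pos_def K"
  shows "(\<integral>\<^sup>+z. ennreal (complex_gaussian_density (v *\<^sub>R mat 1 + h ** herm h) z) * ennreal (quad K z) \<partial>lborel) =
    ennreal (v * (\<Sum>i\<in>UNIV. quad K (axis i 1)) + (\<Sum>k\<in>UNIV. quad K (h *v axis k 1)))"
proof -
  let ?I = "\<lambda>s :: complex^'t. ennreal (complex_gaussian_density (mat 1) s)"
  let ?D = "\<lambda>z :: complex^'r. ennreal (complex_gaussian_density (v *\<^sub>R mat 1) z)"
  let ?m = "v * (\<Sum>i\<in>UNIV. quad K (axis i 1))"
  have nn: "0 \<le> quad K z" for z by (rule quad_nonneg[OF K])
  have m: "0 \<le> ?m" using v nn by (simp add: sum_nonneg)
  have "(\<integral>\<^sup>+z. ennreal (complex_gaussian_density (v *\<^sub>R mat 1 + h ** herm h) z) * ennreal (quad K z) \<partial>lborel) =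
      (\<integral>\<^sup>+z. (\<integral>\<^sup>+s. ?I s * ?D (z - h *v s) \<partial>lborel) * ennreal (quad K z) \<partial>lborel)"
    by (simp add: cgd_convolution[OF cov.scalar[OF v]])
  also have "\<dots> = (\<integral>\<^sup>+z. (\<integral>\<^sup>+s. ?I s * ?D (z - h *v s) * ennreal (quad K z) \<partial>lborel) \<partial>lborel)"
    by (intro nn_integral_cong nn_integral_multc[symmetric]) measurable
  also have "\<dots> = (\<integral>\<^sup>+s. (\<integral>\<^sup>+z. ?I s * ?D (z - h *v s) * ennreal (quad K z) \<partial>lborel) \<partial>lborel)"
    by (rule lborel_pair.Fubini'[symmetric]) measurable
  also have "\<dots> = (\<integral>\<^sup>+s. ?I s * ennreal (quad K (h *v s) + ?m) \<partial>lborel)"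
    by (simp only: mult.assoc) (subst nn_integral_cmult, measurable, simp only: nn_integral_cgd_shift_quad[OF v K])
  also have "\<dots> = (\<integral>\<^sup>+s. ?I s * ennreal (quad K (h *v s)) \<partial>lborel) + (\<integral>\<^sup>+s. ?I s * ennreal ?m \<partial>lborel)"
    using m nn by (simp add: distrib_left nn_integral_add)
  also have "(\<integral>\<^sup>+s. ?I s * ennreal (quad K (h *v s)) \<partial>lborel) = ennreal (\<Sum>k\<in>UNIV. quad K (h *v axis k 1))"
    using nn_integral_cgd_form[of 1 "\<lambda>s. quad K (h *v s)"] nn by (simp add: hermitian_form_quad)
  also have "(\<integral>\<^sup>+s. ?I s * ennreal ?m \<partial>lborel) = ennreal ?m"
    by (subst nn_integral_multc) (auto simp: nn_integral_cgd)
  finally show ?thesis using m nn by (simp add: sum_nonneg add.commute)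
qed

lemma sum_quad_axis:
  "(\<Sum>k\<in>UNIV. quad K (h *v axis k 1)) = Re (trace (matrix_inv K ** (h ** herm h)))"
  for h :: "complex^'t^'r"
proof -
  have c: "h *v axis k 1 = (\<chi> i. h $ i $ k)" for k
    by (simp add: matrix_vector_mult_def axis_def vec_eq_iff if_distrib cong: if_cong)
  have "cdot (h *v axis k 1) (matrix_inv K *v (h *v axis k 1)) = (herm h ** (matrix_inv K ** h)) $ k $ k" for k
    unfolding c cdot_def by (simp add: matrix_matrix_mult_def matrix_vector_mult_def herm_def)
  then have "(\<Sum>k\<in>UNIV. quad K (h *v axis k 1)) = Re (trace (herm h ** (matrix_inv K ** h)))"
    by (simp add: quad_def trace_def)
  also have "trace (herm h ** (matrix_inv K ** h)) = trace (matrix_inv K ** (h ** herm h))"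
    by (subst trace_mul_sym) (simp add: matrix_mul_assoc)
  finally show ?thesis .
qed

lemma trace_scaleR: "trace (r *\<^sub>R A) = complex_of_real r * trace (A :: complex^'n^'n)"
  unfolding trace_def vector_scaleR_component sum_distrib_left by (simp add: scaleR_conv_of_real[of r "_ $ _ $ _"])

text \<open>The trace of \<open>matrix_inv K ** K\<close>, split into noise and signal parts. By
  \<open>nn_integral_cgd_quad\<close> it is the mean of \<open>quad K\<close> under the Gaussian law
  of covariance \<open>K\<close> itself.\<close>

lemma sum_quad_self:
  fixes h :: "complex^'t^'r"
  assumes v: "0 < v"
  defines "K \<equiv> v *\<^sub>R mat 1 + h ** herm h"
  shows "v * (\<Sum>i\<in>UNIV. quad K (axis i 1)) + (\<Sum>k\<in>UNIV. quad K (h *v axis k 1)) = real CARD('r)"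
proof -
  have K: "det K \<noteq> 0"
    unfolding K_def by (intro pos_def_det_nz cov_pos_def cov_add_gram cov.scalar v)
  have "(\<Sum>i\<in>UNIV. quad K (axis i 1)) = Re (trace (matrix_inv K))"
    using sum_quad_axis[of K "mat 1"] by simp
  then have "v * (\<Sum>i\<in>UNIV. quad K (axis i 1)) = Re (trace (matrix_inv K ** (v *\<^sub>R mat 1)))"
    by (simp add: matrix_mult_scaleR trace_scaleR)
  then have "v * (\<Sum>i\<in>UNIV. quad K (axis i 1)) + (\<Sum>k\<in>UNIV. quad K (h *v axis k 1)) =
      Re (trace (matrix_inv K ** K))"
    unfolding sum_quad_axis[of K h] by (subst (3) K_def) (simp add: matrix_add_ldistrib trace_add)
  then show ?thesis by (simp add: matrix_inv_left[OF K] trace_I)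
qed

text \<open>This is Gibbs' inequality for two Gaussian laws.\<close>

lemma ln_det_tangent:
  fixes h :: "complex^'t^'r" and K :: "complex^'r^'r"
  assumes v: "0 < v" and K: "cov K"
  shows "ln (Re (det (v *\<^sub>R mat 1 + h ** herm h))) \<le> ln (Re (det K)) +
    (v * (\<Sum>i\<in>UNIV. quad K (axis i 1)) + (\<Sum>k\<in>UNIV. quad K (h *v axis k 1))) - real CARD('r)"
proof -
  define H where "H = v *\<^sub>R mat 1 + h ** herm h"
  have H: "cov H" unfolding H_def by (intro cov_add_gram cov.scalar v)
  let ?DH = "complex_gaussian_density H" and ?DK = "complex_gaussian_density K"
  define m where "m = v * (\<Sum>i\<in>UNIV. quad K (axis i 1)) + (\<Sum>k\<in>UNIV. quad K (h *v axis k 1))"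
  define c where "c = ln (Re (det H)) - ln (Re (det K))"
  have m: "0 \<le> m"
    unfolding m_def using v K by (intro add_nonneg_nonneg mult_nonneg_nonneg sum_nonneg quad_nonneg cov_pos_def) auto
  have iK: "has_bochner_integral lborel (\<lambda>z. ?DH z * quad K z) m"
    by (rule has_bochner_integral_nn_integral)
       (use nn_integral_cgd_quad[OF v cov_pos_def[OF K], of h] m quad_nonneg[OF cov_pos_def[OF K]] cgd_pos[OF H]
        in \<open>auto simp: H_def m_def ennreal_mult[symmetric] less_imp_le\<close>)
  have iH: "has_bochner_integral lborel (\<lambda>z. ?DH z * quad H z) (real CARD('r))"
    by (rule has_bochner_integral_nn_integral)
       (use nn_integral_cgd_quad[OF v cov_pos_def[OF H], of h] sum_quad_self[OF v, of h]
          quad_nonneg[OF cov_pos_def[OF H]] cgd_pos[OF H]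
        in \<open>auto simp: H_def ennreal_mult[symmetric] less_imp_le\<close>)
  have "has_bochner_integral lborel (complex_gaussian_density L) 1" if "cov L" for L :: "complex^'r^'r"
    by (rule has_bochner_integral_nn_integral) (use nn_integral_cgd[OF that] cgd_pos[OF that] in \<open>auto simp: less_imp_le\<close>)
  note i1 = this[OF H] this[OF K]
  \<comment> \<open>This is \<open>ln x \<le> x - 1\<close> at the ratio of the two densities,
    multiplied by \<open>?DH z\<close>. The right side integrates to 0, the left side to minus the
    relative entropy.\<close>
  have le: "?DH z * quad H z - ?DH z * quad K z + c * ?DH z \<le> ?DK z - ?DH z" for z
  proof -
    note d = cov_det(1)[OF H] cov_det(1)[OF K]
    have "ln (?DK z / ?DH z) = quad H z - quad K z + c"
      using d by (simp add: complex_gaussian_density_quad c_def ln_div ln_mult)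
    moreover have "ln (?DK z / ?DH z) \<le> ?DK z / ?DH z - 1"
      using cgd_pos[OF H, of z] cgd_pos[OF K, of z] by (intro ln_le_minus_one) simp
    ultimately have "?DH z * (quad H z - quad K z + c) \<le> ?DH z * (?DK z / ?DH z - 1)"
      using cgd_pos[OF H, of z] by (intro mult_left_mono) auto
    then show ?thesis using cgd_pos[OF H, of z] by (simp add: algebra_simps)
  qed
  have "has_bochner_integral lborel (\<lambda>z. ?DH z * quad H z - ?DH z * quad K z + c * ?DH z) (real CARD('r) - m + c * 1)"
    by (intro has_bochner_integral_add has_bochner_integral_diff has_bochner_integral_mult_right iH iK i1)
  moreover have "has_bochner_integral lborel (\<lambda>z. ?DK z - ?DH z) (1 - 1)"
    by (intro has_bochner_integral_diff i1)
  ultimately have "real CARD('r) - m + c * 1 \<le> 1 - 1"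
    using le by (metis (no_types, lifting) has_bochner_integral_iff integral_mono)
  then show ?thesis by (simp add: c_def m_def H_def)
qed

text \<open>The standard complex Gaussian law directly on the matrix space, where
  \<open>norm g\<close> is the Frobenius norm. All expectations over a single gain are transported
  to it.\<close>

definition rayleigh :: "(complex^'t^'r) measure" where
  "rayleigh = density lborel (\<lambda>g. ennreal (exp (- (norm g)\<^sup>2) / pi ^ (CARD('t) * CARD('r))))"

lemma sets_rayleigh [measurable_cong, simp]: "sets rayleigh = sets borel"
  and space_rayleigh [simp]: "space rayleigh = UNIV"
  by (simp_all add: rayleigh_def)

lemma nn_integral_rayleigh:
  "f \<in> borel_measurable borel \<Longrightarrow> (\<integral>\<^sup>+g. f g \<partial>rayleigh) =
    (\<integral>\<^sup>+g. ennreal (exp (- (norm g)\<^sup>2) / pi ^ (CARD('t) * CARD('r))) * f (g :: complex^'t^'r) \<partial>lborel)"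
  unfolding rayleigh_def by (rule nn_integral_density) auto

lemma DIM_complex_mat: "DIM(complex^'t^'r) = 2 * (CARD('t) * CARD('r))"
  by simp

lemma prob_space_rayleigh: "prob_space (rayleigh :: (complex^'t^'r) measure)"
proof (rule prob_spaceI)
  let ?c = "pi ^ (CARD('t) * CARD('r))"
  have "emeasure (rayleigh :: (complex^'t^'r) measure) UNIV =
      (\<integral>\<^sup>+g. ennreal (exp (- 1 * (norm (g :: complex^'t^'r))\<^sup>2)) * ennreal (1 / ?c) \<partial>lborel)"
    by (simp add: rayleigh_def emeasure_density ennreal_mult[symmetric])
  also have "\<dots> = ennreal (sqrt pi ^ DIM(complex^'t^'r)) * ennreal (1 / ?c)"
    by (subst nn_integral_multc) (simp, simp only: nn_integral_gauss[of 1] zero_less_one div_by_1)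
  also have "\<dots> = 1"
    unfolding DIM_complex_mat by (subst sqrt_power_double) (auto simp: ennreal_mult[symmetric])
  finally show "emeasure (rayleigh :: (complex^'t^'r) measure) (space rayleigh) = 1" by simp
qed

lemma integrable_rayleigh_norm2: "integrable rayleigh (\<lambda>g :: complex^'t^'r. (norm g)\<^sup>2)"
proof (rule integrableI_bounded)
  let ?c = "pi ^ (CARD('t) * CARD('r))"
  have "(\<integral>\<^sup>+g. ennreal (norm ((norm (g :: complex^'t^'r))\<^sup>2)) \<partial>rayleigh) =
      (\<integral>\<^sup>+g. (\<Sum>b\<in>Basis. ennreal (exp (- 1 * (norm (g :: complex^'t^'r))\<^sup>2) * (g \<bullet> b)\<^sup>2) * ennreal (1 / ?c)) \<partial>lborel)"
    by (subst nn_integral_rayleigh, simp, intro nn_integral_cong)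
       (simp add: ennreal_mult[symmetric] sum_divide_distrib[symmetric] sum_distrib_left[symmetric] norm_power2_Basis[symmetric])
  also have "\<dots> = (\<Sum>b\<in>(Basis :: (complex^'t^'r) set). (\<integral>\<^sup>+g. ennreal (exp (- 1 * (norm (g :: complex^'t^'r))\<^sup>2) * (g \<bullet> b)\<^sup>2) * ennreal (1 / ?c) \<partial>lborel))"
    by (rule nn_integral_sum) measurable
  also have "\<dots> = (\<Sum>b\<in>(Basis :: (complex^'t^'r) set). ennreal (sqrt (pi / 1) ^ DIM(complex^'t^'r) / (2 * 1)) * ennreal (1 / ?c))"
    by (intro sum.cong refl, subst nn_integral_multc, measurable, subst nn_integral_gauss_second_moment) simp_all
  also have "\<dots> < \<infinity>"
    by (simp add: ennreal_mult[symmetric] ennreal_of_nat_eq_real_of_nat ennreal_mult_less_top del: sum_constant) 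
  finally show "(\<integral>\<^sup>+g. ennreal (norm ((norm (g :: complex^'t^'r))\<^sup>2)) \<partial>rayleigh) < \<infinity>" .
qed simp

text \<open>The density depends on \<open>norm g\<close> alone, and a signed permutation of columns
  preserves both the norm and Lebesgue measure.\<close>

lemma distr_rayleigh_column_action:
  assumes "bij \<pi>" and "\<And>k. e k = 1 \<or> e k = (-1 :: real)"
  shows "distr rayleigh borel (column_action e \<pi>) = (rayleigh :: (complex^'t^'r) measure)"
proof -
  have "distr (density lborel (\<lambda>g. ennreal (exp (- (norm (column_action e \<pi> g))\<^sup>2) / pi ^ (CARD('t) * CARD('r))))) borel (column_action e \<pi>)
      = density (distr lborel borel (column_action e \<pi>)) (\<lambda>g :: complex^'t^'r. ennreal (exp (- (norm g)\<^sup>2) / pi ^ (CARD('t) * CARD('r))))"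
    by (rule density_distr[symmetric]) auto
  then show ?thesis
    using assms unfolding rayleigh_def
    by (simp add: norm_column_action lborel_distr_column_action)
qed

text \<open>The covariance of the output at gain \<open>g\<close> when the input is Gaussian with
  power \<open>p\<close> on each transmit antenna and the noise variance is \<open>v\<close>. The
  power is absorbed into the matrix so that the results on \<open>h ** herm h\<close> apply.\<close>

definition out_cov :: "real \<Rightarrow> real \<Rightarrow> complex^'t^'r \<Rightarrow> complex^'r^'r" where
  "out_cov v p g = v *\<^sub>R mat 1 + (sqrt p *\<^sub>R g) ** herm (sqrt p *\<^sub>R g)"

lemma cov_out_cov: "0 < v \<Longrightarrow> cov (out_cov v p g)"
  unfolding out_cov_def by (intro cov_add_gram cov.scalar)

lemma measurable_out_cov [measurable]: "out_cov v p \<in> borel_measurable borel"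
  unfolding out_cov_def[abs_def] by measurable

lemma out_cov_column_action:
  assumes "bij \<pi>" and e: "\<And>k. e k = 1 \<or> e k = (-1 :: real)"
  shows "out_cov v p (column_action e \<pi> g) = out_cov v p g"
proof -
  have ee: "e k * e k = 1" for k using e[of k] by auto
  have "(\<Sum>k\<in>UNIV. (e k *\<^sub>R (g $ i $ \<pi> k)) * cnj (e k *\<^sub>R (g $ j $ \<pi> k))) = (\<Sum>k\<in>UNIV. g $ i $ k * cnj (g $ j $ k))" for i j
    using sum.reindex_bij_betw[of \<pi> UNIV UNIV "\<lambda>k. g $ i $ k * cnj (g $ j $ k)"] assms(1)
    by (simp add: ee)
  then have "column_action e \<pi> g ** herm (column_action e \<pi> g) = g ** herm g"
    by (simp add: vec_eq_iff matrix_matrix_mult_def herm_def column_action_def)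
  then show ?thesis
    by (simp add: out_cov_def herm_scaleR scaleR_matrix_mult matrix_mult_scaleR)
qed

text \<open>The part of \<open>quad (out_cov v p g) (g t + \<xi>)\<close> that is due to the signal \<open>t\<close>.\<close>

definition signal_quad :: "real \<Rightarrow> real \<Rightarrow> complex^'t \<Rightarrow> complex^'t^'r \<Rightarrow> real" where
  "signal_quad v p t g = quad (out_cov v p g) (g *v t)"

lemma measurable_signal_quad [measurable]: "0 < v \<Longrightarrow> signal_quad v p t \<in> borel_measurable borel"
  unfolding signal_quad_def[abs_def] by (rule measurable_quad_family) (auto simp: cov_out_cov)

lemma signal_quad_nonneg: "0 < v \<Longrightarrow> 0 \<le> signal_quad v p t g"
  unfolding signal_quad_def by (intro quad_nonneg cov_pos_def cov_out_cov)

text \<open>An instance of \<open>quad_gram_le\<close> with \<open>h = sqrt p *\<^sub>R g\<close>.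
  The bound is uniform in \<open>g\<close>, which makes \<open>signal_quad\<close>
  integrable.\<close>

lemma signal_quad_le:
  assumes "0 < v" "0 < p" shows "signal_quad v p t g \<le> (norm t)\<^sup>2 / p"
proof -
  have "g *v t = (sqrt p *\<^sub>R g) *v ((1 / sqrt p) *\<^sub>R t)"
    using assms by (simp add: scaleR_matrix_vector matrix_vector_scaleR)
  then have "signal_quad v p t g \<le> (norm ((1 / sqrt p) *\<^sub>R t))\<^sup>2"
    unfolding signal_quad_def out_cov_def
    using quad_gram_le[OF pos_def_scaleR_mat_1[OF assms(1)], of "sqrt p *\<^sub>R g" "(1 / sqrt p) *\<^sub>R t"] by simp
  then show ?thesis using assms by (simp add: power_divide)
qed

lemma integrable_signal_quad:
  assumes "0 < v" "0 < p" shows "integrable rayleigh (signal_quad v p t)"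
proof -
  interpret prob_space rayleigh by (rule prob_space_rayleigh)
  have "\<bar>signal_quad v p t g\<bar> \<le> (norm t)\<^sup>2 / p" for g
    using signal_quad_le[OF assms, of t g] signal_quad_nonneg[OF assms(1), of p t g] by simp
  then show ?thesis
    using assms by (intro integrable_const_bound[of _ "(norm t)\<^sup>2 / p"]) (auto simp: measurable_signal_quad)
qed

text \<open>As a function of \<open>t\<close> the mean is a Hermitian form. Invariance under sign
  flips makes it diagonal and invariance under transpositions makes the diagonal constant;
  \<open>\<kappa>\<close> is the common diagonal value.\<close>

lemma integral_signal_quad:
  assumes v: "0 < v" and p: "0 < p"
  shows "\<exists>\<kappa>\<ge>0. \<forall>t. (\<integral>g. signal_quad v p t (g :: complex^'t^'r) \<partial>rayleigh) = \<kappa> * (norm (t :: complex^'t))\<^sup>2"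
proof -
  define \<alpha> where "\<alpha> t = (\<integral>g. signal_quad v p t (g :: complex^'t^'r) \<partial>rayleigh)" for t
  have hf: "hermitian_form (\<lambda>t. signal_quad v p t g)" for g :: "complex^'t^'r"
    unfolding signal_quad_def by (rule hermitian_form_quad)
  note int = integrable_signal_quad[OF v p]
  have "hermitian_form \<alpha>"
    unfolding hermitian_form_def
  proof safe
    fix x y
    have "\<alpha> (x + y) + \<alpha> (x - y) = (\<integral>g. signal_quad v p (x + y) (g :: complex^'t^'r) + signal_quad v p (x - y) g \<partial>rayleigh)"
      by (simp add: \<alpha>_def int)
    also have "\<dots> = (\<integral>g. 2 * signal_quad v p x (g :: complex^'t^'r) + 2 * signal_quad v p y g \<partial>rayleigh)"
      using hf by (simp add: hermitian_form_def)
    finally show "\<alpha> (x + y) + \<alpha> (x - y) = 2 * \<alpha> x + 2 * \<alpha> y"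
      by (simp add: \<alpha>_def int)
  next
    fix c x
    show "\<alpha> (c *s x) = (cmod c)\<^sup>2 * \<alpha> x"
      using hf by (simp add: \<alpha>_def hermitian_form_def)
  qed
  \<comment> \<open>A signed permutation of the columns of \<open>g\<close> preserves the law of
    \<open>g\<close> and \<open>out_cov\<close>, so its only effect is on \<open>g *v t\<close>,
    where it acts on \<open>t\<close> instead.\<close>
  moreover have act: "\<alpha> t' = \<alpha> t"
    if "bij \<pi>" "\<And>k. e k = 1 \<or> e k = (-1 :: real)" "\<And>g :: complex^'t^'r. column_action e \<pi> g *v t = g *v t'" for e \<pi> t t'
  proof -
    have "\<alpha> t = (\<integral>g. signal_quad v p t (g :: complex^'t^'r) \<partial>distr rayleigh borel (column_action e \<pi>))"
      using that by (simp add: \<alpha>_def distr_rayleigh_column_action)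
    also have "\<dots> = (\<integral>g. signal_quad v p t (column_action e \<pi> g :: complex^'t^'r) \<partial>rayleigh)"
      using v by (intro integral_distr) auto
    also have "\<dots> = \<alpha> t'"
      using that by (simp add: \<alpha>_def signal_quad_def out_cov_column_action)
    finally show ?thesis by simp
  qed
  have "\<alpha> (flip k t) = \<alpha> t" for k t
    by (rule act[of id "\<lambda>j. if j = k then -1 else 1"])
       (auto simp: vec_eq_iff matrix_vector_mult_def column_action_def flip_def intro!: sum.cong)
  ultimately have sum: "\<alpha> t = (\<Sum>k\<in>UNIV. (cmod (t $ k))\<^sup>2 * \<alpha> (axis k 1))" for t
    using hermitian_form_flip_invariant by blast
  have ax: "\<alpha> (axis k 1) = \<alpha> (axis j 1)" for j k
    by (rule act[of "Transposition.transpose j k" "\<lambda>_. 1"])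
       (auto simp: vec_eq_iff matrix_vector_mult_def column_action_def axis_def if_distrib cong: if_cong)
  define \<kappa> where "\<kappa> = \<alpha> (axis undefined 1)"
  have "0 \<le> \<kappa>"
    unfolding \<kappa>_def \<alpha>_def by (intro integral_nonneg_AE AE_I2 signal_quad_nonneg v)
  moreover have "\<alpha> t = \<kappa> * (norm t)\<^sup>2" for t
  proof -
    have "\<alpha> t = (\<Sum>k\<in>UNIV. (cmod (t $ k))\<^sup>2 * \<kappa>)"
      unfolding sum[of t] \<kappa>_def using ax by (intro sum.cong refl) metis
    also have "\<dots> = \<kappa> * (norm t)\<^sup>2"
      by (simp add: norm_vec_def L2_set_def sum_nonneg sum_distrib_right[symmetric])
    finally show ?thesis .
  qed
  ultimately show ?thesis unfolding \<alpha>_def by blast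
qed


text \<open>The trace identity \<open>sum_quad_self\<close> solved for its noise part. Noise and
  signal contributions are thereby both expressed by \<open>signal_quad\<close>, so one constant
  \<open>\<kappa>\<close> serves for both.\<close>

lemma noise_quad:
  fixes g :: "complex^'t^'r"
  assumes v: "0 < v" and p: "0 \<le> p"
  shows "v * (\<Sum>i\<in>UNIV. quad (out_cov v p g) (axis i 1)) = real CARD('r) - p * (\<Sum>k\<in>UNIV. signal_quad v p (axis k 1) g)"
proof -
  have "quad K ((sqrt p *\<^sub>R g) *v axis k 1) = p * quad K (g *v axis k 1)" for K k
    using p quad_scaleR_mult[of K "complex_of_real (sqrt p)" "g *v axis k 1"]
    by (simp add: quad_def scaleR_matrix_vector matrix_vector_scaleR cdot_scaleR_left cdot_scaleR_right mult.assoc[symmetric])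
  then show ?thesis
    using sum_quad_self[OF v, of "sqrt p *\<^sub>R g"]
    by (simp add: out_cov_def[symmetric] signal_quad_def sum_distrib_left)
qed

section \<open>The rate of a single gain matrix\<close>

definition ln_rate :: "real \<Rightarrow> complex^'t^'t \<Rightarrow> complex^'t^'r \<Rightarrow> real" where
  "ln_rate v Q g = ln (Re (det (mat 1 + (1 / v) *\<^sub>R (g ** Q ** herm g))))"

lemma log_det_rate_ln_rate: "log_det_rate \<sigma> Q g = ln_rate (\<sigma>\<^sup>2) Q g / ln 2"
  by (simp add: log_det_rate_def ln_rate_def log_def)

lemma measurable_ln_rate [measurable]: "ln_rate v Q \<in> borel_measurable borel"
  unfolding ln_rate_def[abs_def] by measurable

text \<open>The factor \<open>V\<close> of the input covariance is absorbed into the channel matrix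
  and \<open>v\<close> is taken out of the determinant, which leaves the determinant of a
  \<open>cov\<close> matrix.\<close>

lemma ln_rate_gram:
  fixes g :: "complex^'t^'r"
  assumes v: "0 < v"
  shows "ln_rate v (V ** herm V) g = ln (Re (det (v *\<^sub>R mat 1 + (g ** V) ** herm (g ** V)))) - real CARD('r) * ln v"
proof -
  let ?X = "mat 1 + (1 / v) *\<^sub>R (g ** (V ** herm V) ** herm g)"
  let ?Y = "v *\<^sub>R mat 1 + (g ** V) ** herm (g ** V)"
  have Y: "?Y = v *\<^sub>R ?X"
    using v by (simp add: scaleR_add_right herm_mult matrix_mul_assoc)
  have "cov ?Y" by (intro cov_add_gram cov.scalar v)
  from cov_det(1)[OF this] have pos: "0 < Re (det ?Y)" .
  have "Re (det ?Y) = v ^ CARD('r) * Re (det ?X)"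
    unfolding Y by (subst det_scaleR_mat) (simp only: of_real_power[symmetric] Re_complex_of_real times_complex.sel Im_complex_of_real)
  moreover have "0 < Re (det ?X)"
    using pos v unfolding calculation by (simp add: zero_less_mult_iff)
  ultimately show ?thesis
    using v by (simp add: ln_rate_def ln_mult ln_realpow)
qed

lemma ln_rate_scalar:
  fixes g :: "complex^'t^'r"
  assumes "0 < v" "0 \<le> p"
  shows "ln_rate v (p *\<^sub>R mat 1) g = ln (Re (det (out_cov v p g))) - real CARD('r) * ln v"
proof -
  have "p *\<^sub>R mat 1 = (sqrt p *\<^sub>R mat 1) ** herm (sqrt p *\<^sub>R mat 1 :: complex^'t^'t)"
    using assms by (simp add: herm_scaleR scaleR_matrix_mult matrix_mult_scaleR)
  moreover have "g ** (sqrt p *\<^sub>R mat 1) = sqrt p *\<^sub>R g"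
    by (simp add: matrix_mult_scaleR)
  ultimately show ?thesis using ln_rate_gram[OF assms(1)] by (metis out_cov_def)
qed

lemma ln_rate_nonneg:
  fixes g :: "complex^'t^'r"
  assumes v: "0 < v" shows "0 \<le> ln_rate v (V ** herm V) g"
proof -
  have c: "cov (v *\<^sub>R mat 1 :: complex^'r^'r)" using v by (rule cov.scalar)
  have "ln (Re (det (v *\<^sub>R mat 1 :: complex^'r^'r))) \<le> ln (Re (det (v *\<^sub>R mat 1 + (g ** V) ** herm (g ** V))))"
    using cov_det(1)[OF c] det_le_det_add_gram[OF c] by (intro ln_mono) (auto intro: less_le_trans)
  moreover have "Re (det (v *\<^sub>R mat 1 :: complex^'r^'r)) = v ^ CARD('r)"
    by (simp add: det_scaleR_mat)
  ultimately show ?thesis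
    using v unfolding ln_rate_gram[OF v] by (simp add: ln_realpow)
qed

lemma norm_axis_one: "norm (axis i 1 :: complex^'n) = 1"
  by (simp add: norm_eq_sqrt_inner inner_axis)

text \<open>The tangent inequality at \<open>K = v *\<^sub>R mat 1\<close>, the logarithm of the
  determinant being bounded by a trace. It dominates the rate by a quadratic function of the gain,
  hence by an integrable one.\<close>

lemma ln_rate_le:
  fixes g :: "complex^'t^'r" and V :: "complex^'t^'t"
  assumes v: "0 < v"
  shows "ln_rate v (V ** herm V) g \<le> (\<Sum>k\<in>UNIV. (norm (g *v (V *v axis k 1)))\<^sup>2) / v"
proof -
  have "Re (det (v *\<^sub>R mat 1 :: complex^'r^'r)) = v ^ CARD('r)"
    by (simp add: det_scaleR_mat)
  then show ?thesis
    using ln_det_tangent[OF v cov.scalar[OF v], of "g ** V"] v unfolding ln_rate_gram[OF v]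
    by (simp add: quad_scalar norm_axis_one ln_realpow matrix_vector_mul_assoc sum_divide_distrib)
qed

lemma norm_matrix_vector_le:
  fixes g :: "complex^'t^'r" and t :: "complex^'t"
  shows "(norm (g *v t))\<^sup>2 \<le> real CARD('r) * (\<Sum>j\<in>UNIV. cmod (t $ j))\<^sup>2 * (norm g)\<^sup>2"
proof -
  have le: "cmod (g $ i $ j) \<le> norm g" for i j
    using Finite_Cartesian_Product.norm_nth_le[of "g $ i" j] Finite_Cartesian_Product.norm_nth_le[of g i] by linarith
  have "cmod ((g *v t) $ i) \<le> (\<Sum>j\<in>UNIV. cmod (t $ j)) * norm g" for i
  proof -
    have "cmod ((g *v t) $ i) \<le> (\<Sum>j\<in>UNIV. cmod (g $ i $ j * t $ j))"
      unfolding matrix_vector_mult_def by (simp add: norm_sum)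
    also have "\<dots> \<le> (\<Sum>j\<in>UNIV. norm g * cmod (t $ j))"
      by (intro sum_mono) (simp add: norm_mult mult_right_mono le)
    finally show ?thesis by (simp add: sum_distrib_left mult.commute)
  qed
  then have "(\<Sum>i\<in>UNIV. (cmod ((g *v t) $ i))\<^sup>2) \<le> (\<Sum>i\<in>(UNIV :: 'r set). ((\<Sum>j\<in>UNIV. cmod (t $ j)) * norm g)\<^sup>2)"
    by (intro sum_mono power_mono) auto
  then show ?thesis
    by (simp add: norm_vec_def[of "g *v t"] L2_set_def sum_nonneg power_mult_distrib mult.assoc)
qed

lemma integrable_rayleigh_image_norm2: "integrable rayleigh (\<lambda>g :: complex^'t^'r. (norm (g *v t))\<^sup>2)"
  by (rule Bochner_Integration.integrable_bound[OF
        integrable_mult_right[OF integrable_rayleigh_norm2, of "real CARD('r) * (\<Sum>j\<in>UNIV. cmod (t $ j))\<^sup>2"]])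
     (auto intro!: AE_I2 order_trans[OF norm_matrix_vector_le])

lemma integrable_ln_rate_gram:
  fixes V :: "complex^'t^'t"
  assumes "0 < v" shows "integrable rayleigh (ln_rate v (V ** herm V) :: complex^'t^'r \<Rightarrow> real)"
proof (rule Bochner_Integration.integrable_bound)
  show "integrable rayleigh (\<lambda>g :: complex^'t^'r. (\<Sum>k\<in>UNIV. (norm (g *v (V *v axis k 1)))\<^sup>2) / v)"
    by (intro Bochner_Integration.integrable_divide Bochner_Integration.integrable_sum integrable_rayleigh_image_norm2)
  show "AE g in rayleigh. norm (ln_rate v (V ** herm V) g) \<le> norm ((\<Sum>k\<in>UNIV. (norm ((g :: complex^'t^'r) *v (V *v axis k 1)))\<^sup>2) / v)"
  proof (rule AE_I2)
    fix g :: "complex^'t^'r"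
    show "norm (ln_rate v (V ** herm V) g) \<le> norm ((\<Sum>k\<in>UNIV. (norm (g *v (V *v axis k 1)))\<^sup>2) / v)"
      using ln_rate_le[OF assms, of V g] ln_rate_nonneg[OF assms, of V g] assms by (simp add: sum_nonneg)
  qed
qed simp

text \<open>The tangent inequality at \<open>K = out_cov v p g\<close>. Rewriting its noise part by
  \<open>noise_quad\<close> cancels the term \<open>real CARD('r)\<close>.\<close>

lemma ln_rate_le_scalar:
  fixes g :: "complex^'t^'r" and V :: "complex^'t^'t"
  assumes v: "0 < v" and p: "0 \<le> p"
  shows "ln_rate v (V ** herm V) g \<le> ln_rate v (p *\<^sub>R mat 1) g +
    (\<Sum>k\<in>UNIV. signal_quad v p (V *v axis k 1) g) - p * (\<Sum>k\<in>UNIV. signal_quad v p (axis k 1) g)"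
  using ln_det_tangent[OF v cov_out_cov[OF v, of p g], of "g ** V"] noise_quad[OF v p, of g]
  unfolding ln_rate_gram[OF v] ln_rate_scalar[OF v p]
  by (simp add: matrix_vector_mul_assoc[symmetric] signal_quad_def[symmetric])

lemma integrable_ln_rate:
  assumes "0 < v" "hermitian_psd Q" shows "integrable rayleigh (ln_rate v Q :: complex^'t^'r \<Rightarrow> real)"
proof -
  obtain V :: "complex^'t^'t" where "Q = V ** herm V" using hermitian_psd_factor[OF assms(2)] .
  then show ?thesis using integrable_ln_rate_gram[OF assms(1)] by simp
qed

lemma hermitian_psd_scalar: "0 \<le> p \<Longrightarrow> hermitian_psd (p *\<^sub>R mat 1)"
  by (simp add: hermitian_psd_def herm_scaleR scaleR_matrix_vector cdot_scaleR_right Re_cdot_self)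

text \<open>After integration the two sums in \<open>ln_rate_le_scalar\<close> become
  \<open>\<kappa>\<close> times the trace of \<open>Q\<close> and \<open>\<kappa>\<close> times
  \<open>p * real CARD('t)\<close>; the trace bound makes their difference nonpositive.\<close>

lemma integral_ln_rate_le_scalar:
  fixes Q :: "complex^'t^'t"
  assumes v: "0 < v" and p: "0 < p" and Q: "hermitian_psd Q" "Re (trace Q) \<le> p * real CARD('t)"
  shows "(\<integral>g. ln_rate v Q (g :: complex^'t^'r) \<partial>rayleigh) \<le> (\<integral>g. ln_rate v (p *\<^sub>R mat 1) (g :: complex^'t^'r) \<partial>rayleigh)"
proof -
  obtain V :: "complex^'t^'t" where V: "Q = V ** herm V" using hermitian_psd_factor[OF Q(1)] .
  obtain \<kappa> where \<kappa>: "0 \<le> \<kappa>" "\<And>t. (\<integral>g. signal_quad v p t (g :: complex^'t^'r) \<partial>rayleigh) = \<kappa> * (norm (t :: complex^'t))\<^sup>2"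
    using integral_signal_quad[OF v p] by metis
  note int = integrable_ln_rate[OF v hermitian_psd_scalar[OF less_imp_le[OF p]]] integrable_signal_quad[OF v p]
  have i0: "integrable rayleigh (ln_rate v (p *\<^sub>R mat 1) :: complex^'t^'r \<Rightarrow> real)"
    by (rule int(1))
  have iB: "integrable rayleigh (\<lambda>g :: complex^'t^'r. \<Sum>k\<in>UNIV. signal_quad v p (W k) g)"
    and vB: "(\<integral>g. (\<Sum>k\<in>UNIV. signal_quad v p (W k) (g :: complex^'t^'r)) \<partial>rayleigh) = \<kappa> * (\<Sum>k\<in>UNIV. (norm (W k))\<^sup>2)"
    for W :: "'t \<Rightarrow> complex^'t"
    by (simp_all add: int(2) Bochner_Integration.integral_sum \<kappa>(2) sum_distrib_left)
  have "(\<integral>g. ln_rate v Q (g :: complex^'t^'r) \<partial>rayleigh) \<le> (\<integral>g. ln_rate v (p *\<^sub>R mat 1) (g :: complex^'t^'r) +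
      (\<Sum>k\<in>UNIV. signal_quad v p (V *v axis k 1) g) - p * (\<Sum>k\<in>UNIV. signal_quad v p (axis k 1) g) \<partial>rayleigh)"
    unfolding V using p v ln_rate_le_scalar[OF v, of p V]
    by (intro integral_mono Bochner_Integration.integrable_diff Bochner_Integration.integrable_add
        Bochner_Integration.integrable_sum integrable_mult_right int integrable_ln_rate_gram) auto
  also have "\<dots> = (\<integral>g. ln_rate v (p *\<^sub>R mat 1) (g :: complex^'t^'r) \<partial>rayleigh) +
      \<kappa> * ((\<Sum>k\<in>UNIV. (norm (V *v axis k 1))\<^sup>2) - p * real CARD('t))"
    using i0 by (simp add: iB vB norm_axis_one p less_imp_le) (simp add: algebra_simps)
  also have "(\<Sum>k\<in>UNIV. (norm (V *v axis k 1))\<^sup>2) = Re (trace Q)"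
    using sum_quad_axis[of "mat 1" V] by (simp add: V quad_mat_1 matrix_inv_eqI)
  finally show ?thesis using Q(2) \<kappa>(1) by (smt (verit) mult_nonneg_nonpos)
qed

text \<open>With \<open>r = p / p'\<close>, the covariance at power \<open>p\<close> is
  \<open>r\<close> times that at power \<open>p'\<close> plus the nonnegative multiple
  \<open>(1 - r) * v\<close> of the identity, so determinant monotonicity applies. The loss is
  uniform in \<open>g\<close> and hence carries over to the mean rates.\<close>

lemma ln_rate_scalar_lower:
  fixes g :: "complex^'t^'r"
  assumes v: "0 < v" and p: "0 < p" "p \<le> p'"
  shows "ln_rate v (p' *\<^sub>R mat 1) g - real CARD('r) * ln (p' / p) \<le> ln_rate v (p *\<^sub>R mat 1) g"
proof -
  define r where "r = p / p'"
  have r: "0 < r" "r \<le> 1" using p by (simp_all add: r_def)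
  define c where "c = (1 - r) * v"
  have c: "0 \<le> c" using r v by (simp add: c_def)
  let ?I = "mat 1 :: complex^'r^'r" and ?X = "g ** herm g"
  have oc: "out_cov v q g = v *\<^sub>R ?I + q *\<^sub>R ?X" if "0 < q" for q
    using that by (simp add: out_cov_def herm_scaleR scaleR_matrix_mult matrix_mult_scaleR)
  have "r *\<^sub>R out_cov v p' g + c *\<^sub>R ?I = (r * v + c) *\<^sub>R ?I + (r * p') *\<^sub>R ?X"
    using oc[of p'] p by (simp add: scaleR_add_right scaleR_add_left)
  also have "r * v + c = v" by (simp add: c_def left_diff_distrib)
  also have "r * p' = p" using p by (simp add: r_def)
  finally have "out_cov v p g = r *\<^sub>R out_cov v p' g + c *\<^sub>R mat 1"
    using oc[of p] p by simp
  also have "c *\<^sub>R mat 1 = (sqrt c *\<^sub>R mat 1) ** herm (sqrt c *\<^sub>R mat 1 :: complex^'r^'r)"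
    using c by (simp add: herm_scaleR scaleR_matrix_mult matrix_mult_scaleR)
  finally have "Re (det (r *\<^sub>R out_cov v p' g)) \<le> Re (det (out_cov v p g))"
    using det_le_det_add_gram[OF cov_scaleR[OF cov_out_cov[OF v] r(1)]] by metis
  moreover have "Re (det (r *\<^sub>R out_cov v p' g)) = r ^ CARD('r) * Re (det (out_cov v p' g))"
    by (subst det_scaleR_mat) (simp only: of_real_power[symmetric] Re_complex_of_real times_complex.sel Im_complex_of_real)
  moreover have d: "0 < Re (det (out_cov v p' g))" by (rule cov_det(1)[OF cov_out_cov[OF v]])
  ultimately have "ln (r ^ CARD('r) * Re (det (out_cov v p' g))) \<le> ln (Re (det (out_cov v p g)))"
    using r by (intro ln_mono) auto
  then show ?thesis
    using p r d by (simp add: ln_rate_scalar[OF v] ln_mult ln_realpow) (simp add: r_def ln_div algebra_simps)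
qed


section \<open>Products of Gaussian densities\<close>

abbreviation lebesgue_block :: "nat \<Rightarrow> (nat \<Rightarrow> 'a :: euclidean_space) measure" where
  "lebesgue_block n \<equiv> Pi\<^sub>M {1..n} (\<lambda>_. lborel)"

lemma product_sigma_finite_lborel: "product_sigma_finite (\<lambda>_. lborel)"
  by (simp add: product_sigma_finite_def sigma_finite_lborel)

lemma sigma_finite_lebesgue_block: "sigma_finite_measure (lebesgue_block n)"
  by (rule product_sigma_finite.sigma_finite[OF product_sigma_finite_lborel]) simp

lemma sets_lebesgue_block [measurable_cong]: "sets (lebesgue_block n) = sets (blocks n)"
  by (intro sets_PiM_cong) auto

lemma space_lebesgue_block: "space (lebesgue_block n) = space (blocks n)"
  by (simp add: space_PiM)

text \<open>Both measures agree on rectangles, where the integrand factorises.\<close>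

lemma PiM_density_lborel:
  fixes f :: "'i \<Rightarrow> 'a :: euclidean_space \<Rightarrow> ennreal"
  assumes fin: "finite I" and [measurable]: "\<And>i. f i \<in> borel_measurable borel"
    and prob: "\<And>i. (\<integral>\<^sup>+x. f i x \<partial>lborel) = 1"
  shows "Pi\<^sub>M I (\<lambda>i. density lborel (f i)) = density (Pi\<^sub>M I (\<lambda>_. lborel)) (\<lambda>x. \<Prod>i\<in>I. f i (x i))"
proof -
  have ps: "prob_space (density lborel (f i))" for i
    by (rule prob_spaceI) (simp add: emeasure_density prob)
  interpret product_sigma_finite "\<lambda>i. density lborel (f i)"
    by (simp add: product_sigma_finite_def prob_space_imp_sigma_finite ps)
  show ?thesis
  proof (rule PiM_eqI[OF fin, symmetric])
    show "sets (density (Pi\<^sub>M I (\<lambda>_. lborel)) (\<lambda>x. \<Prod>i\<in>I. f i (x i))) = sets (Pi\<^sub>M I (\<lambda>i. density lborel (f i)))"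
      unfolding sets_density by (intro sets_PiM_cong) auto
    fix A assume A: "\<And>i. i \<in> I \<Longrightarrow> A i \<in> sets (density lborel (f i))"
    have mA: "Pi\<^sub>E I A \<in> sets (Pi\<^sub>M I (\<lambda>_. lborel))"
      using A fin by (intro sets_PiM_I_finite) auto
    have "(\<Prod>i\<in>I. f i (x i)) * indicator (Pi\<^sub>E I A) x = (\<Prod>i\<in>I. f i (x i) * indicator (A i) (x i))"
      if sp: "x \<in> space (Pi\<^sub>M I (\<lambda>_. lborel))" for x
    proof (cases "x \<in> Pi\<^sub>E I A")
      case True
      then show ?thesis by (auto intro!: prod.cong simp: PiE_iff)
    next
      case False
      then obtain i where "i \<in> I" "x i \<notin> A i" using sp by (auto simp: space_PiM PiE_def)
      then have "(\<Prod>i\<in>I. f i (x i) * indicator (A i) (x i)) = 0"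
        using fin by (intro prod_zero bexI[of _ i]) auto
      then show ?thesis using False by simp
    qed
    then have "emeasure (density (Pi\<^sub>M I (\<lambda>_. lborel)) (\<lambda>x. \<Prod>i\<in>I. f i (x i))) (Pi\<^sub>E I A) =
        (\<integral>\<^sup>+x. (\<Prod>i\<in>I. f i (x i) * indicator (A i) (x i)) \<partial>Pi\<^sub>M I (\<lambda>_. lborel))"
      using mA by (subst emeasure_density) (auto intro!: nn_integral_cong)
    also have "\<dots> = (\<Prod>i\<in>I. (\<integral>\<^sup>+x. f i x * indicator (A i) x \<partial>lborel))"
      using A by (intro product_sigma_finite.product_nn_integral_prod[OF product_sigma_finite_lborel fin]) auto
    also have "\<dots> = (\<Prod>i\<in>I. emeasure (density lborel (f i)) (A i))"
      using A by (intro prod.cong refl) (simp add: emeasure_density)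
    finally show "emeasure (density (Pi\<^sub>M I (\<lambda>_. lborel)) (\<lambda>x. \<Prod>i\<in>I. f i (x i))) (Pi\<^sub>E I A) =
        (\<Prod>i\<in>I. emeasure (density lborel (f i)) (A i))" .
  qed
qed

lemma nn_integral_prod_marginal:
  fixes f :: "'i \<Rightarrow> 'a :: euclidean_space \<Rightarrow> ennreal"
  assumes fin: "finite I" and [measurable]: "\<And>i. f i \<in> borel_measurable borel" "a \<in> borel_measurable borel"
    and prob: "\<And>i. (\<integral>\<^sup>+x. f i x \<partial>lborel) = 1" and k: "k \<in> I"
  shows "(\<integral>\<^sup>+x. (\<Prod>i\<in>I. f i (x i)) * a (x k) \<partial>Pi\<^sub>M I (\<lambda>_. lborel)) = (\<integral>\<^sup>+x. f k x * a x \<partial>lborel)"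
proof -
  have "(\<Prod>i\<in>I. f i (x i)) * a (x k) = (\<Prod>i\<in>I. f i (x i) * (if i = k then a (x i) else 1))" for x
    using fin k by (simp add: prod.distrib prod.delta)
  then have "(\<integral>\<^sup>+x. (\<Prod>i\<in>I. f i (x i)) * a (x k) \<partial>Pi\<^sub>M I (\<lambda>_. lborel)) =
      (\<Prod>i\<in>I. (\<integral>\<^sup>+x. f i x * (if i = k then a x else 1) \<partial>lborel))"
    by (simp only:) (rule product_sigma_finite.product_nn_integral_prod[OF product_sigma_finite_lborel fin], measurable)
  also have "\<dots> = (\<Prod>i\<in>I. if i = k then (\<integral>\<^sup>+x. f i x * a x \<partial>lborel) else 1)"
    by (intro prod.cong refl) (simp add: prob)
  also have "\<dots> = (\<integral>\<^sup>+x. f k x * a x \<partial>lborel)"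
    using fin k by (simp add: prod.delta)
  finally show ?thesis .
qed

definition gauss_prod :: "nat \<Rightarrow> (nat \<Rightarrow> complex^'n^'n) \<Rightarrow> (nat \<Rightarrow> complex^'n) \<Rightarrow> real" where
  "gauss_prod n K z = (\<Prod>i=1..n. complex_gaussian_density (K i) (z i))"

definition quad_sum :: "nat \<Rightarrow> (nat \<Rightarrow> complex^'n^'n) \<Rightarrow> (nat \<Rightarrow> complex^'n) \<Rightarrow> real" where
  "quad_sum n K z = (\<Sum>i=1..n. quad (K i) (z i))"

lemma gauss_prod_pos: "(\<And>i. cov (K i)) \<Longrightarrow> 0 < gauss_prod n K z"
  unfolding gauss_prod_def by (intro prod_pos cgd_pos) auto

lemma gauss_prod_ennreal:
  "(\<And>i. cov (K i)) \<Longrightarrow> ennreal (gauss_prod n K z) = (\<Prod>i=1..n. ennreal (complex_gaussian_density (K i) (z i)))"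
  unfolding gauss_prod_def by (intro prod_ennreal[symmetric] less_imp_le cgd_pos) auto

lemma ln_gauss_prod:
  fixes K :: "nat \<Rightarrow> complex^'n^'n"
  assumes "\<And>i. cov (K i)"
  shows "ln (gauss_prod n K z) = - quad_sum n K z - (\<Sum>i=1..n. real CARD('n) * ln pi + ln (Re (det (K i))))"
proof -
  have "ln (gauss_prod n K z) = (\<Sum>i=1..n. ln (complex_gaussian_density (K i) (z i)))"
    unfolding gauss_prod_def by (rule ln_prod, simp) (metis assms cgd_pos less_irrefl)
  also have "\<dots> = (\<Sum>i=1..n. - quad (K i) (z i) - (real CARD('n) * ln pi + ln (Re (det (K i)))))"
    by (intro sum.cong refl) (use cov_det(1)[OF assms] cov_det(1)[OF assms, THEN less_imp_neq, THEN not_sym] in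
        \<open>simp add: complex_gaussian_density_quad ln_div ln_mult ln_realpow\<close>)
  finally show ?thesis by (simp add: sum_subtractf sum_negf quad_sum_def)
qed

lemma nn_integral_gauss_prod:
  fixes K :: "nat \<Rightarrow> complex^'n^'n"
  assumes K: "\<And>i. cov (K i)"
  shows "(\<integral>\<^sup>+z. ennreal (gauss_prod n K (\<lambda>i. z i - a i)) \<partial>lebesgue_block n) = 1"
proof -
  have "(\<integral>\<^sup>+z. ennreal (complex_gaussian_density (K i) (z - a i)) \<partial>lborel) = 1" for i
    using nn_integral_lborel_translate[of "\<lambda>z. ennreal (complex_gaussian_density (K i) z)" "- a i"]
    by (simp add: nn_integral_cgd[OF K])
  then show ?thesis
    unfolding gauss_prod_ennreal[OF K]
    by (subst product_sigma_finite.product_nn_integral_prod[OF product_sigma_finite_lborel]) auto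
qed

text \<open>The value depends neither on the covariances nor on the shift. This is why the tail
  bounds below hold uniformly in gains and codewords.\<close>

lemma nn_integral_gauss_prod_exp:
  fixes K :: "nat \<Rightarrow> complex^'n^'n"
  assumes K: "\<And>i. cov (K i)" and s: "-1 < s"
  shows "(\<integral>\<^sup>+z. ennreal (gauss_prod n K (\<lambda>i. z i - a i)) * ennreal (exp (- s * quad_sum n K (\<lambda>i. z i - a i))) \<partial>lebesgue_block n) =
    ennreal ((1 / (1 + s)) ^ CARD('n)) ^ n"
proof -
  have "ennreal (gauss_prod n K (\<lambda>i. z i - a i)) * ennreal (exp (- s * quad_sum n K (\<lambda>i. z i - a i))) =
      (\<Prod>i=1..n. ennreal (complex_gaussian_density (K i) (z i - a i)) * ennreal (exp (- s * quad (K i) (z i - a i))))" for z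
    by (simp add: gauss_prod_ennreal[OF K] prod.distrib quad_sum_def sum_distrib_left exp_sum[symmetric]
        prod_ennreal sum_negf)
  then have "(\<integral>\<^sup>+z. ennreal (gauss_prod n K (\<lambda>i. z i - a i)) * ennreal (exp (- s * quad_sum n K (\<lambda>i. z i - a i))) \<partial>lebesgue_block n) =
     (\<Prod>i=1..n. (\<integral>\<^sup>+z. ennreal (complex_gaussian_density (K i) (z - a i)) * ennreal (exp (- s * quad (K i) (z - a i))) \<partial>lborel))"
    by (simp only:) (rule product_sigma_finite.product_nn_integral_prod[OF product_sigma_finite_lborel], auto)
  also have "\<dots> = (\<Prod>i=1..n. (\<integral>\<^sup>+z. ennreal (complex_gaussian_density (K i) z) * ennreal (exp (- s * quad (K i) z)) \<partial>lborel))"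
    using nn_integral_lborel_translate[of "\<lambda>z. ennreal (complex_gaussian_density (K i) z) * ennreal (exp (- s * quad (K i) z))" "- a i" for i]
    by (intro prod.cong refl) simp
  finally show ?thesis unfolding nn_integral_cgd_exp_quad[OF K s] by simp
qed

lemma measurable_quad_sum [measurable]: "(\<lambda>z. quad_sum n K (\<lambda>i. z i - a i)) \<in> borel_measurable (lebesgue_block n)"
  unfolding quad_sum_def by measurable

lemma measurable_gauss_prod [measurable]: "(\<lambda>z. gauss_prod n K (\<lambda>i. z i - a i)) \<in> borel_measurable (lebesgue_block n)"
  unfolding gauss_prod_def by measurable

text \<open>The quadratic form of a single Gaussian vector has a Gamma law of mean \<open>CARD('n)\<close>.\<close>

lemma gauss_prod_lower_tail:
  assumes \<delta>: "0 < \<delta>"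
  shows "\<exists>\<rho>. 0 < \<rho> \<and> \<rho> < 1 \<and> (\<forall>n (K :: nat \<Rightarrow> complex^'n^'n) a. (\<forall>i. cov (K i)) \<longrightarrow>
    (\<integral>\<^sup>+z. ennreal (gauss_prod n K (\<lambda>i. z i - a i)) * indicator {z. quad_sum n K (\<lambda>i. z i - a i) \<le> real n * (real CARD('n) - \<delta>)} z \<partial>lebesgue_block n)
      \<le> ennreal (\<rho> ^ n))"
proof -
  let ?m = "real CARD('n)"
  \<comment> \<open>The Chernoff parameter. From \<open>ln (1 + s) \<ge> s - s\<^sup>2\<close> the
    logarithm of \<open>\<rho>\<close> is at most \<open>?m * s\<^sup>2 - \<delta> * s\<close>, and
    \<open>2 * ?m * s \<le> \<delta>\<close> brings this below
    \<open>- \<delta> * s / 2\<close>.\<close>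
  define s where "s = min 1 (\<delta> / (2 * ?m))"
  have s: "0 < s" "s \<le> 1" "2 * ?m * s \<le> \<delta>"
    using \<delta> by (auto simp: s_def min_def field_simps)
  define \<rho> where "\<rho> = exp (s * (?m - \<delta>)) * (1 / (1 + s)) ^ CARD('n)"
  have "exp (?m * ln (1 + s)) = (1 + s) ^ CARD('n)"
    using s by (simp add: exp_of_nat_mult)
  then have "\<rho> = exp (s * (?m - \<delta>) - ?m * ln (1 + s))"
    unfolding \<rho>_def exp_diff by (simp add: power_one_over)
  moreover have "s * (?m - \<delta>) - ?m * ln (1 + s) < 0"
  proof -
    have "?m * (s - s\<^sup>2) \<le> ?m * ln (1 + s)"
      using ln_one_plus_pos_lower_bound[of s] s by (intro mult_left_mono) auto
    moreover have "?m * s * s \<le> \<delta> * s / 2" using s(1,3) by (simp add: mult_right_mono)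
    moreover have "?m * (s - s\<^sup>2) = ?m * s - ?m * s * s" "s * (?m - \<delta>) = ?m * s - \<delta> * s"
      by (simp_all add: algebra_simps power2_eq_square)
    moreover have "0 < \<delta> * s" using \<delta> s(1) by simp
    ultimately show ?thesis by linarith
  qed
  ultimately have \<rho>: "0 < \<rho>" "\<rho> < 1" by simp_all
  moreover have "(\<integral>\<^sup>+z. ennreal (gauss_prod n K (\<lambda>i. z i - a i)) * indicator {z. quad_sum n K (\<lambda>i. z i - a i) \<le> real n * (?m - \<delta>)} z \<partial>lebesgue_block n)
      \<le> ennreal (\<rho> ^ n)" if K: "\<forall>i. cov (K i)" for n a and K :: "nat \<Rightarrow> complex^'n^'n"
  proof -
    let ?c = "ennreal (exp (s * (?m - \<delta>)) ^ n)"
    have "(\<integral>\<^sup>+z. ennreal (gauss_prod n K (\<lambda>i. z i - a i)) * indicator {z. quad_sum n K (\<lambda>i. z i - a i) \<le> real n * (?m - \<delta>)} z \<partial>lebesgue_block n) \<le>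
       (\<integral>\<^sup>+z. ?c * (ennreal (gauss_prod n K (\<lambda>i. z i - a i)) * ennreal (exp (- s * quad_sum n K (\<lambda>i. z i - a i)))) \<partial>lebesgue_block n)"
    proof (intro nn_integral_mono)
      fix z
      have "indicator {z. quad_sum n K (\<lambda>i. z i - a i) \<le> real n * (?m - \<delta>)} z \<le> ?c * ennreal (exp (- s * quad_sum n K (\<lambda>i. z i - a i)))"
        using s(1) by (auto simp: indicator_def ennreal_mult[symmetric] exp_of_nat_mult[symmetric] exp_add[symmetric]
            mult.left_commute[of s] intro!: mult_left_mono)
      then show "ennreal (gauss_prod n K (\<lambda>i. z i - a i)) * indicator {z. quad_sum n K (\<lambda>i. z i - a i) \<le> real n * (?m - \<delta>)} z
          \<le> ?c * (ennreal (gauss_prod n K (\<lambda>i. z i - a i)) * ennreal (exp (- s * quad_sum n K (\<lambda>i. z i - a i))))"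
        by (subst mult.left_commute) (intro mult_left_mono, auto)
    qed
    also have "\<dots> = ?c * (\<integral>\<^sup>+z. ennreal (gauss_prod n K (\<lambda>i. z i - a i)) * ennreal (exp (- s * quad_sum n K (\<lambda>i. z i - a i))) \<partial>lebesgue_block n)"
      by (rule nn_integral_cmult) measurable
    also have "(\<integral>\<^sup>+z. ennreal (gauss_prod n K (\<lambda>i. z i - a i)) * ennreal (exp (- s * quad_sum n K (\<lambda>i. z i - a i))) \<partial>lebesgue_block n) =
        ennreal ((1 / (1 + s)) ^ CARD('n)) ^ n"
      using K s(1) by (intro nn_integral_gauss_prod_exp) auto
    also have "?c * ennreal ((1 / (1 + s)) ^ CARD('n)) ^ n = ennreal (\<rho> ^ n)"
      using s(1) by (subst ennreal_power, simp) (simp only: \<rho>_def power_mult_distrib, subst ennreal_mult, auto)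
    finally show ?thesis .
  qed
  ultimately show ?thesis by blast
qed

text \<open>The Chernoff bound with the opposite sign in the exponent. Again \<open>\<rho>\<close>
  is fixed before the block-length, the covariances and the shift.\<close>

lemma gauss_prod_upper_tail:
  assumes \<delta>: "0 < \<delta>"
  shows "\<exists>\<rho>. 0 < \<rho> \<and> \<rho> < 1 \<and> (\<forall>n (K :: nat \<Rightarrow> complex^'n^'n) a. (\<forall>i. cov (K i)) \<longrightarrow>
    (\<integral>\<^sup>+z. ennreal (gauss_prod n K (\<lambda>i. z i - a i)) * indicator {z. real n * (real CARD('n) + \<delta>) \<le> quad_sum n K (\<lambda>i. z i - a i)} z \<partial>lebesgue_block n)
      \<le> ennreal (\<rho> ^ n))"
proof -
  let ?m = "real CARD('n)"
  \<comment> \<open>The bound \<open>s \<le> 1/2\<close> keeps the exponential moment finite and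
    gives \<open>ln (1 - s) \<ge> - s - 2 * s\<^sup>2\<close>; then
    \<open>4 * ?m * s \<le> \<delta>\<close> makes the logarithm of \<open>\<rho>\<close> at most
    \<open>- \<delta> * s / 2\<close>.\<close>
  define s where "s = min (1/2) (\<delta> / (4 * ?m))"
  have s: "0 < s" "s \<le> 1/2" "4 * ?m * s \<le> \<delta>"
    using \<delta> by (auto simp: s_def min_def field_simps)
  define \<rho> where "\<rho> = exp (- s * (?m + \<delta>)) * (1 / (1 - s)) ^ CARD('n)"
  have "exp (?m * ln (1 - s)) = (1 - s) ^ CARD('n)"
    using s by (simp add: exp_of_nat_mult)
  then have "\<rho> = exp (- s * (?m + \<delta>) - ?m * ln (1 - s))"
    unfolding \<rho>_def exp_diff by (simp add: power_one_over)
  moreover have "- s * (?m + \<delta>) - ?m * ln (1 - s) < 0"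
  proof -
    have "?m * (- s - 2 * s\<^sup>2) \<le> ?m * ln (1 - s)"
      using ln_one_minus_pos_lower_bound[of s] s by (intro mult_left_mono) auto
    moreover have "?m * s * s * 2 \<le> \<delta> * s / 2" using s(1,3) by (simp add: mult_right_mono)
    moreover have "?m * (- s - 2 * s\<^sup>2) = - (?m * s) - ?m * s * s * 2" "- s * (?m + \<delta>) = - (?m * s) - \<delta> * s"
      by (simp_all add: algebra_simps power2_eq_square)
    moreover have "0 < \<delta> * s" using \<delta> s(1) by simp
    ultimately show ?thesis by linarith
  qed
  ultimately have \<rho>: "0 < \<rho>" "\<rho> < 1" by simp_all
  moreover have "(\<integral>\<^sup>+z. ennreal (gauss_prod n K (\<lambda>i. z i - a i)) * indicator {z. real n * (?m + \<delta>) \<le> quad_sum n K (\<lambda>i. z i - a i)} z \<partial>lebesgue_block n)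
      \<le> ennreal (\<rho> ^ n)" if K: "\<forall>i. cov (K i)" for n a and K :: "nat \<Rightarrow> complex^'n^'n"
  proof -
    let ?c = "ennreal (exp (- s * (?m + \<delta>)) ^ n)"
    have "(\<integral>\<^sup>+z. ennreal (gauss_prod n K (\<lambda>i. z i - a i)) * indicator {z. real n * (?m + \<delta>) \<le> quad_sum n K (\<lambda>i. z i - a i)} z \<partial>lebesgue_block n) \<le>
       (\<integral>\<^sup>+z. ?c * (ennreal (gauss_prod n K (\<lambda>i. z i - a i)) * ennreal (exp (- (- s) * quad_sum n K (\<lambda>i. z i - a i)))) \<partial>lebesgue_block n)"
    proof (intro nn_integral_mono)
      fix z
      have "indicator {z. real n * (?m + \<delta>) \<le> quad_sum n K (\<lambda>i. z i - a i)} z \<le> ?c * ennreal (exp (- (- s) * quad_sum n K (\<lambda>i. z i - a i)))"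
        using s(1) by (auto simp: indicator_def ennreal_mult[symmetric] exp_of_nat_mult[symmetric] exp_add[symmetric]
            mult.left_commute[of s] intro!: mult_left_mono)
      then show "ennreal (gauss_prod n K (\<lambda>i. z i - a i)) * indicator {z. real n * (?m + \<delta>) \<le> quad_sum n K (\<lambda>i. z i - a i)} z
          \<le> ?c * (ennreal (gauss_prod n K (\<lambda>i. z i - a i)) * ennreal (exp (- (- s) * quad_sum n K (\<lambda>i. z i - a i))))"
        by (subst mult.left_commute) (intro mult_left_mono, auto)
    qed
    also have "\<dots> = ?c * (\<integral>\<^sup>+z. ennreal (gauss_prod n K (\<lambda>i. z i - a i)) * ennreal (exp (- (- s) * quad_sum n K (\<lambda>i. z i - a i))) \<partial>lebesgue_block n)"
      by (rule nn_integral_cmult) measurable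
    also have "(\<integral>\<^sup>+z. ennreal (gauss_prod n K (\<lambda>i. z i - a i)) * ennreal (exp (- (- s) * quad_sum n K (\<lambda>i. z i - a i))) \<partial>lebesgue_block n) =
        ennreal ((1 / (1 + - s)) ^ CARD('n)) ^ n"
      using K s(2) by (intro nn_integral_gauss_prod_exp) auto
    also have "?c * ennreal ((1 / (1 + - s)) ^ CARD('n)) ^ n = ennreal (\<rho> ^ n)"
      using s(2) by (subst ennreal_power, simp) (simp only: \<rho>_def power_mult_distrib, subst ennreal_mult, auto)
    finally show ?thesis .
  qed
  ultimately show ?thesis by blast
qed


section \<open>Feinstein's maximal code construction\<close>

lemma feinstein:
  fixes \<Phi> :: "'t measure" and \<beta> :: "'y measure" and w :: "'t \<Rightarrow> 'y \<Rightarrow> ennreal"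
    and \<gamma> \<theta> :: real and k :: nat
  assumes \<Phi>: "prob_space \<Phi>" and \<beta>: "sigma_finite_measure \<beta>"
    and w [measurable]: "(\<lambda>(t, y). w t y) \<in> borel_measurable (\<Phi> \<Otimes>\<^sub>M \<beta>)"
    and q [measurable]: "q \<in> borel_measurable \<beta>" and F [measurable]: "F \<in> sets \<Phi>"
    and marginal: "\<And>y. y \<in> space \<beta> \<Longrightarrow> (\<integral>\<^sup>+t. w t y \<partial>\<Phi>) = q y"
    and total: "\<And>t. t \<in> space \<Phi> \<Longrightarrow> (\<integral>\<^sup>+y. w t y \<partial>\<beta>) = 1"
    and \<gamma>: "0 < \<gamma>" and \<theta>: "0 < \<theta>" "\<theta> < 1"
    and large: "ennreal (1 - \<theta> + real k / \<gamma>) <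
      (\<integral>\<^sup>+t. (\<integral>\<^sup>+y. w t y * indicator {y. ennreal \<gamma> * q y \<le> w t y} y \<partial>\<beta>) * indicator F t \<partial>\<Phi>)"
  shows "\<exists>c D. (\<forall>l\<in>{1..k + 1}. c l \<in> F \<and> D l \<in> sets \<beta> \<and>
      ennreal (1 - \<theta>) \<le> (\<integral>\<^sup>+y. w (c l) y * indicator (D l) y \<partial>\<beta>)) \<and>
    (\<forall>l\<in>{1..k + 1}. \<forall>j\<in>{1..k + 1}. l \<noteq> j \<longrightarrow> D l \<inter> D j = {})"
proof -
  interpret \<Phi>: prob_space \<Phi> by (rule \<Phi>)
  interpret \<beta>: sigma_finite_measure \<beta> by (rule \<beta>)
  interpret pair_sigma_finite \<Phi> \<beta> ..
  have wt [measurable]: "t \<in> space \<Phi> \<Longrightarrow> w t \<in> borel_measurable \<beta>" for t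
    using measurable_compose[OF measurable_Pair1' w] by simp
  define A where "A t = {y\<in>space \<beta>. ennreal \<gamma> * q y \<le> w t y}" for t
  have A [measurable]: "t \<in> space \<Phi> \<Longrightarrow> A t \<in> sets \<beta>" for t
    unfolding A_def by measurable
  have F_sub: "t \<in> F \<Longrightarrow> t \<in> space \<Phi>" for t using sets.sets_into_space[OF F] by auto
  let ?K = "\<lambda>t B. \<integral>\<^sup>+y. w t y * indicator B y \<partial>\<beta>"
  \<comment> \<open>Keeping \<open>D l\<close> inside \<open>A (c l)\<close> during the induction is
    what controls the \<open>q\<close>-mass. The last step, to \<open>k + 1\<close> codewords, has
    only \<open>k\<close> earlier regions to avoid.\<close>
  have step: "\<exists>c D. (\<forall>l\<in>{1..j}. c l \<in> F \<and> D l \<in> sets \<beta> \<and> D l \<subseteq> A (c l) \<and> ennreal (1 - \<theta>) \<le> ?K (c l) (D l)) \<and>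
    (\<forall>l\<in>{1..j}. \<forall>i\<in>{1..j}. l \<noteq> i \<longrightarrow> D l \<inter> D i = {})" if "j \<le> k + 1" for j
    using that
  proof (induction j)
    case 0
    then show ?case by auto
  next
    case (Suc j)
    then have "j \<le> k + 1" by simp
    from Suc.IH[OF this] obtain c D where
      cD: "\<forall>l\<in>{1..j}. c l \<in> F \<and> D l \<in> sets \<beta> \<and> D l \<subseteq> A (c l) \<and> ennreal (1 - \<theta>) \<le> ?K (c l) (D l)"
        "\<forall>l\<in>{1..j}. \<forall>i\<in>{1..j}. l \<noteq> i \<longrightarrow> D l \<inter> D i = {}"
      by (elim exE conjE)
    have c: "\<And>l. l \<in> {1..j} \<Longrightarrow> c l \<in> F"
      and D: "\<And>l. l \<in> {1..j} \<Longrightarrow> D l \<in> sets \<beta>" "\<And>l. l \<in> {1..j} \<Longrightarrow> D l \<subseteq> A (c l)"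
      and K: "\<And>l. l \<in> {1..j} \<Longrightarrow> ennreal (1 - \<theta>) \<le> ?K (c l) (D l)"
      and disj: "\<And>l i. l \<in> {1..j} \<Longrightarrow> i \<in> {1..j} \<Longrightarrow> l \<noteq> i \<Longrightarrow> D l \<inter> D i = {}"
      using cD by auto
    define U where "U = (\<Union>l\<in>{1..j}. D l)"
    have U [measurable]: "U \<in> sets \<beta>" unfolding U_def using D(1) by auto
    \<comment> \<open>Otherwise every \<open>t\<close> in \<open>F\<close> captures at most
      \<open>1 - \<theta>\<close> outside \<open>U\<close>. By Fubini the mean capture inside
      \<open>U\<close> is its \<open>q\<close>-mass, so the mean over \<open>t\<close> would be at
      most \<open>1 - \<theta> + real k / \<gamma>\<close>, against \<open>large\<close>.\<close>
    have "\<exists>t\<in>F. ennreal (1 - \<theta>) \<le> ?K t (A t - U)"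
    proof (rule ccontr)
      assume "\<not> ?thesis"
      then have small: "?K t (A t - U) \<le> ennreal (1 - \<theta>)" if "t \<in> F" for t
        using that by (auto simp: not_le)
      \<comment> \<open>On \<open>D l\<close> the density \<open>q\<close> is at most
        \<open>w (c l)\<close> divided by \<open>\<gamma>\<close>, and \<open>w (c l)\<close> has
        total mass 1: each region contributes at most \<open>1 / \<gamma>\<close>.\<close>
      have qU: "(\<integral>\<^sup>+y. q y * indicator U y \<partial>\<beta>) \<le> ennreal (real k / \<gamma>)"
      proof -
        have "(\<integral>\<^sup>+y. q y * indicator U y \<partial>\<beta>) \<le> (\<integral>\<^sup>+y. (\<Sum>l\<in>{1..j}. q y * indicator (D l) y) \<partial>\<beta>)"
        proof (intro nn_integral_mono)
          fix y
          have "indicator U y \<le> (\<Sum>l\<in>{1..j}. indicator (D l) y :: ennreal)"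
          proof (cases "y \<in> U")
            case True
            then obtain l where l: "l \<in> {1..j}" "y \<in> D l" by (auto simp: U_def)
            then show ?thesis
              using member_le_sum[of l "{1..j}" "\<lambda>l. indicator (D l) y :: ennreal"] by (auto simp: indicator_def)
          qed (simp add: indicator_def)
          then show "q y * indicator U y \<le> (\<Sum>l\<in>{1..j}. q y * indicator (D l) y)"
            by (simp add: sum_distrib_left[symmetric] mult_left_mono)
        qed
        also have "\<dots> = (\<Sum>l\<in>{1..j}. \<integral>\<^sup>+y. q y * indicator (D l) y \<partial>\<beta>)"
          using D(1) by (intro nn_integral_sum) auto
        also have "\<dots> \<le> (\<Sum>l\<in>{1..j}. ennreal (1 / \<gamma>))"
        proof (intro sum_mono)
          fix l assume l: "l \<in> {1..j}"
          have "(\<integral>\<^sup>+y. q y * indicator (D l) y \<partial>\<beta>) \<le> (\<integral>\<^sup>+y. ennreal (1 / \<gamma>) * w (c l) y \<partial>\<beta>)"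
          proof (intro nn_integral_mono)
            fix y
            show "q y * indicator (D l) y \<le> ennreal (1 / \<gamma>) * w (c l) y"
            proof (cases "y \<in> D l")
              case True
              then have "ennreal \<gamma> * q y \<le> w (c l) y" using D(2)[OF l] by (auto simp: A_def)
              then have "ennreal (1 / \<gamma>) * (ennreal \<gamma> * q y) \<le> ennreal (1 / \<gamma>) * w (c l) y"
                by (rule mult_left_mono) simp
              moreover have "ennreal (1 / \<gamma>) * (ennreal \<gamma> * q y) = q y"
                using \<gamma> by (simp add: mult.assoc[symmetric] ennreal_mult[symmetric])
              ultimately show ?thesis using True by simp
            qed simp
          qed
          also have "\<dots> = ennreal (1 / \<gamma>)"
            using F_sub[OF c[OF l]] by (subst nn_integral_cmult) (auto simp: total)
          finally show "(\<integral>\<^sup>+y. q y * indicator (D l) y \<partial>\<beta>) \<le> ennreal (1 / \<gamma>)" .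
        qed
        also have "\<dots> = ennreal (real j / \<gamma>)"
          using \<gamma> by (simp add: ennreal_of_nat_eq_real_of_nat ennreal_mult[symmetric])
        also have "\<dots> \<le> ennreal (real k / \<gamma>)"
          using Suc.prems \<gamma> by (intro ennreal_leI divide_right_mono) auto
        finally show ?thesis .
      qed
      have "(\<integral>\<^sup>+t. (\<integral>\<^sup>+y. w t y * indicator {y. ennreal \<gamma> * q y \<le> w t y} y \<partial>\<beta>) * indicator F t \<partial>\<Phi>) \<le>
          (\<integral>\<^sup>+t. ennreal (1 - \<theta>) + (\<integral>\<^sup>+y. w t y * indicator U y \<partial>\<beta>) \<partial>\<Phi>)"
      proof (intro nn_integral_mono)
        fix t assume [measurable]: "t \<in> space \<Phi>"
        show "(\<integral>\<^sup>+y. w t y * indicator {y. ennreal \<gamma> * q y \<le> w t y} y \<partial>\<beta>) * indicator F t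
            \<le> ennreal (1 - \<theta>) + ?K t U"
        proof (cases "t \<in> F")
          case True
          have "(\<integral>\<^sup>+y. w t y * indicator {y. ennreal \<gamma> * q y \<le> w t y} y \<partial>\<beta>) \<le>
              (\<integral>\<^sup>+y. w t y * indicator (A t - U) y + w t y * indicator U y \<partial>\<beta>)"
            by (intro nn_integral_mono) (auto simp: indicator_def A_def)
          also have "\<dots> = ?K t (A t - U) + ?K t U"
            by (rule nn_integral_add) measurable
          also have "\<dots> \<le> ennreal (1 - \<theta>) + ?K t U"
            by (intro add_mono small True order_refl)
          finally show ?thesis using True by simp
        qed simp
      qed
      also have "\<dots> = ennreal (1 - \<theta>) + (\<integral>\<^sup>+t. (\<integral>\<^sup>+y. w t y * indicator U y \<partial>\<beta>) \<partial>\<Phi>)"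
        by (subst nn_integral_add) (auto simp: \<Phi>.emeasure_space_1)
      also have "(\<integral>\<^sup>+t. (\<integral>\<^sup>+y. w t y * indicator U y \<partial>\<beta>) \<partial>\<Phi>) = (\<integral>\<^sup>+y. (\<integral>\<^sup>+t. w t y * indicator U y \<partial>\<Phi>) \<partial>\<beta>)"
        by (rule Fubini'[symmetric]) measurable
      also have "\<dots> = (\<integral>\<^sup>+y. q y * indicator U y \<partial>\<beta>)"
      proof (intro nn_integral_cong)
        fix y assume y: "y \<in> space \<beta>"
        have "(\<lambda>t. w t y) \<in> borel_measurable \<Phi>"
          using measurable_compose[OF measurable_Pair2'[OF y] w] by simp
        then show "(\<integral>\<^sup>+t. w t y * indicator U y \<partial>\<Phi>) = q y * indicator U y"
          using y by (simp add: nn_integral_multc marginal)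
      qed
      also have "ennreal (1 - \<theta>) + (\<integral>\<^sup>+y. q y * indicator U y \<partial>\<beta>) \<le> ennreal (1 - \<theta>) + ennreal (real k / \<gamma>)"
        using qU by (intro add_mono) auto
      also have "\<dots> = ennreal (1 - \<theta> + real k / \<gamma>)"
        using \<theta> \<gamma> by simp
      finally show False using large by simp
    qed
    then obtain t where t: "t \<in> F" "ennreal (1 - \<theta>) \<le> ?K t (A t - U)" by blast
    let ?c = "c(Suc j := t)" and ?D = "D(Suc j := A t - U)"
    have cases: "l \<in> {1..Suc j} \<longleftrightarrow> l = Suc j \<or> l \<in> {1..j} \<and> l \<noteq> Suc j" for l by auto
    have dU: "D l \<inter> (A t - U) = {}" if "l \<in> {1..j}" for l
      using that by (auto simp: U_def)
    show ?case
    proof (intro exI[of _ ?c] exI[of _ ?D] conjI ballI impI)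
      fix l assume "l \<in> {1..Suc j}"
      then consider "l = Suc j" | "l \<in> {1..j}" "l \<noteq> Suc j" using cases by blast
      note l = this
      show "?c l \<in> F" using l by cases (use t c in auto)
      show "?D l \<in> sets \<beta>" using l by cases (use F_sub[OF t(1)] D in auto)
      show "?D l \<subseteq> A (?c l)" using l by cases (use D in auto)
      show "ennreal (1 - \<theta>) \<le> ?K (?c l) (?D l)" using l by cases (use t K in auto)
      fix i assume "i \<in> {1..Suc j}" and li: "l \<noteq> i"
      then consider "i = Suc j" | "i \<in> {1..j}" "i \<noteq> Suc j" using cases by blast
      then show "?D l \<inter> ?D i = {}"
        by cases (use l li dU[of l] dU[of i] disj[of l i] in auto)
    qed
  qed
  from step[of "k + 1"] show ?thesis by blast
qed


section \<open>The gain process\<close>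

lemma vectorize_unvectorize: "(\<chi> i j. vectorize g $ (j, i)) = (g :: complex^'t^'r)"
  by (simp add: vectorize_def vec_eq_iff)

text \<open>Undoing \<open>vectorize\<close> permutes real coordinates, hence preserves Lebesgue
  measure and the norm, and carries the standard density on vectors to that on matrices.\<close>

lemma rayleigh_matrix_law:
  fixes H :: "'w \<Rightarrow> complex^'t^'r"
  assumes "rayleigh_matrix M H"
  shows "H \<in> borel_measurable M" "distr M borel H = rayleigh"
proof -
  define u :: "complex^('t \<times> 'r) \<Rightarrow> complex^'t^'r" where "u x = (\<chi> i j. x $ (j, i))" for x
  have [measurable]: "u \<in> borel_measurable borel" unfolding u_def[abs_def] by measurable
  have uv: "u (vectorize g) = g" for g by (simp add: u_def vectorize_unvectorize)
  have d: "distributed M lborel (\<lambda>\<omega>. vectorize (H \<omega>)) (\<lambda>z. ennreal (complex_gaussian_density (mat 1) z))"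
    using assms by (simp add: rayleigh_matrix_def complex_gaussian_def)
  then have [measurable]: "(\<lambda>\<omega>. vectorize (H \<omega>)) \<in> borel_measurable M"
    by (simp add: distributed_def)
  have H: "H = u \<circ> (\<lambda>\<omega>. vectorize (H \<omega>))" by (simp add: uv comp_def)
  show "H \<in> borel_measurable M" by (subst H, rule measurable_comp[of _ _ borel]) measurable
  let ?I = "UNIV \<times> UNIV \<times> (Basis :: complex set)"
  let ?a = "\<lambda>(i :: 'r, k :: 't, w :: complex). axis (k, i) w"
  have "bij_betw (\<lambda>(i :: 'r, k :: 't, w :: complex). ((k, i), w)) ?I (UNIV \<times> Basis)"
    by (rule bij_betwI[where g="\<lambda>((k, i), w). (i, k, w)"]) auto
  from bij_betw_trans[OF this bij_betw_axis[of id]]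
  have a: "bij_betw ?a ?I Basis" by (simp add: comp_def case_prod_unfold)
  note sp = a bij_betw_axis_axis[of id, OF bij_id, unfolded id_apply]
  have uu: "distr lborel borel u = lborel"
    by (rule lborel_distr_signed_permutation[OF sp, where c="\<lambda>_. 1"]) (auto simp: u_def inner_axis_axis' inner_axis)
  have nu: "norm (u x) = norm x" for x
    by (rule norm_signed_permutation[OF sp, where c="\<lambda>_. 1"]) (auto simp: u_def inner_axis_axis' inner_axis)
  have "distr M borel H = distr (distr M lborel (\<lambda>\<omega>. vectorize (H \<omega>))) borel u"
    by (subst H) (simp add: distr_distr comp_def)
  also have "distr M lborel (\<lambda>\<omega>. vectorize (H \<omega>)) = density lborel (\<lambda>z. ennreal (exp (- (norm (u z))\<^sup>2) / pi ^ (CARD('t) * CARD('r))))"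
    using d by (simp add: distributed_def complex_gaussian_density_quad quad_mat_1 nu)
  also have "distr \<dots> borel u = density (distr lborel borel u) (\<lambda>g. ennreal (exp (- (norm g)\<^sup>2) / pi ^ (CARD('t) * CARD('r))))"
    by (rule density_distr[symmetric]) auto
  finally show "distr M borel H = rayleigh" by (simp add: uu rayleigh_def)
qed

lemma nn_integral_lborel_scale:
  fixes f :: "'a::euclidean_space \<Rightarrow> ennreal"
  assumes [measurable]: "f \<in> borel_measurable borel" and c: "0 < c"
  shows "(\<integral>\<^sup>+x. f x \<partial>lborel) = ennreal (c ^ DIM('a)) * (\<integral>\<^sup>+x. f (t + c *\<^sub>R x) \<partial>lborel)"
  using c by (subst lborel_affine[of c t]) (simp_all add: nn_integral_density nn_integral_distr nn_integral_cmult)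

text \<open>Rotation invariance of the standard Gaussian law. The pair \<open>x\<close>,
  \<open>u = a *\<^sub>R x + b *\<^sub>R y\<close> is described by the law of \<open>u\<close> and
  the conditional law of \<open>x\<close> given \<open>u\<close>, which has mean
  \<open>a *\<^sub>R u\<close> and integrates out.\<close>

lemma rayleigh_convolution:
  fixes F :: "complex^'t^'r \<Rightarrow> ennreal"
  assumes b: "0 < b" and ab: "a\<^sup>2 + b\<^sup>2 = (1 :: real)" and [measurable]: "F \<in> borel_measurable borel"
  shows "(\<integral>\<^sup>+x. (\<integral>\<^sup>+y. F (a *\<^sub>R x + b *\<^sub>R y) \<partial>rayleigh) \<partial>rayleigh) = (\<integral>\<^sup>+x. F x \<partial>rayleigh)"
proof -
  let ?c = "pi ^ (CARD('t) * CARD('r))"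
  let ?D = "DIM(complex^'t^'r)"
  let ?r = "\<lambda>g :: complex^'t^'r. ennreal (exp (- (norm g)\<^sup>2) / ?c)"
  let ?k = "\<lambda>x u :: complex^'t^'r. ennreal (exp (- (1 / b\<^sup>2) * (norm (x - a *\<^sub>R u))\<^sup>2) / ?c / b ^ ?D)"
  \<comment> \<open>The joint density of \<open>x\<close> and \<open>u\<close> factorised the other
    way round: \<open>?k x u\<close> is the conditional density of \<open>x\<close> given
    \<open>u\<close>. The identity of the exponents uses
    \<open>a\<^sup>2 + b\<^sup>2 = 1\<close>.\<close>
  have kern: "?r x * (?r ((1 / b) *\<^sub>R (u - a *\<^sub>R x)) * ennreal (1 / b ^ ?D)) = ?r u * ?k x u" for x u
  proof -
    have "(norm x)\<^sup>2 + (norm ((1 / b) *\<^sub>R (u - a *\<^sub>R x)))\<^sup>2 = (norm u)\<^sup>2 + (1 / b\<^sup>2) * (norm (x - a *\<^sub>R u))\<^sup>2"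
    proof -
      have "(norm x)\<^sup>2 = (a\<^sup>2 + b\<^sup>2) * (norm x)\<^sup>2" "(norm u)\<^sup>2 = (a\<^sup>2 + b\<^sup>2) * (norm u)\<^sup>2"
        by (simp_all add: ab)
      moreover have "(norm (u - a *\<^sub>R x))\<^sup>2 = (norm u)\<^sup>2 - 2 * a * (u \<bullet> x) + a\<^sup>2 * (norm x)\<^sup>2"
        "(norm (x - a *\<^sub>R u))\<^sup>2 = (norm x)\<^sup>2 - 2 * a * (u \<bullet> x) + a\<^sup>2 * (norm u)\<^sup>2"
        unfolding power2_norm_eq_inner
        by (simp_all add: inner_diff_left inner_diff_right inner_commute power2_eq_square[of a] algebra_simps)
      ultimately have "b\<^sup>2 * (norm x)\<^sup>2 + (norm (u - a *\<^sub>R x))\<^sup>2 = b\<^sup>2 * (norm u)\<^sup>2 + (norm (x - a *\<^sub>R u))\<^sup>2"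
        by (simp add: algebra_simps)
      then show ?thesis
        unfolding norm_scaleR using b by (simp add: power_mult_distrib power_divide field_simps)
    qed
    then have "exp (- (norm x)\<^sup>2) * exp (- (norm ((1 / b) *\<^sub>R (u - a *\<^sub>R x)))\<^sup>2) =
        exp (- (norm u)\<^sup>2) * exp (- (1 / b\<^sup>2) * (norm (x - a *\<^sub>R u))\<^sup>2)"
      unfolding exp_add[symmetric] by (intro arg_cong[where f=exp]) linarith
    then show ?thesis
      using b by (simp add: ennreal_mult[symmetric] del: norm_scaleR)
  qed
  have inner: "(\<integral>\<^sup>+y. ?r y * F (a *\<^sub>R x + b *\<^sub>R y) \<partial>lborel) =
      (\<integral>\<^sup>+u. ?r ((1 / b) *\<^sub>R (u - a *\<^sub>R x)) * ennreal (1 / b ^ ?D) * F u \<partial>lborel)" for x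
  proof -
    have "(\<integral>\<^sup>+u. ?r ((1 / b) *\<^sub>R (u - a *\<^sub>R x)) * ennreal (1 / b ^ ?D) * F u \<partial>lborel) =
        ennreal (b ^ ?D) * (\<integral>\<^sup>+y. ?r y * ennreal (1 / b ^ ?D) * F (a *\<^sub>R x + b *\<^sub>R y) \<partial>lborel)"
      using b by (subst nn_integral_lborel_scale[OF _ b, where t="a *\<^sub>R x"]) auto
    also have "\<dots> = ennreal (b ^ ?D) * (ennreal (1 / b ^ ?D) * (\<integral>\<^sup>+y. ?r y * F (a *\<^sub>R x + b *\<^sub>R y) \<partial>lborel))"
      by (subst nn_integral_cmult[symmetric]) (auto simp: mult_ac)
    finally show ?thesis
      using b by (simp add: mult.assoc[symmetric] ennreal_mult[symmetric])
  qed
  have k1: "(\<integral>\<^sup>+x. ?k x u \<partial>lborel) = 1" for u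
  proof -
    have "(\<integral>\<^sup>+x. ?k x u \<partial>lborel) = (\<integral>\<^sup>+x. ennreal (exp (- (1 / b\<^sup>2) * (norm (x :: complex^'t^'r))\<^sup>2) / ?c / b ^ ?D) \<partial>lborel)"
      using nn_integral_lborel_translate[of "\<lambda>x. ennreal (exp (- (1 / b\<^sup>2) * (norm (x :: complex^'t^'r))\<^sup>2) / ?c / b ^ ?D)" "- (a *\<^sub>R u)"]
      by simp
    also have "\<dots> = (\<integral>\<^sup>+x. ennreal (exp (- (1 / b\<^sup>2) * (norm (x :: complex^'t^'r))\<^sup>2)) * ennreal (1 / (?c * b ^ ?D)) \<partial>lborel)"
      using b by (intro nn_integral_cong) (simp add: ennreal_mult[symmetric])
    also have "\<dots> = ennreal (sqrt (pi / (1 / b\<^sup>2)) ^ ?D) * ennreal (1 / (?c * b ^ ?D))"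
      using b by (subst nn_integral_multc, measurable, subst nn_integral_gauss) simp_all
    also have "\<dots> = 1"
      using b by (simp add: DIM_complex_mat sqrt_power_double ennreal_mult[symmetric] power_mult_distrib power_mult[symmetric] del: DIM_cart)
    finally show ?thesis .
  qed
  have "(\<integral>\<^sup>+x. (\<integral>\<^sup>+y. F (a *\<^sub>R x + b *\<^sub>R y) \<partial>rayleigh) \<partial>rayleigh) =
      (\<integral>\<^sup>+x. ?r x * (\<integral>\<^sup>+y. ?r y * F (a *\<^sub>R x + b *\<^sub>R y) \<partial>lborel) \<partial>lborel)"
    by (simp add: nn_integral_rayleigh)
  also have "\<dots> = (\<integral>\<^sup>+x. (\<integral>\<^sup>+u. ?r u * ?k x u * F u \<partial>lborel) \<partial>lborel)"
    unfolding inner kern[symmetric]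
    by (intro nn_integral_cong, subst nn_integral_cmult[symmetric]) (auto simp: mult.assoc)
  also have "\<dots> = (\<integral>\<^sup>+u. (\<integral>\<^sup>+x. ?r u * ?k x u * F u \<partial>lborel) \<partial>lborel)"
    by (rule lborel_pair.Fubini'[symmetric]) measurable
  also have "\<dots> = (\<integral>\<^sup>+u. ?r u * F u * (\<integral>\<^sup>+x. ?k x u \<partial>lborel) \<partial>lborel)"
    by (intro nn_integral_cong, subst nn_integral_cmult[symmetric]) (auto simp: mult_ac)
  also have "\<dots> = (\<integral>\<^sup>+x. F x \<partial>rayleigh)"
    unfolding k1 by (simp add: nn_integral_rayleigh)
  finally show ?thesis .
qed

section \<open>Stationarity and decorrelation of the gains\<close>

context gauss_markov_channel
begin

lemma innovations_rv: "2 \<le> i \<Longrightarrow> random_variable borel (W i)"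
  using rayleigh_matrix_law(1) innovation_rayleigh by blast

text \<open>Merges the initial gain and the innovations into one independent sequence, so that
  independence can be read off from disjoint sets of times.\<close>

definition source :: "nat \<Rightarrow> 'w \<Rightarrow> complex^'t^'r" where
  "source i = (if i = 1 then G 1 else W i)"

lemma source_indep: "indep_vars (\<lambda>_. borel) source {1..}"
  using initial_innovations_indep unfolding source_def[abs_def] .

text \<open>The part of the gain at time \<open>j + d\<close> that stems from innovations after time
  \<open>j\<close>.\<close>

definition fresh :: "nat \<Rightarrow> nat \<Rightarrow> (nat \<Rightarrow> complex^'t^'r) \<Rightarrow> complex^'t^'r" where
  "fresh j d x = (\<Sum>l=j+1..j+d. (sqrt \<alpha> ^ (j + d - l) * sqrt (1 - \<alpha>)) *\<^sub>R x l)"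

lemma gain_decompose:
  assumes j: "1 \<le> j" and \<omega>: "\<omega> \<in> space M"
  shows "G (j + d) \<omega> = sqrt \<alpha> ^ d *\<^sub>R G j \<omega> + fresh j d (\<lambda>l. source l \<omega>)"
proof (induction d)
  case 0
  then show ?case by (simp add: fresh_def)
next
  case (Suc d)
  have "G (j + Suc d) \<omega> = sqrt \<alpha> *\<^sub>R G (j + d) \<omega> + sqrt (1 - \<alpha>) *\<^sub>R W (j + Suc d) \<omega>"
    using gain_recursion[of "j + Suc d" \<omega>] j \<omega> by simp
  moreover have "fresh j (Suc d) (\<lambda>l. source l \<omega>) = sqrt \<alpha> *\<^sub>R fresh j d (\<lambda>l. source l \<omega>) + sqrt (1 - \<alpha>) *\<^sub>R W (j + Suc d) \<omega>"
  proof -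
    have "(\<Sum>l=j+1..j+d. (sqrt \<alpha> ^ (j + Suc d - l) * sqrt (1 - \<alpha>)) *\<^sub>R source l \<omega>) = sqrt \<alpha> *\<^sub>R fresh j d (\<lambda>l. source l \<omega>)"
      unfolding fresh_def scaleR_sum_right by (intro sum.cong refl) (auto simp: Suc_diff_le)
    moreover have "source (j + Suc d) = W (j + Suc d)" using j by (simp add: source_def)
    ultimately show ?thesis by (simp add: fresh_def)
  qed
  ultimately show ?case by (simp add: Suc scaleR_add_right)
qed

text \<open>The gain at time \<open>j\<close> as an explicit function of the sources up to
  \<open>j\<close>. The two agree on \<open>space M\<close>, where the recursion is assumed.\<close>

definition past :: "nat \<Rightarrow> (nat \<Rightarrow> complex^'t^'r) \<Rightarrow> complex^'t^'r" where
  "past j x = sqrt \<alpha> ^ (j - 1) *\<^sub>R x 1 + fresh 1 (j - 1) x"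

lemma gain_past: "1 \<le> j \<Longrightarrow> \<omega> \<in> space M \<Longrightarrow> G j \<omega> = past j (\<lambda>l. source l \<omega>)"
  using gain_decompose[of 1 \<omega> "j - 1"] by (simp add: past_def source_def)

text \<open>The two variables are measurable functions of the sources with indices in
  \<open>{1..j}\<close> and in \<open>{j+1..j+d}\<close>, which are disjoint blocks of an
  independent family.\<close>

lemma indep_past_fresh:
  assumes "1 \<le> j"
  shows "indep_var borel (\<lambda>\<omega>. past j (\<lambda>l. source l \<omega>)) borel (\<lambda>\<omega>. fresh j d (\<lambda>l. source l \<omega>))"
proof -
  have i: "indep_var (PiM {1..j} (\<lambda>_. borel)) (\<lambda>\<omega>. \<lambda>i\<in>{1..j}. source i \<omega>) (PiM {j+1..j+d} (\<lambda>_. borel)) (\<lambda>\<omega>. \<lambda>i\<in>{j+1..j+d}. source i \<omega>)"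
    by (rule indep_var_restrict[OF source_indep]) auto
  have mf: "fresh j d \<in> borel_measurable (PiM {j+1..j+d} (\<lambda>_. borel))" for j d
    unfolding fresh_def[abs_def] by (intro borel_measurable_sum borel_measurable_scaleR borel_measurable_const measurable_component_singleton) auto
  have mp: "past j \<in> borel_measurable (PiM {1..j} (\<lambda>_. borel))"
  proof -
    have "fresh 1 (j - 1) \<in> borel_measurable (PiM {1..j} (\<lambda>_. borel))"
      unfolding fresh_def[abs_def]
      by (intro borel_measurable_sum borel_measurable_scaleR borel_measurable_const measurable_component_singleton) (use assms in auto)
    then show ?thesis
      unfolding past_def[abs_def]
      by (intro borel_measurable_add borel_measurable_scaleR borel_measurable_const measurable_component_singleton) (use assms in auto)
  qed
  have "fresh j d (\<lambda>i\<in>{j+1..j+d}. source i \<omega>) = fresh j d (\<lambda>l. source l \<omega>)" for \<omega>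
    unfolding fresh_def by (intro sum.cong) auto
  moreover have "past j (\<lambda>i\<in>{1..j}. source i \<omega>) = past j (\<lambda>l. source l \<omega>)" for \<omega>
  proof -
    have "fresh 1 (j - 1) (\<lambda>i\<in>{1..j}. source i \<omega>) = fresh 1 (j - 1) (\<lambda>l. source l \<omega>)"
      unfolding fresh_def by (intro sum.cong) (use assms in auto)
    then show ?thesis using assms by (simp add: past_def)
  qed
  ultimately show ?thesis
    using indep_var_compose[OF i mp mf] by (simp add: comp_def)
qed

lemma past_rv: "1 \<le> j \<Longrightarrow> random_variable borel (\<lambda>\<omega>. past j (\<lambda>l. source l \<omega>))"
  and fresh_rv: "1 \<le> j \<Longrightarrow> random_variable borel (\<lambda>\<omega>. fresh j d (\<lambda>l. source l \<omega>))"
  using indep_past_fresh indep_var_rv1 indep_var_rv2 by blast+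

lemma gains_rv: "1 \<le> j \<Longrightarrow> random_variable borel (G j)"
  using past_rv[of j] by (subst measurable_cong[OF gain_past]) auto

text \<open>Stationarity: the coefficients \<open>sqrt \<alpha>\<close> and
  \<open>sqrt (1 - \<alpha>)\<close> have squares that sum to 1, so one step of the recursion is an
  instance of \<open>rayleigh_convolution\<close>; its condition \<open>0 < b\<close> is
  \<open>\<alpha> < 1\<close>.\<close>

lemma gains_law:
  assumes "0 \<le> \<alpha>" "\<alpha> < 1" and "1 \<le> j"
  shows "distr M borel (G j) = rayleigh"
  using assms(3)
proof (induction j rule: dec_induct)
  case base
  show ?case by (rule rayleigh_matrix_law(2)[OF initial_rayleigh])
next
  case (step j)
  let ?a = "sqrt \<alpha>" and ?b = "sqrt (1 - \<alpha>)"
  let ?P = "\<lambda>\<omega>. past j (\<lambda>l. source l \<omega>)" and ?F = "\<lambda>\<omega>. fresh j 1 (\<lambda>l. source l \<omega>)"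
  have j: "1 \<le> j" using step by simp
  have F: "?F \<omega> = ?b *\<^sub>R W (Suc j) \<omega>" for \<omega>
    using j by (simp add: fresh_def source_def)
  note [measurable] = past_rv[OF j] fresh_rv[OF j, of 1] innovations_rv[of "Suc j"]
  have lP: "distr M borel ?P = rayleigh"
    using step(3) by (subst (asm) distr_cong[OF refl refl gain_past[OF j]]) auto
  have lW: "distr M borel (W (Suc j)) = rayleigh"
    using j by (intro rayleigh_matrix_law(2) innovation_rayleigh) auto
  have mW [measurable]: "W (Suc j) \<in> borel_measurable M" using innovations_rv[of "Suc j"] j by simp
  have pair: "distr M borel ?P \<Otimes>\<^sub>M distr M borel ?F = distr M (borel \<Otimes>\<^sub>M borel) (\<lambda>\<omega>. (?P \<omega>, ?F \<omega>))"
    using indep_past_fresh[OF j, of 1] unfolding indep_var_distribution_eq by blast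
  have lF: "distr M borel ?F = distr rayleigh borel (\<lambda>y. ?b *\<^sub>R y)"
    unfolding F lW[symmetric] by (subst distr_distr) (auto simp: comp_def)
  interpret F: prob_space "distr M borel ?F" by (rule prob_space_distr, rule fresh_rv[OF j])
  show ?case
  proof (rule measure_eqI)
    fix A assume "A \<in> sets (distr M borel (G (Suc j)))"
    then have [measurable]: "A \<in> sets borel" by simp
    have "emeasure (distr M borel (G (Suc j))) A = (\<integral>\<^sup>+\<omega>. indicator A (G (Suc j) \<omega>) \<partial>M)"
      using gains_rv[of "Suc j"] by (subst nn_integral_indicator[symmetric], simp, subst nn_integral_distr) auto
    also have "\<dots> = (\<integral>\<^sup>+\<omega>. indicator A (?a *\<^sub>R ?P \<omega> + ?F \<omega>) \<partial>M)"
      using gain_decompose[OF j, of _ 1] gain_past[OF j] by (intro nn_integral_cong) simp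
    also have "\<dots> = (\<integral>\<^sup>+z. indicator A (?a *\<^sub>R fst z + snd z) \<partial>distr M (borel \<Otimes>\<^sub>M borel) (\<lambda>\<omega>. (?P \<omega>, ?F \<omega>)))"
      by (subst nn_integral_distr) (auto simp del: One_nat_def)
    also have "\<dots> = (\<integral>\<^sup>+x. (\<integral>\<^sup>+y. indicator A (?a *\<^sub>R x + y) \<partial>distr M borel ?F) \<partial>distr M borel ?P)"
      unfolding pair[symmetric]
      by (subst F.nn_integral_fst[symmetric]) (auto simp: borel_prod)
    also have "\<dots> = (\<integral>\<^sup>+x. (\<integral>\<^sup>+y. indicator A (?a *\<^sub>R x + ?b *\<^sub>R y) \<partial>rayleigh) \<partial>rayleigh)"
      unfolding lP lF by (subst nn_integral_distr) auto
    also have "\<dots> = (\<integral>\<^sup>+x. indicator A x \<partial>rayleigh)"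
      using assms by (intro rayleigh_convolution) auto
    also have "\<dots> = emeasure rayleigh A" by simp
    finally show "emeasure (distr M borel (G (Suc j))) A = emeasure rayleigh A" .
  qed simp
qed

lemma integral_gains:
  fixes f :: "complex^'t^'r \<Rightarrow> real"
  assumes "0 \<le> \<alpha>" "\<alpha> < 1" "1 \<le> j" and [measurable]: "f \<in> borel_measurable borel"
  shows "expectation (\<lambda>\<omega>. f (G j \<omega>)) = (\<integral>g. f g \<partial>rayleigh)"
    and "integrable rayleigh f \<Longrightarrow> integrable M (\<lambda>\<omega>. f (G j \<omega>))"
  unfolding gains_law[OF assms(1-3), symmetric]
  using gains_rv[OF assms(3)] by (simp_all add: integral_distr integrable_distr_eq)

text \<open>The gain at time \<open>j + d\<close> differs from a variable independent of the gain at time \<open>j\<close> by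
  \<open>sqrt \<alpha> ^ d\<close> times the latter.\<close>

lemma gains_mixing:
  fixes \<phi> :: "complex^'t^'r \<Rightarrow> real"
  assumes \<alpha>: "0 \<le> \<alpha>" "\<alpha> < 1" and [measurable]: "\<phi> \<in> borel_measurable borel"
    and B: "\<And>g. \<bar>\<phi> g\<bar> \<le> B" and uc: "uniformly_continuous_on UNIV \<phi>"
    and mean: "(\<integral>g. \<phi> g \<partial>rayleigh) = 0" and \<eta>: "0 < \<eta>"
  shows "\<exists>d0. \<forall>d\<ge>d0. \<forall>j\<ge>1. expectation (\<lambda>\<omega>. \<phi> (G j \<omega>) * \<phi> (G (j + d) \<omega>)) \<le> \<eta>"
proof -
  have B0: "0 \<le> B" using B[of 0] by linarith
  \<comment> \<open>Half of \<open>\<eta>\<close> is reserved for small shifts, where uniform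
    continuity acts; \<open>B + 1\<close> in place of \<open>B\<close> avoids division by 0.\<close>
  define \<eta>' where "\<eta>' = \<eta> / (2 * (B + 1))"
  have \<eta>': "0 < \<eta>'" "B * \<eta>' \<le> \<eta> / 2" using \<eta> B0 by (auto simp: \<eta>'_def field_simps)
  obtain \<rho> where \<rho>: "0 < \<rho>" "\<And>x y. dist x y < \<rho> \<Longrightarrow> dist (\<phi> x) (\<phi> y) < \<eta>'"
    using uc \<eta>'(1) unfolding uniformly_continuous_on_def by (metis UNIV_I)
  define E2 where "E2 = (\<integral>g. (norm (g :: complex^'t^'r))\<^sup>2 \<partial>rayleigh)"
  \<comment> \<open>The bound for large shifts: there the values differ by at most
    \<open>2 * B\<close>, and the event has indicator at most \<open>\<alpha> ^ d * (norm (G j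
    \<omega>))\<^sup>2 / \<rho>\<^sup>2\<close>, whose mean decays in \<open>d\<close>.\<close>
  define c where "c = B * (2 * B) / \<rho>\<^sup>2 * E2"
  have "(\<lambda>d. c * \<alpha> ^ d) \<longlonglongrightarrow> c * 0"
    using \<alpha> by (intro tendsto_mult_left LIMSEQ_power_zero) auto
  then have "eventually (\<lambda>d. c * \<alpha> ^ d < \<eta> / 2) sequentially"
    using \<eta> by (intro order_tendstoD(2)[of _ 0]) auto
  then obtain d0 where d0: "\<And>d. d \<ge> d0 \<Longrightarrow> c * \<alpha> ^ d < \<eta> / 2"
    by (auto simp: eventually_sequentially)
  have "expectation (\<lambda>\<omega>. \<phi> (G j \<omega>) * \<phi> (G (j + d) \<omega>)) \<le> \<eta>" if d: "d \<ge> d0" and j: "1 \<le> j" for d j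
  proof -
    let ?P = "\<lambda>\<omega>. past j (\<lambda>l. source l \<omega>)" and ?F = "\<lambda>\<omega>. fresh j d (\<lambda>l. source l \<omega>)"
    note [measurable] = past_rv[OF j] fresh_rv[OF j, of d] gains_rv[OF j]
    have [measurable]: "random_variable borel (G (j + d))" using gains_rv[of "j + d"] j by simp
    have bd: "integrable M (\<lambda>\<omega>. \<phi> (X \<omega>))" if "random_variable borel X" for X
      using that B by (intro integrable_const_bound[of _ B]) auto
    have bd2: "integrable M (\<lambda>\<omega>. \<phi> (X \<omega>) * \<phi> (Y \<omega>))" if "random_variable borel X" "random_variable borel Y" for X Y
      using that B B0 by (intro integrable_const_bound[of _ "B * B"]) (auto simp: abs_mult intro!: mult_mono)
    have ind: "indep_var borel (\<lambda>\<omega>. \<phi> (?P \<omega>)) borel (\<lambda>\<omega>. \<phi> (?F \<omega>))"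
      using indep_var_compose[OF indep_past_fresh[OF j, of d], of \<phi> borel \<phi> borel] by (simp add: comp_def)
    have "expectation (\<lambda>\<omega>. \<phi> (?P \<omega>) * \<phi> (?F \<omega>)) = expectation (\<lambda>\<omega>. \<phi> (?P \<omega>)) * expectation (\<lambda>\<omega>. \<phi> (?F \<omega>))"
      by (rule indep_var_lebesgue_integral[OF ind]) (auto intro!: bd)
    also have "expectation (\<lambda>\<omega>. \<phi> (?P \<omega>)) = expectation (\<lambda>\<omega>. \<phi> (G j \<omega>))"
      using gain_past[OF j] by (intro Bochner_Integration.integral_cong) auto
    also have "\<dots> = 0" using integral_gains(1)[OF \<alpha> j, of \<phi>] mean by simp
    finally have zero: "expectation (\<lambda>\<omega>. \<phi> (?P \<omega>) * \<phi> (?F \<omega>)) = 0" by simp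
    have int2: "integrable M (\<lambda>\<omega>. (norm (G j \<omega>))\<^sup>2)"
      by (rule integral_gains(2)[OF \<alpha> j]) (auto intro: integrable_rayleigh_norm2)
    \<comment> \<open>Replacing the later gain by its fresh part costs little, and the product with
      the fresh part has mean 0 because the earlier factor is centred and independent of it.\<close>
    have le: "\<phi> (G j \<omega>) * \<phi> (G (j + d) \<omega>) - \<phi> (?P \<omega>) * \<phi> (?F \<omega>) \<le>
        B * \<eta>' + B * (2 * B) / \<rho>\<^sup>2 * \<alpha> ^ d * (norm (G j \<omega>))\<^sup>2" if \<omega>: "\<omega> \<in> space M" for \<omega>
    proof -
      have D: "dist (G (j + d) \<omega>) (?F \<omega>) = sqrt \<alpha> ^ d * norm (G j \<omega>)"
        using gain_decompose[OF j \<omega>, of d] \<alpha> by (simp add: dist_norm)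
      have "\<bar>\<phi> (G (j + d) \<omega>) - \<phi> (?F \<omega>)\<bar> \<le> \<eta>' + 2 * B / \<rho>\<^sup>2 * \<alpha> ^ d * (norm (G j \<omega>))\<^sup>2"
      proof (cases "dist (G (j + d) \<omega>) (?F \<omega>) < \<rho>")
        case True
        then have "\<bar>\<phi> (G (j + d) \<omega>) - \<phi> (?F \<omega>)\<bar> \<le> \<eta>'" using \<rho>(2) by (simp add: dist_real_def less_imp_le)
        moreover have "0 \<le> 2 * B / \<rho>\<^sup>2 * \<alpha> ^ d * (norm (G j \<omega>))\<^sup>2" using \<alpha> B0 by simp
        ultimately show ?thesis by linarith
      next
        case False
        then have "\<rho>\<^sup>2 \<le> (sqrt \<alpha> ^ d * norm (G j \<omega>))\<^sup>2" using \<rho>(1) D by (intro power_mono) auto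
        also have "\<dots> = \<alpha> ^ d * (norm (G j \<omega>))\<^sup>2"
          using \<alpha> by (simp add: power_mult_distrib power_mult[symmetric] mult.commute[of d])
             (simp add: power_mult)
        finally have "1 \<le> \<alpha> ^ d * (norm (G j \<omega>))\<^sup>2 / \<rho>\<^sup>2" using \<rho>(1) by (simp add: field_simps)
        then have "2 * B * 1 \<le> 2 * B * (\<alpha> ^ d * (norm (G j \<omega>))\<^sup>2 / \<rho>\<^sup>2)" using B0 by (intro mult_left_mono) auto
        moreover have "\<bar>\<phi> (G (j + d) \<omega>) - \<phi> (?F \<omega>)\<bar> \<le> 2 * B"
          using B[of "G (j + d) \<omega>"] B[of "?F \<omega>"] by linarith
        ultimately show ?thesis using \<eta>'(1) by simp
      qed
      moreover have "\<phi> (G j \<omega>) * \<phi> (G (j + d) \<omega>) - \<phi> (?P \<omega>) * \<phi> (?F \<omega>) \<le> B * \<bar>\<phi> (G (j + d) \<omega>) - \<phi> (?F \<omega>)\<bar>"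
      proof -
        have "\<phi> (G j \<omega>) * \<phi> (G (j + d) \<omega>) - \<phi> (?P \<omega>) * \<phi> (?F \<omega>) = \<phi> (G j \<omega>) * (\<phi> (G (j + d) \<omega>) - \<phi> (?F \<omega>))"
          using gain_past[OF j \<omega>] by (simp add: right_diff_distrib)
        also have "\<dots> \<le> \<bar>\<phi> (G j \<omega>)\<bar> * \<bar>\<phi> (G (j + d) \<omega>) - \<phi> (?F \<omega>)\<bar>" by (simp add: abs_mult[symmetric])
        also have "\<dots> \<le> B * \<bar>\<phi> (G (j + d) \<omega>) - \<phi> (?F \<omega>)\<bar>" using B by (intro mult_right_mono) auto
        finally show ?thesis .
      qed
      ultimately have "\<phi> (G j \<omega>) * \<phi> (G (j + d) \<omega>) - \<phi> (?P \<omega>) * \<phi> (?F \<omega>) \<le>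
          B * (\<eta>' + 2 * B / \<rho>\<^sup>2 * \<alpha> ^ d * (norm (G j \<omega>))\<^sup>2)"
        using B0 by (meson mult_left_mono order_trans)
      then show ?thesis by (simp add: algebra_simps)
    qed
    have "expectation (\<lambda>\<omega>. \<phi> (G j \<omega>) * \<phi> (G (j + d) \<omega>)) =
        expectation (\<lambda>\<omega>. \<phi> (G j \<omega>) * \<phi> (G (j + d) \<omega>) - \<phi> (?P \<omega>) * \<phi> (?F \<omega>))"
      by (subst Bochner_Integration.integral_diff) (auto intro!: bd2 simp: zero)
    also have "\<dots> \<le> expectation (\<lambda>\<omega>. B * \<eta>' + B * (2 * B) / \<rho>\<^sup>2 * \<alpha> ^ d * (norm (G j \<omega>))\<^sup>2)"
      using le int2 by (intro integral_mono Bochner_Integration.integrable_diff bd2 Bochner_Integration.integrable_add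
          integrable_mult_right) auto
    also have "\<dots> = B * \<eta>' + B * (2 * B) / \<rho>\<^sup>2 * \<alpha> ^ d * E2"
      using int2 integral_gains(1)[OF \<alpha> j, of "\<lambda>g. (norm g)\<^sup>2"] by (simp add: prob_space E2_def)
    also have "\<dots> = B * \<eta>' + c * \<alpha> ^ d" by (simp add: c_def)
    also have "\<dots> \<le> \<eta>" using \<eta>'(2) d0[OF d] by linarith
    finally show ?thesis .
  qed
  then show ?thesis by blast
qed

text \<open>Chebyshev's inequality. Of the \<open>n\<^sup>2\<close> products in the second moment,
  those with indices less than \<open>d0\<close> apart are bounded by \<open>B\<^sup>2\<close> and
  are linear in number, while the others have mean at most \<open>\<eta>\<close>.\<close>

lemma gains_weak_law_bounded:
  fixes \<phi> :: "complex^'t^'r \<Rightarrow> real"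
  assumes \<alpha>: "0 \<le> \<alpha>" "\<alpha> < 1" and [measurable]: "\<phi> \<in> borel_measurable borel"
    and B: "\<And>g. \<bar>\<phi> g\<bar> \<le> B" and uc: "uniformly_continuous_on UNIV \<phi>"
    and mean: "(\<integral>g. \<phi> g \<partial>rayleigh) = 0" and \<epsilon>: "0 < \<epsilon>" and \<tau>: "0 < \<tau>"
  shows "eventually (\<lambda>n. prob {\<omega>\<in>space M. (\<Sum>i=1..n. \<phi> (G i \<omega>)) \<le> - (real n * \<epsilon>)} \<le> \<tau>) sequentially"
proof -
  have B0: "0 \<le> B" using B[of 0] by linarith
  \<comment> \<open>With this value the distant pairs contribute exactly \<open>\<tau> / 2\<close>
    after division by \<open>(real n * \<epsilon>)\<^sup>2\<close>.\<close>
  define \<eta> where "\<eta> = \<epsilon>\<^sup>2 * \<tau> / 2"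
  have \<eta>: "0 < \<eta>" using \<epsilon> \<tau> by (simp add: \<eta>_def)
  obtain d0 where d0: "\<And>d j. d \<ge> d0 \<Longrightarrow> j \<ge> 1 \<Longrightarrow> expectation (\<lambda>\<omega>. \<phi> (G j \<omega>) * \<phi> (G (j + d) \<omega>)) \<le> \<eta>"
    using gains_mixing[OF \<alpha> assms(3) B uc mean \<eta>] by blast
  have rv: "random_variable borel (\<lambda>\<omega>. \<phi> (G i \<omega>))" if "1 \<le> i" for i
    using gains_rv[OF that] by measurable
  have int: "integrable M (\<lambda>\<omega>. \<phi> (G i \<omega>) * \<phi> (G j \<omega>))" if "1 \<le> i" "1 \<le> j" for i j
    using rv[OF that(1)] rv[OF that(2)] B B0
    by (intro integrable_const_bound[of _ "B * B"]) (auto simp: abs_mult intro!: mult_mono)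
  define C where "C = (2 * real d0 + 1) * B\<^sup>2"
  have cov: "expectation (\<lambda>\<omega>. \<phi> (G i \<omega>) * \<phi> (G j \<omega>)) \<le> (if j < i + d0 \<and> i < j + d0 then B\<^sup>2 else 0) + \<eta>"
    if i: "1 \<le> i" and j: "1 \<le> j" for i j
  proof -
    have "expectation (\<lambda>\<omega>. \<phi> (G i \<omega>) * \<phi> (G j \<omega>)) \<le> expectation (\<lambda>\<omega>. B * B)"
    proof (intro integral_mono int i j)
      fix \<omega>
      have "\<phi> (G i \<omega>) * \<phi> (G j \<omega>) \<le> \<bar>\<phi> (G i \<omega>)\<bar> * \<bar>\<phi> (G j \<omega>)\<bar>" by (simp add: abs_mult[symmetric])
      also have "\<dots> \<le> B * B" using B B0 by (intro mult_mono) auto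
      finally show "\<phi> (G i \<omega>) * \<phi> (G j \<omega>) \<le> B * B" .
    qed simp
    then have 1: "expectation (\<lambda>\<omega>. \<phi> (G i \<omega>) * \<phi> (G j \<omega>)) \<le> B\<^sup>2"
      by (simp add: prob_space power2_eq_square)
    consider "j < i + d0 \<and> i < j + d0" | "i + d0 \<le> j" | "j + d0 \<le> i" by linarith
    then show ?thesis
    proof cases
      case 1
      then show ?thesis using \<open>expectation _ \<le> B\<^sup>2\<close> \<eta> by simp
    next
      case 2
      then show ?thesis using d0[of "j - i" i] i by simp
    next
      case 3
      then show ?thesis using d0[of "i - j" j] j by (simp add: mult.commute)
    qed
  qed
  have second: "expectation (\<lambda>\<omega>. (\<Sum>i=1..n. \<phi> (G i \<omega>))\<^sup>2) \<le> real n * C + (real n)\<^sup>2 * \<eta>" for n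
  proof -
    have "expectation (\<lambda>\<omega>. (\<Sum>i=1..n. \<phi> (G i \<omega>))\<^sup>2) = expectation (\<lambda>\<omega>. \<Sum>i=1..n. \<Sum>j=1..n. \<phi> (G i \<omega>) * \<phi> (G j \<omega>))"
      by (simp add: power2_eq_square sum_product)
    also have "\<dots> = (\<Sum>i=1..n. expectation (\<lambda>\<omega>. \<Sum>j=1..n. \<phi> (G i \<omega>) * \<phi> (G j \<omega>)))"
      by (intro Bochner_Integration.integral_sum Bochner_Integration.integrable_sum int) auto
    also have "\<dots> = (\<Sum>i=1..n. \<Sum>j=1..n. expectation (\<lambda>\<omega>. \<phi> (G i \<omega>) * \<phi> (G j \<omega>)))"
      by (intro sum.cong refl Bochner_Integration.integral_sum int) auto
    also have "\<dots> \<le> (\<Sum>i=1..n. C + real n * \<eta>)"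
    proof (intro sum_mono)
      fix i assume i: "i \<in> {1..n}"
      have "(\<Sum>j=1..n. expectation (\<lambda>\<omega>. \<phi> (G i \<omega>) * \<phi> (G j \<omega>))) \<le>
          (\<Sum>j=1..n. (if j < i + d0 \<and> i < j + d0 then B\<^sup>2 else 0) + \<eta>)"
        using i by (intro sum_mono cov) auto
      also have "\<dots> = (\<Sum>j\<in>{1..n} \<inter> {j. j < i + d0 \<and> i < j + d0}. B\<^sup>2) + real n * \<eta>"
        by (simp add: sum.distrib sum.If_cases)
      also have "(\<Sum>j\<in>{1..n} \<inter> {j. j < i + d0 \<and> i < j + d0}. B\<^sup>2) \<le> C"
      proof -
        have "card ({1..n} \<inter> {j. j < i + d0 \<and> i < j + d0}) \<le> card {i - d0..i + d0}"
          by (intro card_mono) auto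
        also have "\<dots> \<le> 2 * d0 + 1" by simp
        finally have "real (card ({1..n} \<inter> {j. j < i + d0 \<and> i < j + d0})) \<le> 2 * real d0 + 1" by linarith
        then show ?thesis by (simp add: C_def mult_right_mono)
      qed
      finally show "(\<Sum>j=1..n. expectation (\<lambda>\<omega>. \<phi> (G i \<omega>) * \<phi> (G j \<omega>))) \<le> C + real n * \<eta>" by simp
    qed
    also have "\<dots> = real n * C + (real n)\<^sup>2 * \<eta>" by (simp add: distrib_left power2_eq_square)
    finally show ?thesis .
  qed
  have bound: "prob {\<omega>\<in>space M. (\<Sum>i=1..n. \<phi> (G i \<omega>)) \<le> - (real n * \<epsilon>)} \<le> C / \<epsilon>\<^sup>2 / real n + \<tau> / 2" if n: "0 < n" for n
  proof -
    let ?S = "\<lambda>\<omega>. \<Sum>i=1..n. \<phi> (G i \<omega>)"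
    have rS [measurable]: "random_variable borel ?S" using rv by (intro borel_measurable_sum) auto
    have "(?S \<omega>)\<^sup>2 = (\<Sum>i=1..n. \<Sum>j=1..n. \<phi> (G i \<omega>) * \<phi> (G j \<omega>))" for \<omega>
      by (simp add: power2_eq_square sum_product)
    then have iS: "integrable M (\<lambda>\<omega>. (?S \<omega>)\<^sup>2)"
      by (simp only:) (intro Bochner_Integration.integrable_sum int, auto)
    have pos: "0 < (real n * \<epsilon>)\<^sup>2" using n \<epsilon> by simp
    have "prob {\<omega>\<in>space M. ?S \<omega> \<le> - (real n * \<epsilon>)} \<le> prob {\<omega>\<in>space M. (real n * \<epsilon>)\<^sup>2 \<le> (?S \<omega>)\<^sup>2}"
    proof (intro finite_measure_mono)
      show "{\<omega>\<in>space M. ?S \<omega> \<le> - (real n * \<epsilon>)} \<subseteq> {\<omega>\<in>space M. (real n * \<epsilon>)\<^sup>2 \<le> (?S \<omega>)\<^sup>2}"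
      proof safe
        fix \<omega> assume "?S \<omega> \<le> - (real n * \<epsilon>)"
        then have "(real n * \<epsilon>)\<^sup>2 \<le> (- ?S \<omega>)\<^sup>2" using \<epsilon> by (intro power_mono) auto
        then show "(real n * \<epsilon>)\<^sup>2 \<le> (?S \<omega>)\<^sup>2" by simp
      qed
    qed measurable
    also have "\<dots> \<le> expectation (\<lambda>\<omega>. (?S \<omega>)\<^sup>2) / (real n * \<epsilon>)\<^sup>2"
      by (rule integral_Markov_inequality_measure[OF iS, of "{}"]) (use pos in auto)
    also have "\<dots> \<le> (real n * C + (real n)\<^sup>2 * \<eta>) / (real n * \<epsilon>)\<^sup>2"
      using second[of n] pos by (intro divide_right_mono) auto
    also have "\<dots> = C / \<epsilon>\<^sup>2 / real n + \<tau> / 2"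
      using n \<epsilon> by (simp add: \<eta>_def power_mult_distrib add_divide_distrib power2_eq_square)
    finally show ?thesis .
  qed
  have "(\<lambda>n. C / \<epsilon>\<^sup>2 / real n) \<longlonglongrightarrow> 0"
    by (rule lim_const_over_n)
  then have "eventually (\<lambda>n. C / \<epsilon>\<^sup>2 / real n < \<tau> / 2) sequentially"
    using \<tau> by (intro order_tendstoD(2)[of _ 0]) auto
  with eventually_gt_at_top[of 0] show ?thesis
  proof eventually_elim
    case (elim n)
    then show ?case using bound[of n] by linarith
  qed
qed

text \<open>Only a lower bound is needed, so a nonnegative function may be truncated.\<close>

lemma gains_weak_law_lower:
  fixes f :: "complex^'t^'r \<Rightarrow> real"
  assumes \<alpha>: "0 \<le> \<alpha>" "\<alpha> < 1" and f: "continuous_on UNIV f" "\<And>g. 0 \<le> f g" "integrable rayleigh f"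
    and \<epsilon>: "0 < \<epsilon>" and \<tau>: "0 < \<tau>"
  shows "eventually (\<lambda>n. prob {\<omega>\<in>space M. (\<Sum>i=1..n. f (G i \<omega>)) \<le> real n * ((\<integral>g. f g \<partial>rayleigh) - \<epsilon>)} \<le> \<tau>) sequentially"
proof -
  interpret R: prob_space "rayleigh :: (complex^'t^'r) measure" by (rule prob_space_rayleigh)
  have [measurable]: "f \<in> borel_measurable borel" using f(1) by (rule borel_measurable_continuous_onI)
  \<comment> \<open>A continuous cutoff that vanishes from radius \<open>K\<close> on; the product
    with \<open>f\<close> is bounded and uniformly continuous, as the bounded weak law
    demands.\<close>
  define cut where "cut K g = max 0 (min 1 (real K - norm g))" for K and g :: "complex^'t^'r"
  have cut: "0 \<le> cut K g" "cut K g \<le> 1" for K g by (auto simp: cut_def)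
  have cut0: "cut K g = 0" if "real K \<le> norm g" for K g using that by (auto simp: cut_def)
  have ccut: "continuous_on UNIV (cut K)" for K unfolding cut_def by (intro continuous_intros)
  have [measurable]: "cut K \<in> borel_measurable borel" for K using ccut by (rule borel_measurable_continuous_onI)
  have le: "f g * cut K g \<le> f g" for K g using f(2)[of g] cut[of K g] by (simp add: mult_left_le)
  have "(\<lambda>K. \<integral>g. f g * cut K g \<partial>rayleigh) \<longlonglongrightarrow> (\<integral>g. f g \<partial>rayleigh)"
  proof (rule integral_dominated_convergence[where w=f])
    show "AE g in rayleigh. (\<lambda>K. f g * cut K g) \<longlonglongrightarrow> f g"
    proof (rule AE_I2)
      fix g :: "complex^'t^'r"
      obtain K0 :: nat where K0: "norm g + 1 \<le> real K0" using real_arch_simple by blast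
      have "eventually (\<lambda>K. f g * cut K g = f g) sequentially"
        using eventually_ge_at_top[of K0] by eventually_elim (use K0 in \<open>auto simp: cut_def\<close>)
      then show "(\<lambda>K. f g * cut K g) \<longlonglongrightarrow> f g" by (rule tendsto_eventually)
    qed
    show "AE g in rayleigh. norm (f g * cut K g) \<le> f g" for K
      using le f(2) cut by (intro AE_I2) simp
  qed (use f(3) in auto)
  then have "eventually (\<lambda>K. (\<integral>g. f g \<partial>rayleigh) - \<epsilon> / 2 < (\<integral>g. f g * cut K g \<partial>rayleigh)) sequentially"
    using \<epsilon> by (intro order_tendstoD(1)) auto
  then obtain K where K: "(\<integral>g. f g \<partial>rayleigh) - \<epsilon> / 2 < (\<integral>g. f g * cut K g \<partial>rayleigh)"
    by (auto simp: eventually_sequentially)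
  define \<psi> where "\<psi> g = f g * cut K g" for g
  define m where "m = (\<integral>g. \<psi> g \<partial>rayleigh)"
  have c\<psi>: "continuous_on UNIV \<psi>" unfolding \<psi>_def using f(1) ccut by (intro continuous_intros)
  have [measurable]: "\<psi> \<in> borel_measurable borel" using c\<psi> by (rule borel_measurable_continuous_onI)
  have \<psi>0: "\<psi> g = 0" if "real K \<le> norm g" for g using cut0[OF that] by (simp add: \<psi>_def)
  \<comment> \<open>The radius exceeds \<open>K\<close> by 1 so that two points less than 1 apart
    either both lie in the ball, where compactness applies, or both have norm at least
    \<open>K\<close>, where \<open>\<psi>\<close> is 0.\<close>
  let ?C = "cball (0 :: complex^'t^'r) (real K + 1)"
  have "bounded (\<psi> ` ?C)"
    by (intro compact_imp_bounded compact_continuous_image continuous_on_subset[OF c\<psi>] compact_cball subset_UNIV)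
  then obtain B where B: "\<And>g. g \<in> ?C \<Longrightarrow> norm (\<psi> g) \<le> B" unfolding bounded_iff by blast
  have "norm (\<psi> 0) \<le> B" by (rule B) simp
  then have B0: "0 \<le> B" using norm_ge_zero order_trans by blast
  have Bd: "\<bar>\<psi> g\<bar> \<le> B" for g
    using B[of g] B0 \<psi>0[of g] by (cases "norm g \<le> real K + 1") auto
  have uc: "uniformly_continuous_on UNIV \<psi>"
    unfolding uniformly_continuous_on_def
  proof (intro allI impI)
    fix e :: real assume e: "0 < e"
    have "uniformly_continuous_on ?C \<psi>"
      by (intro compact_uniformly_continuous continuous_on_subset[OF c\<psi>] compact_cball subset_UNIV)
    then obtain d where d: "0 < d" "\<And>x y. x \<in> ?C \<Longrightarrow> y \<in> ?C \<Longrightarrow> dist y x < d \<Longrightarrow> dist (\<psi> y) (\<psi> x) < e"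
      using e unfolding uniformly_continuous_on_def by metis
    have "dist (\<psi> y) (\<psi> x) < e" if xy: "dist y x < min d 1" for x y
    proof (cases "x \<in> ?C \<and> y \<in> ?C")
      case True
      then show ?thesis using d(2)[of x y] xy by simp
    next
      case False
      have "\<bar>norm y - norm x\<bar> < 1"
        using xy norm_triangle_ineq3[of y x] by (simp add: dist_norm)
      then have "real K \<le> norm x" "real K \<le> norm y" using False by auto
      then show ?thesis using \<psi>0 e by simp
    qed
    then show "\<exists>d>0. \<forall>x\<in>UNIV. \<forall>x'\<in>UNIV. dist x' x < d \<longrightarrow> dist (\<psi> x') (\<psi> x) < e"
      using d(1) by (intro exI[of _ "min d 1"]) auto
  qed
  have int\<psi>: "integrable rayleigh \<psi>" using Bd by (intro R.integrable_const_bound[of _ B]) auto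
  define \<phi> where "\<phi> g = \<psi> g - m" for g
  have "eventually (\<lambda>n. prob {\<omega>\<in>space M. (\<Sum>i=1..n. \<phi> (G i \<omega>)) \<le> - (real n * (\<epsilon> / 2))} \<le> \<tau>) sequentially"
  proof (rule gains_weak_law_bounded[OF \<alpha>, where B="B + \<bar>m\<bar>"])
    show "\<bar>\<phi> g\<bar> \<le> B + \<bar>m\<bar>" for g using Bd[of g] by (simp add: \<phi>_def)
    show "uniformly_continuous_on UNIV \<phi>"
      unfolding \<phi>_def by (intro uniformly_continuous_on_diff uc uniformly_continuous_on_const)
    show "(\<integral>g. \<phi> g \<partial>rayleigh) = 0"
      using int\<psi> R.prob_space by (simp add: \<phi>_def m_def)
  qed (use \<epsilon> \<tau> in \<open>auto simp: \<phi>_def[abs_def]\<close>)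
  then show ?thesis
  proof eventually_elim
    case (elim n)
    have "prob {\<omega>\<in>space M. (\<Sum>i=1..n. f (G i \<omega>)) \<le> real n * ((\<integral>g. f g \<partial>rayleigh) - \<epsilon>)}
        \<le> prob {\<omega>\<in>space M. (\<Sum>i=1..n. \<phi> (G i \<omega>)) \<le> - (real n * (\<epsilon> / 2))}"
    proof (intro finite_measure_mono)
      show "{\<omega>\<in>space M. (\<Sum>i=1..n. f (G i \<omega>)) \<le> real n * ((\<integral>g. f g \<partial>rayleigh) - \<epsilon>)} \<subseteq>
          {\<omega>\<in>space M. (\<Sum>i=1..n. \<phi> (G i \<omega>)) \<le> - (real n * (\<epsilon> / 2))}"
      proof safe
        fix \<omega> assume a: "(\<Sum>i=1..n. f (G i \<omega>)) \<le> real n * ((\<integral>g. f g \<partial>rayleigh) - \<epsilon>)"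
        have "(\<Sum>i=1..n. \<psi> (G i \<omega>)) \<le> (\<Sum>i=1..n. f (G i \<omega>))"
          unfolding \<psi>_def by (intro sum_mono le)
        moreover have "real n * ((\<integral>g. f g \<partial>rayleigh) - \<epsilon>) \<le> real n * (m - \<epsilon> / 2)"
          using K by (intro mult_left_mono) (auto simp: m_def \<psi>_def)
        ultimately have "(\<Sum>i=1..n. \<psi> (G i \<omega>)) \<le> real n * (m - \<epsilon> / 2)" using a by linarith
        then show "(\<Sum>i=1..n. \<phi> (G i \<omega>)) \<le> - (real n * (\<epsilon> / 2))"
          by (simp add: \<phi>_def sum_subtractf algebra_simps)
      qed
      have "random_variable borel (\<lambda>\<omega>. \<phi> (G i \<omega>))" if "i \<in> {1..n}" for i
        using gains_rv[of i] that unfolding \<phi>_def by simp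
      then have "random_variable borel (\<lambda>\<omega>. \<Sum>i=1..n. \<phi> (G i \<omega>))"
        by (rule borel_measurable_sum)
      then show "{\<omega>\<in>space M. (\<Sum>i=1..n. \<phi> (G i \<omega>)) \<le> - (real n * (\<epsilon> / 2))} \<in> events"
        by measurable
    qed
    then show ?case using elim by linarith
  qed
qed

lemma channel_law_density:
  assumes \<sigma>: "0 < \<sigma>\<^sup>2" and n: "1 \<le> n"
  shows "channel_law M \<xi> n g t =
    density (lebesgue_block n) (\<lambda>z. ennreal (gauss_prod n (\<lambda>_. \<sigma>\<^sup>2 *\<^sub>R mat 1) (\<lambda>i. z i - g i *v t i)))"
proof -
  let ?K = "\<sigma>\<^sup>2 *\<^sub>R mat 1 :: complex^'r^'r"
  let ?f = "\<lambda>i z. ennreal (complex_gaussian_density ?K (z - g i *v t i))"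
  have K: "cov ?K" using \<sigma> by (rule cov.scalar)
  have dist: "distributed M lborel (\<xi> i) (\<lambda>z. ennreal (complex_gaussian_density ?K z))" if "1 \<le> i" for i
    using noise_gaussian[OF that] by (simp add: complex_gaussian_def)
  have rv: "random_variable borel (\<xi> i)" if "1 \<le> i" for i
    using dist[OF that] by (simp add: distributed_def)
  have law: "distr M borel (\<lambda>\<omega>. g i *v t i + \<xi> i \<omega>) = density lborel (?f i)" if i: "1 \<le> i" for i
  proof -
    have "distr M borel (\<lambda>\<omega>. g i *v t i + \<xi> i \<omega>) = distr (distr M lborel (\<xi> i)) borel ((+) (g i *v t i))"
      using rv[OF i] by (subst distr_distr) (auto simp: comp_def)
    also have "\<dots> = distr (density lborel (\<lambda>z. ?f i (g i *v t i + z))) borel ((+) (g i *v t i))"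
      using dist[OF i] by (simp add: distributed_def)
    also have "\<dots> = density (distr lborel borel ((+) (g i *v t i))) (?f i)"
      by (rule density_distr[symmetric]) auto
    finally show ?thesis by (simp add: lborel_distr_plus)
  qed
  have ind: "indep_vars (\<lambda>_. borel) (\<lambda>i \<omega>. g i *v t i + \<xi> i \<omega>) {1..n}"
    by (rule indep_vars_compose2[OF indep_vars_subset[OF noise_indep]]) auto
  have "channel_law M \<xi> n g t = Pi\<^sub>M {1..n} (\<lambda>i. distr M borel (\<lambda>\<omega>. g i *v t i + \<xi> i \<omega>))"
    unfolding channel_law_def block_def
    by (rule indep_vars_iff_distr_eq_PiM'[THEN iffD1, OF _ _ ind]) (use n rv in auto)
  also have "\<dots> = Pi\<^sub>M {1..n} (\<lambda>i. density lborel (?f i))"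
    by (intro PiM_cong refl law) auto
  also have "\<dots> = density (lebesgue_block n) (\<lambda>z. \<Prod>i\<in>{1..n}. ?f i (z i))"
  proof (rule PiM_density_lborel)
    show "(\<integral>\<^sup>+z. ?f i z \<partial>lborel) = 1" for i
      using nn_integral_lborel_translate[of "\<lambda>z. ennreal (complex_gaussian_density ?K z)" "- (g i *v t i)"]
      by (simp add: nn_integral_cgd[OF K])
  qed auto
  finally show ?thesis by (simp only: gauss_prod_ennreal[OF K])
qed

end


section \<open>The channel with receiver state information\<close>

text \<open>The index set \<open>{1..n}\<close> must not be rewritten to \<open>{Suc 0..n}\<close>: it occurs in measurability rules.\<close>

declare One_nat_def [simp del]

lemma ln_rate_psd_nonneg:
  fixes Q :: "complex^'t^'t"
  assumes "0 < v" "hermitian_psd Q" shows "0 \<le> ln_rate v Q g"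
proof -
  obtain V :: "complex^'t^'t" where "Q = V ** herm V" using hermitian_psd_factor[OF assms(2)] .
  then show ?thesis using ln_rate_nonneg[OF assms(1)] by simp
qed

lemmas ln_rate_scalar_nonneg = ln_rate_psd_nonneg[OF _ hermitian_psd_scalar]

lemma continuous_ln_rate:
  fixes Q :: "complex^'t^'t"
  assumes v: "0 < v" and Q: "hermitian_psd Q"
  shows "continuous_on UNIV (ln_rate v Q :: complex^'t^'r \<Rightarrow> real)"
proof -
  obtain V :: "complex^'t^'t" where V: "Q = V ** herm V" using hermitian_psd_factor[OF Q] .
  have eq: "ln_rate v Q = (\<lambda>g :: complex^'t^'r. ln (Re (det (v *\<^sub>R mat 1 + (g ** V) ** herm (g ** V)))) - real CARD('r) * ln v)"
    by (simp add: fun_eq_iff V ln_rate_gram[OF v])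
  have pos: "0 < Re (det (v *\<^sub>R mat 1 + (g ** V) ** herm (g ** V)))" for g :: "complex^'t^'r"
    by (intro cov_det(1) cov_add_gram cov.scalar v)
  have "continuous_on UNIV (\<lambda>g :: complex^'t^'r. Re (det (v *\<^sub>R mat 1 + (g ** V) ** herm (g ** V))))"
    unfolding det_def matrix_matrix_mult_def herm_def mat_def by (simp, intro continuous_intros)
  then show ?thesis
    unfolding eq using pos by (intro continuous_on_diff continuous_on_ln continuous_on_const) (auto simp: less_imp_neq[THEN not_sym])
qed

section \<open>Block densities and the information density\<close>

definition trans_dens :: "nat \<Rightarrow> real \<Rightarrow> (nat \<Rightarrow> complex^'t) \<Rightarrow> (nat \<Rightarrow> complex^'t^'r) \<Rightarrow> (nat \<Rightarrow> complex^'r) \<Rightarrow> real" where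
  "trans_dens n v t g z = gauss_prod n (\<lambda>_. v *\<^sub>R mat 1) (\<lambda>i. z i - g i *v t i)"

text \<open>The output density at given gains when all input symbols are independent Gaussian
  vectors with power \<open>p\<close> per antenna. It is the reference law of both the converse and
  the direct part.\<close>

definition out_dens :: "nat \<Rightarrow> real \<Rightarrow> real \<Rightarrow> (nat \<Rightarrow> complex^'t^'r) \<Rightarrow> (nat \<Rightarrow> complex^'r) \<Rightarrow> real" where
  "out_dens n v p g z = gauss_prod n (\<lambda>i. out_cov v p (g i)) z"

definition noise_sum :: "nat \<Rightarrow> real \<Rightarrow> (nat \<Rightarrow> complex^'t) \<Rightarrow> (nat \<Rightarrow> complex^'t^'r) \<Rightarrow> (nat \<Rightarrow> complex^'r) \<Rightarrow> real" where
  "noise_sum n v t g z = quad_sum n (\<lambda>_. v *\<^sub>R mat 1) (\<lambda>i. z i - g i *v t i)"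

definition out_sum :: "nat \<Rightarrow> real \<Rightarrow> real \<Rightarrow> (nat \<Rightarrow> complex^'t^'r) \<Rightarrow> (nat \<Rightarrow> complex^'r) \<Rightarrow> real" where
  "out_sum n v p g z = quad_sum n (\<lambda>i. out_cov v p (g i)) z"

lemma trans_dens_pos: "0 < v \<Longrightarrow> 0 < trans_dens n v t g z"
  unfolding trans_dens_def by (intro gauss_prod_pos cov.scalar)

lemma out_dens_pos: "0 < v \<Longrightarrow> 0 < out_dens n v p g z"
  unfolding out_dens_def by (intro gauss_prod_pos cov_out_cov)

lemma noise_sum_nonneg: "0 < v \<Longrightarrow> 0 \<le> noise_sum n v t g z"
  unfolding noise_sum_def quad_sum_def by (intro sum_nonneg quad_nonneg pos_def_scaleR_mat_1)

lemma out_sum_nonneg: "0 < v \<Longrightarrow> 0 \<le> out_sum n v p g z"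
  unfolding out_sum_def quad_sum_def by (intro sum_nonneg quad_nonneg cov_pos_def cov_out_cov)

text \<open>The information density. The powers of \<open>pi\<close> cancel and the determinants
  combine to rates. Under Gaussian input both quadratic sums have mean \<open>n\<close> times
  \<open>CARD('r)\<close>, so the sum of rates dominates.\<close>

lemma ln_density_ratio:
  fixes g :: "nat \<Rightarrow> complex^'t^'r"
  assumes v: "0 < v" and p: "0 \<le> p"
  shows "ln (trans_dens n v t g z) - ln (out_dens n v p g z) =
    (\<Sum>i=1..n. ln_rate v (p *\<^sub>R mat 1) (g i)) + out_sum n v p g z - noise_sum n v t g z"
proof -
  have "ln (Re (det (v *\<^sub>R mat 1 :: complex^'r^'r))) = real CARD('r) * ln v"
    using v by (simp add: det_scaleR_mat ln_realpow)
  then show ?thesis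
    unfolding trans_dens_def out_dens_def out_sum_def noise_sum_def ln_rate_scalar[OF v p]
    by (subst (1 2) ln_gauss_prod) (simp_all add: cov.scalar[OF v] cov_out_cov[OF v] sum.distrib sum_subtractf algebra_simps)
qed

lemma measurable_trans_dens [measurable (raw)]:
  fixes G :: "'x \<Rightarrow> nat \<Rightarrow> complex^'t^'r"
  assumes T: "T \<in> measurable N (Pi\<^sub>M {1..n} (\<lambda>_. borel))"
    and G: "G \<in> measurable N (Pi\<^sub>M {1..n} (\<lambda>_. borel))"
    and Z: "Z \<in> measurable N (Pi\<^sub>M {1..n} (\<lambda>_. borel))"
  shows "(\<lambda>x. trans_dens n v (T x) (G x) (Z x)) \<in> borel_measurable N"
    and "(\<lambda>x. noise_sum n v (T x) (G x) (Z x)) \<in> borel_measurable N"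
proof -
  have [measurable]: "(\<lambda>x. T x i) \<in> borel_measurable N" "(\<lambda>x. G x i) \<in> borel_measurable N" "(\<lambda>x. Z x i) \<in> borel_measurable N"
    if "i \<in> {1..n}" for i
    using measurable_compose[OF T measurable_component_singleton[OF that]]
      measurable_compose[OF G measurable_component_singleton[OF that]]
      measurable_compose[OF Z measurable_component_singleton[OF that]] by auto
  show "(\<lambda>x. trans_dens n v (T x) (G x) (Z x)) \<in> borel_measurable N"
    unfolding trans_dens_def gauss_prod_def by (intro borel_measurable_prod) measurable
  show "(\<lambda>x. noise_sum n v (T x) (G x) (Z x)) \<in> borel_measurable N"
    unfolding noise_sum_def quad_sum_def by (intro borel_measurable_sum) measurable
qed

lemma measurable_out_dens [measurable (raw)]:
  fixes G :: "'x \<Rightarrow> nat \<Rightarrow> complex^'t^'r"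
  assumes v: "0 < v" and G: "G \<in> measurable N (Pi\<^sub>M {1..n} (\<lambda>_. borel))"
    and Z: "Z \<in> measurable N (Pi\<^sub>M {1..n} (\<lambda>_. borel))"
  shows "(\<lambda>x. out_dens n v p (G x) (Z x)) \<in> borel_measurable N"
    and "(\<lambda>x. out_sum n v p (G x) (Z x)) \<in> borel_measurable N"
    and "(\<lambda>x. \<Sum>i=1..n. ln_rate v Q (G x i)) \<in> borel_measurable N"
proof -
  have [measurable]: "(\<lambda>x. G x i) \<in> borel_measurable N" "(\<lambda>x. Z x i) \<in> borel_measurable N"
    if "i \<in> {1..n}" for i
    using measurable_compose[OF G measurable_component_singleton[OF that]]
      measurable_compose[OF Z measurable_component_singleton[OF that]] by auto
  have q: "(\<lambda>x. quad (out_cov v p (G x i)) (Z x i)) \<in> borel_measurable N" if "i \<in> {1..n}" for i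
    using that by (intro measurable_quad_family cov_out_cov v) measurable
  show "(\<lambda>x. out_dens n v p (G x) (Z x)) \<in> borel_measurable N"
    unfolding out_dens_def gauss_prod_def complex_gaussian_density_quad
    by (intro borel_measurable_prod) (use q in measurable)
  show "(\<lambda>x. out_sum n v p (G x) (Z x)) \<in> borel_measurable N"
    unfolding out_sum_def quad_sum_def by (intro borel_measurable_sum q)
  show "(\<lambda>x. \<Sum>i=1..n. ln_rate v Q (G x i)) \<in> borel_measurable N"
    by (intro borel_measurable_sum) measurable
qed

lemma nn_integral_trans_dens:
  "0 < v \<Longrightarrow> (\<integral>\<^sup>+z. ennreal (trans_dens n v t g z) \<partial>lebesgue_block n) = 1"
  unfolding trans_dens_def by (rule nn_integral_gauss_prod[OF cov.scalar])

lemma nn_integral_out_dens: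
  "0 < v \<Longrightarrow> (\<integral>\<^sup>+z. ennreal (out_dens n v p g z) \<partial>lebesgue_block n) = 1"
  unfolding out_dens_def
  using nn_integral_gauss_prod[of "\<lambda>i. out_cov v p (g i)" n "\<lambda>_. 0"] by (simp add: cov_out_cov)

lemma nn_integral_trans_dens_coordinate:
  fixes g :: "nat \<Rightarrow> complex^'t^'r"
  assumes v: "0 < v" and k: "k \<in> {1..n}" and [measurable]: "a \<in> borel_measurable borel"
  shows "(\<integral>\<^sup>+z. ennreal (trans_dens n v t g z) * a (z k) \<partial>lebesgue_block n) =
    (\<integral>\<^sup>+z. ennreal (complex_gaussian_density (v *\<^sub>R mat 1) (z - g k *v t k)) * a z \<partial>lborel)"
proof -
  have c: "cov (v *\<^sub>R mat 1 :: complex^'r^'r)" using v by (rule cov.scalar)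
  have "(\<integral>\<^sup>+z. ennreal (complex_gaussian_density (v *\<^sub>R mat 1) (z - g i *v t i)) \<partial>lborel) = 1" for i
    using nn_integral_lborel_translate[of "\<lambda>z. ennreal (complex_gaussian_density (v *\<^sub>R mat 1) z)" "- (g i *v t i)"]
    by (simp add: nn_integral_cgd[OF c])
  then show ?thesis
    unfolding trans_dens_def gauss_prod_ennreal[OF c]
    by (intro nn_integral_prod_marginal[where f="\<lambda>i z. ennreal (complex_gaussian_density (v *\<^sub>R mat 1) (z - g i *v t i))"] k) auto
qed

context gauss_markov_channel
begin

definition gain_law :: "nat \<Rightarrow> (nat \<Rightarrow> complex^'t^'r) measure" where
  "gain_law n = distr M (blocks n) (block n G)"

lemma sets_gain_law [measurable_cong, simp]: "sets (gain_law n) = sets (blocks n)"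
  and space_gain_law [simp]: "space (gain_law n) = space (blocks n)"
  by (simp_all add: gain_law_def)

lemma measurable_block_gains [measurable]: "block n G \<in> measurable M (blocks n)"
  unfolding block_def by (intro measurable_restrict) (auto intro: gains_rv)

lemma prob_space_gain_law: "prob_space (gain_law n)"
  unfolding gain_law_def by (rule prob_space_distr) measurable

lemma block_gains_component: "k \<in> {1..n} \<Longrightarrow> block n G \<omega> k = G k \<omega>"
  by (simp add: block_def)

lemma nn_integral_gain_law_component:
  assumes "0 \<le> \<alpha>" "\<alpha> < 1" and k: "k \<in> {1..n}" and [measurable]: "f \<in> borel_measurable borel"
  shows "(\<integral>\<^sup>+g. f (g k) \<partial>gain_law n) = (\<integral>\<^sup>+g. f g \<partial>rayleigh)"
proof -
  have "(\<lambda>g. g k) \<in> borel_measurable (blocks n :: (nat \<Rightarrow> complex^'t^'r) measure)"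
    using k by (rule measurable_component_singleton)
  then have "(\<integral>\<^sup>+g. f (g k) \<partial>gain_law n) = (\<integral>\<^sup>+\<omega>. f (G k \<omega>) \<partial>M)"
    unfolding gain_law_def using k by (subst nn_integral_distr) (auto simp: block_gains_component)
  also have "\<dots> = (\<integral>\<^sup>+g. f g \<partial>distr M borel (G k))"
    using k gains_rv[of k] by (subst nn_integral_distr) auto
  finally show ?thesis using gains_law[OF assms(1,2)] k by simp
qed

text \<open>Reference measure for the pair of gains and output. The gains keep their own law, so
  that \<open>trans_dens\<close> and \<open>out_dens\<close> are joint densities of the pair under
  the two output laws.\<close>

definition base :: "nat \<Rightarrow> ((nat \<Rightarrow> complex^'t^'r) \<times> (nat \<Rightarrow> complex^'r)) measure" where
  "base n = gain_law n \<Otimes>\<^sub>M lebesgue_block n"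

lemma sets_base [measurable_cong]: "sets (base n) = sets (blocks n \<Otimes>\<^sub>M blocks n)"
  unfolding base_def by (intro sets_pair_measure_cong) (simp_all add: sets_lebesgue_block)

lemma space_base: "space (base n) = space (blocks n) \<times> space (blocks n)"
  by (simp add: base_def space_pair_measure space_lebesgue_block)

lemma sigma_finite_base: "sigma_finite_measure (base n)"
proof -
  interpret A: prob_space "gain_law n" by (rule prob_space_gain_law)
  interpret B: sigma_finite_measure "lebesgue_block n :: (nat \<Rightarrow> complex^'r) measure" by (rule sigma_finite_lebesgue_block)
  interpret pair_sigma_finite "gain_law n" "lebesgue_block n :: (nat \<Rightarrow> complex^'r) measure" ..
  show ?thesis unfolding base_def by (rule sigma_finite_pair_measure) standard
qed

lemma nn_integral_base:
  assumes "f \<in> borel_measurable (base n)"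
  shows "(\<integral>\<^sup>+y. f y \<partial>base n) = (\<integral>\<^sup>+g. (\<integral>\<^sup>+z. f (g, z) \<partial>lebesgue_block n) \<partial>gain_law n)"
proof -
  interpret B: sigma_finite_measure "lebesgue_block n :: (nat \<Rightarrow> complex^'r) measure" by (rule sigma_finite_lebesgue_block)
  show ?thesis using assms unfolding base_def by (rule B.nn_integral_fst[symmetric])
qed

lemma measurable_base [measurable]:
  "fst \<in> measurable (base n) (blocks n)" "snd \<in> measurable (base n) (blocks n)"
  unfolding measurable_cong_sets[OF sets_base refl] by measurable

lemma nn_integral_base_trans_dens:
  "0 < v \<Longrightarrow> t \<in> space (blocks n) \<Longrightarrow> (\<integral>\<^sup>+y. ennreal (trans_dens n v t (fst y) (snd y)) \<partial>base n) = 1"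
  by (subst nn_integral_base) (auto simp: nn_integral_trans_dens prob_space.emeasure_space_1[OF prob_space_gain_law] simp del: space_gain_law)

lemma nn_integral_base_out_dens:
  "0 < v \<Longrightarrow> (\<integral>\<^sup>+y. ennreal (out_dens n v p (fst y) (snd y)) \<partial>base n) = 1"
  by (subst nn_integral_base) (auto simp: nn_integral_out_dens prob_space.emeasure_space_1[OF prob_space_gain_law] simp del: space_gain_law)

text \<open>Turns the error of a codeword, an expectation over gains of a conditional probability,
  into one integral over pairs. The bound \<open>c \<le> 1\<close> ensures that
  \<open>enn2real c\<close> loses nothing.\<close>

lemma error_probability:
  fixes D :: "(nat \<Rightarrow> complex^'t^'r) \<Rightarrow> (nat \<Rightarrow> complex^'r) set"
  assumes \<sigma>: "0 < \<sigma>\<^sup>2" and n: "1 \<le> n" and t: "t \<in> space (blocks n)"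
    and D: "(SIGMA g : space (blocks n). D g) \<in> sets (blocks n \<Otimes>\<^sub>M blocks n)"
    and D_sub: "\<And>g. g \<in> space (blocks n) \<Longrightarrow> D g \<subseteq> space (blocks n)"
  defines "c \<equiv> \<integral>\<^sup>+y. ennreal (trans_dens n (\<sigma>\<^sup>2) t (fst y) (snd y)) * indicator (SIGMA g : space (blocks n). D g) y \<partial>base n"
  shows "(\<integral>\<omega>. measure (channel_law M \<xi> n (block n G \<omega>) t) (space (blocks n) - D (block n G \<omega>)) \<partial>M) = 1 - enn2real c"
    and "c \<le> 1"
proof -
  let ?S = "SIGMA g : space (blocks n). D g"
  let ?w = "\<lambda>g z. ennreal (trans_dens n (\<sigma>\<^sup>2) t g z)"
  let ?c = "\<lambda>g. \<integral>\<^sup>+z. ?w g z * indicator ?S (g, z) \<partial>lebesgue_block n"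
  interpret L: sigma_finite_measure "lebesgue_block n :: (nat \<Rightarrow> complex^'r) measure" by (rule sigma_finite_lebesgue_block)
  have Sb [measurable]: "?S \<in> sets (base n)" using D by (simp add: sets_base)
  have wm: "(\<lambda>y. ?w (fst y) (snd y) * indicator ?S y) \<in> borel_measurable (base n)"
    using t by measurable
  have c: "c = (\<integral>\<^sup>+g. ?c g \<partial>gain_law n)"
    unfolding c_def by (subst nn_integral_base[OF wm]) simp
  have cm: "?c \<in> borel_measurable (gain_law n)"
    using wm unfolding base_def by (intro L.borel_measurable_nn_integral) (simp add: case_prod_unfold)
  have c1: "?c g \<le> 1" for g
  proof -
    have "?c g \<le> (\<integral>\<^sup>+z. ?w g z \<partial>lebesgue_block n)"
      by (intro nn_integral_mono) (auto simp: indicator_def)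
    then show ?thesis by (simp add: nn_integral_trans_dens[OF \<sigma>])
  qed
  have "c \<le> (\<integral>\<^sup>+g. 1 \<partial>gain_law n)" unfolding c using c1 by (intro nn_integral_mono)
  then show "c \<le> 1" using prob_space.emeasure_space_1[OF prob_space_gain_law, of n] by simp
  have pt: "measure (channel_law M \<xi> n g t) (space (blocks n) - D g) = 1 - enn2real (?c g)" if g: "g \<in> space (blocks n)" for g
  proof -
    have law: "channel_law M \<xi> n g t = density (lebesgue_block n) (?w g)"
      unfolding trans_dens_def by (rule channel_law_density[OF \<sigma> n])
    have wg: "?w g \<in> borel_measurable (lebesgue_block n)"
      using t g by measurable
    interpret P: prob_space "channel_law M \<xi> n g t"
      unfolding law by (rule prob_spaceI) (use wg in \<open>simp add: emeasure_density nn_integral_trans_dens[OF \<sigma>] cong: nn_integral_cong\<close>)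
    have Dg: "D g \<in> sets (lebesgue_block n)"
    proof -
      have "Pair g -` ?S \<in> sets (blocks n)" by (rule sets_Pair1[OF D])
      moreover have "Pair g -` ?S = D g" using g by auto
      ultimately show ?thesis by (simp add: sets_lebesgue_block)
    qed
    have "emeasure (channel_law M \<xi> n g t) (D g) = ?c g"
      unfolding law using wg Dg g by (subst emeasure_density) (auto intro!: nn_integral_cong simp: indicator_def)
    moreover have "space (channel_law M \<xi> n g t) = space (blocks n)" by (simp add: law space_lebesgue_block)
    moreover have "D g \<in> sets (channel_law M \<xi> n g t)" using Dg by (simp add: law)
    ultimately show ?thesis using P.prob_compl[of "D g"] by (simp add: measure_def)
  qed
  have cm': "(\<lambda>\<omega>. ?c (block n G \<omega>)) \<in> borel_measurable M"
    using cm by (intro measurable_compose[OF measurable_block_gains]) (simp add: measurable_cong_sets[OF sets_gain_law refl])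
  have bg: "block n G \<omega> \<in> space (blocks n)" if "\<omega> \<in> space M" for \<omega>
    using measurable_space[OF measurable_block_gains that] .
  have ce: "enn2real (?c g) \<le> 1" for g using c1[of g] by (simp add: enn2real_leI)
  have int: "integrable M (\<lambda>\<omega>. enn2real (?c (block n G \<omega>)))"
    using cm' ce by (intro integrable_const_bound[of _ 1]) auto
  have "(\<integral>\<omega>. measure (channel_law M \<xi> n (block n G \<omega>) t) (space (blocks n) - D (block n G \<omega>)) \<partial>M) =
      (\<integral>\<omega>. 1 - enn2real (?c (block n G \<omega>)) \<partial>M)"
    by (intro Bochner_Integration.integral_cong refl pt bg)
  also have "\<dots> = 1 - (\<integral>\<omega>. enn2real (?c (block n G \<omega>)) \<partial>M)"
    using int by (simp add: prob_space)
  also have "(\<integral>\<omega>. enn2real (?c (block n G \<omega>)) \<partial>M) = enn2real (\<integral>\<^sup>+\<omega>. ennreal (enn2real (?c (block n G \<omega>))) \<partial>M)"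
    using cm' by (intro integral_eq_nn_integral) auto
  also have "(\<integral>\<^sup>+\<omega>. ennreal (enn2real (?c (block n G \<omega>))) \<partial>M) = (\<integral>\<^sup>+\<omega>. ?c (block n G \<omega>) \<partial>M)"
    by (intro nn_integral_cong ennreal_enn2real) (rule le_less_trans[OF c1], simp)
  also have "\<dots> = c"
    unfolding c gain_law_def using cm by (intro nn_integral_distr[symmetric]) (auto simp: measurable_cong_sets[OF sets_gain_law refl] gain_law_def)
  finally show "(\<integral>\<omega>. measure (channel_law M \<xi> n (block n G \<omega>) t) (space (blocks n) - D (block n G \<omega>)) \<partial>M) = 1 - enn2real c" .
qed

end


section \<open>Converse\<close>

context gauss_markov_channel
begin

section \<open>Mean information density of a codeword\<close>

lemma nn_integral_base_coordinate:
  assumes \<alpha>: "0 \<le> \<alpha>" "\<alpha> < 1" and v: "0 < v" and t: "t \<in> space (blocks n)" and k: "k \<in> {1..n}"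
    and a [measurable]: "(\<lambda>(g, z). a g z) \<in> borel_measurable (borel \<Otimes>\<^sub>M borel)"
  shows "(\<integral>\<^sup>+y. ennreal (trans_dens n v t (fst y) (snd y)) * a (fst y k) (snd y k) \<partial>base n) =
    (\<integral>\<^sup>+g. (\<integral>\<^sup>+z. ennreal (complex_gaussian_density (v *\<^sub>R mat 1) (z - g *v t k)) * a g z \<partial>lborel) \<partial>rayleigh)"
proof -
  have c [measurable]: "(\<lambda>y. fst y k) \<in> borel_measurable (base n)" "(\<lambda>y. snd y k) \<in> borel_measurable (base n)"
    using measurable_compose[OF measurable_base(1) measurable_component_singleton[OF k]]
      measurable_compose[OF measurable_base(2) measurable_component_singleton[OF k]] by auto
  have ac: "(\<lambda>y. a (fst y k) (snd y k)) \<in> borel_measurable (base n)"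
    using measurable_compose[OF measurable_Pair[OF c] a] by simp
  have w: "(\<lambda>y. trans_dens n v t (fst y) (snd y)) \<in> borel_measurable (base n)"
    using t by measurable
  note wa = borel_measurable_times_ennreal[OF measurable_compose[OF w measurable_ennreal] ac]
  have "(\<integral>\<^sup>+y. ennreal (trans_dens n v t (fst y) (snd y)) * a (fst y k) (snd y k) \<partial>base n) =
      (\<integral>\<^sup>+g. (\<integral>\<^sup>+z. ennreal (trans_dens n v t g z) * a (g k) (z k) \<partial>lebesgue_block n) \<partial>gain_law n)"
    by (subst nn_integral_base[OF wa]) simp
  also have "\<dots> = (\<integral>\<^sup>+g. (\<integral>\<^sup>+z. ennreal (complex_gaussian_density (v *\<^sub>R mat 1) (z - g k *v t k)) * a (g k) z \<partial>lborel) \<partial>gain_law n)"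
    by (intro nn_integral_cong nn_integral_trans_dens_coordinate[OF v k]) measurable
  also have "\<dots> = (\<integral>\<^sup>+g. (\<integral>\<^sup>+z. ennreal (complex_gaussian_density (v *\<^sub>R mat 1) (z - g *v t k)) * a g z \<partial>lborel) \<partial>rayleigh)"
    by (rule nn_integral_gain_law_component[OF \<alpha> k]) measurable
  finally show ?thesis .
qed

lemma nn_integral_base_noise_sum:
  assumes \<alpha>: "0 \<le> \<alpha>" "\<alpha> < 1" and v: "0 < v" and t: "t \<in> space (blocks n)"
  shows "(\<integral>\<^sup>+y. ennreal (trans_dens n v t (fst y) (snd y)) * ennreal (noise_sum n v t (fst y) (snd y)) \<partial>base n) =
    ennreal (real n * real CARD('r))"
proof -
  let ?K = "v *\<^sub>R mat 1 :: complex^'r^'r"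
  have nn: "0 \<le> quad ?K z" for z by (rule quad_nonneg[OF pos_def_scaleR_mat_1[OF v]])
  have qf: "hermitian_form (quad ?K)" using hermitian_form_quad[of ?K "mat 1"] by simp
  have one: "(\<integral>\<^sup>+z. ennreal (complex_gaussian_density ?K (z - c)) * ennreal (quad ?K (z - c)) \<partial>lborel) = ennreal (real CARD('r))" for c
  proof -
    have "(\<integral>\<^sup>+z. ennreal (complex_gaussian_density ?K (z - c)) * ennreal (quad ?K (z - c)) \<partial>lborel) =
        (\<integral>\<^sup>+z. ennreal (complex_gaussian_density ?K z) * ennreal (quad ?K z) \<partial>lborel)"
      using nn_integral_lborel_translate[of "\<lambda>z. ennreal (complex_gaussian_density ?K z) * ennreal (quad ?K z)" "- c"] by simp
    also have "\<dots> = ennreal (v * (\<Sum>k\<in>UNIV. quad ?K (axis k 1)))"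
      by (rule nn_integral_cgd_form[OF v qf nn]) measurable
    finally show ?thesis using v by (simp add: quad_scalar norm_axis_one)
  qed
  interpret R: prob_space "rayleigh :: (complex^'t^'r) measure" by (rule prob_space_rayleigh)
  let ?q = "\<lambda>i y. ennreal (quad ?K (snd y i - fst y i *v t i))"
  let ?w = "\<lambda>y. ennreal (trans_dens n v t (fst y) (snd y))"
  have c [measurable]: "(\<lambda>y. fst y k) \<in> borel_measurable (base n)" "(\<lambda>y. snd y k) \<in> borel_measurable (base n)" if "k \<in> {1..n}" for k
    using measurable_compose[OF measurable_base(1) measurable_component_singleton[OF that]]
      measurable_compose[OF measurable_base(2) measurable_component_singleton[OF that]] by auto
  have "(\<integral>\<^sup>+y. ?w y * ennreal (noise_sum n v t (fst y) (snd y)) \<partial>base n) = (\<integral>\<^sup>+y. (\<Sum>i=1..n. ?w y * ?q i y) \<partial>base n)"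
    unfolding noise_sum_def quad_sum_def by (intro nn_integral_cong) (simp add: sum_distrib_left[symmetric] nn)
  also have "\<dots> = (\<Sum>i=1..n. \<integral>\<^sup>+y. ?w y * ?q i y \<partial>base n)"
    using t by (intro nn_integral_sum) measurable
  also have "\<dots> = (\<Sum>i=1..n. ennreal (real CARD('r)))"
  proof (intro sum.cong refl)
    fix i assume i: "i \<in> {1..n}"
    have "(\<integral>\<^sup>+y. ?w y * ?q i y \<partial>base n) = (\<integral>\<^sup>+g. ennreal (real CARD('r)) \<partial>(rayleigh :: (complex^'t^'r) measure))"
      by (subst nn_integral_base_coordinate[OF \<alpha> v t i, where a="\<lambda>g z. ennreal (quad ?K (z - g *v t i))"]) (measurable, simp only: one)
    then show "(\<integral>\<^sup>+y. ?w y * ?q i y \<partial>base n) = ennreal (real CARD('r))"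
      using R.emeasure_space_1 by simp
  qed
  finally show ?thesis by (simp add: ennreal_of_nat_eq_real_of_nat ennreal_mult)
qed

text \<open>At a fixed gain the mean of one summand is the signal form of \<open>t i\<close> plus
  the noise share. Averaging over the gain turns both into multiples of \<open>\<kappa>\<close>,
  leaving a term that depends on \<open>t i\<close> only through its power.\<close>

lemma nn_integral_base_out_sum:
  assumes \<alpha>: "0 \<le> \<alpha>" "\<alpha> < 1" and v: "0 < v" and p: "0 < p" and t: "t \<in> space (blocks n)"
    and \<kappa>: "0 \<le> \<kappa>" "\<And>t. (\<integral>g. signal_quad v p t (g :: complex^'t^'r) \<partial>rayleigh) = \<kappa> * (norm (t :: complex^'t))\<^sup>2"
  shows "(\<integral>\<^sup>+y. ennreal (trans_dens n v t (fst y) (snd y)) * ennreal (out_sum n v p (fst y) (snd y)) \<partial>base n) =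
    ennreal (\<Sum>i=1..n. \<kappa> * (norm (t i))\<^sup>2 + real CARD('r) - \<kappa> * p * real CARD('t))"
    and "0 \<le> \<kappa> * (norm (t i))\<^sup>2 + real CARD('r) - \<kappa> * p * real CARD('t)"
proof -
  let ?m = "\<lambda>i. \<kappa> * (norm (t i))\<^sup>2 + real CARD('r) - \<kappa> * p * real CARD('t)"
  let ?h = "\<lambda>i g. signal_quad v p (t i) g + (real CARD('r) - p * (\<Sum>k\<in>UNIV. signal_quad v p (axis k 1) (g :: complex^'t^'r)))"
  have h: "?h i g = quad (out_cov v p g) (g *v t i) + v * (\<Sum>i\<in>UNIV. quad (out_cov v p g) (axis i 1))" for i g
    using noise_quad[OF v less_imp_le[OF p], of g] by (simp add: signal_quad_def)
  have h0: "0 \<le> ?h i g" for i g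
    unfolding h using v by (intro add_nonneg_nonneg mult_nonneg_nonneg sum_nonneg quad_nonneg cov_pos_def cov_out_cov) auto
  interpret R: prob_space "rayleigh :: (complex^'t^'r) measure" by (rule prob_space_rayleigh)
  note int = integrable_signal_quad[OF v p]
  have ih: "integrable rayleigh (?h i)" for i
    by (intro Bochner_Integration.integrable_add Bochner_Integration.integrable_diff integrable_mult_right
        Bochner_Integration.integrable_sum int) simp
  have vh: "(\<integral>g. ?h i g \<partial>rayleigh) = ?m i" for i
    using R.prob_space by (simp add: int Bochner_Integration.integral_sum \<kappa>(2) norm_axis_one mult_ac)
  have m0: "0 \<le> ?m i" for i
    unfolding vh[symmetric] by (intro integral_nonneg_AE AE_I2 h0)
  then show "0 \<le> ?m i" .
  let ?q = "\<lambda>i y. ennreal (quad (out_cov v p (fst y i)) (snd y i))"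
  let ?w = "\<lambda>y. ennreal (trans_dens n v t (fst y) (snd y))"
  have c [measurable]: "(\<lambda>y. fst y k) \<in> borel_measurable (base n)" "(\<lambda>y. snd y k) \<in> borel_measurable (base n)" if "k \<in> {1..n}" for k
    using measurable_compose[OF measurable_base(1) measurable_component_singleton[OF that]]
      measurable_compose[OF measurable_base(2) measurable_component_singleton[OF that]] by auto
  have nn: "0 \<le> quad (out_cov v p g) z" for g :: "complex^'t^'r" and z
    by (intro quad_nonneg cov_pos_def cov_out_cov v)
  have qm: "(\<lambda>y. quad (out_cov v p (fst y i)) (snd y i)) \<in> borel_measurable (base n)" if "i \<in> {1..n}" for i
    using that by (intro measurable_quad_family cov_out_cov v) measurable
  have wm: "(\<lambda>y. trans_dens n v t (fst y) (snd y)) \<in> borel_measurable (base n)"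
    using t by measurable
  have qm2: "(\<lambda>y. quad (out_cov v p (fst y :: complex^'t^'r)) (snd y)) \<in> borel_measurable (borel \<Otimes>\<^sub>M borel)"
    by (intro measurable_quad_family cov_out_cov v) measurable
  have "(\<integral>\<^sup>+y. ?w y * ennreal (out_sum n v p (fst y) (snd y)) \<partial>base n) = (\<integral>\<^sup>+y. (\<Sum>i=1..n. ?w y * ?q i y) \<partial>base n)"
    unfolding out_sum_def quad_sum_def by (intro nn_integral_cong) (simp add: sum_distrib_left[symmetric] nn)
  also have "\<dots> = (\<Sum>i=1..n. \<integral>\<^sup>+y. ?w y * ?q i y \<partial>base n)"
    by (intro nn_integral_sum borel_measurable_times_ennreal measurable_compose[OF wm measurable_ennreal]
        measurable_compose[OF qm measurable_ennreal])
  also have "\<dots> = (\<Sum>i=1..n. ennreal (?m i))"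
  proof (intro sum.cong refl)
    fix i assume i: "i \<in> {1..n}"
    have "(\<integral>\<^sup>+y. ?w y * ?q i y \<partial>base n) = (\<integral>\<^sup>+g. (\<integral>\<^sup>+z. ennreal (complex_gaussian_density (v *\<^sub>R mat 1) (z - g *v t i)) *
        ennreal (quad (out_cov v p (g :: complex^'t^'r)) z) \<partial>lborel) \<partial>rayleigh)"
      using qm2 by (intro nn_integral_base_coordinate[OF \<alpha> v t i, where a="\<lambda>(g :: complex^'t^'r) z. ennreal (quad (out_cov v p g) z)"]) (simp add: case_prod_unfold)
    also have "\<dots> = (\<integral>\<^sup>+g. ennreal (?h i g) \<partial>rayleigh)"
      unfolding h using v by (intro nn_integral_cong nn_integral_cgd_shift_quad cov_pos_def cov_out_cov)
    also have "\<dots> = ennreal (?m i)"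
      unfolding vh[symmetric] using ih h0 by (intro nn_integral_eq_integral) auto
    finally show "(\<integral>\<^sup>+y. ?w y * ?q i y \<partial>base n) = ennreal (?m i)" .
  qed
  finally show "(\<integral>\<^sup>+y. ?w y * ennreal (out_sum n v p (fst y) (snd y)) \<partial>base n) = ennreal (\<Sum>i=1..n. ?m i)"
    using m0 by (simp add: sum_ennreal)
qed

lemma nn_integral_base_rate_sum:
  assumes \<alpha>: "0 \<le> \<alpha>" "\<alpha> < 1" and v: "0 < v" and t: "t \<in> space (blocks n)" and Q: "hermitian_psd Q"
  shows "(\<integral>\<^sup>+y. ennreal (trans_dens n v t (fst y) (snd y)) * ennreal (\<Sum>i=1..n. ln_rate v Q (fst y i)) \<partial>base n) =
    ennreal (real n * (\<integral>g. ln_rate v Q (g :: complex^'t^'r) \<partial>rayleigh))"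
proof -
  let ?C = "\<integral>g. ln_rate v Q (g :: complex^'t^'r) \<partial>rayleigh"
  let ?w = "\<lambda>y. ennreal (trans_dens n v t (fst y) (snd y))"
  have c [measurable]: "(\<lambda>y. fst y k) \<in> borel_measurable (base n)" if "k \<in> {1..n}" for k
    using measurable_compose[OF measurable_base(1) measurable_component_singleton[OF that]] by auto
  note nn = ln_rate_psd_nonneg[OF v Q]
  have C0: "0 \<le> ?C" using nn by (intro integral_nonneg_AE AE_I2)
  have "(\<integral>\<^sup>+y. ?w y * ennreal (\<Sum>i=1..n. ln_rate v Q (fst y i)) \<partial>base n) = (\<integral>\<^sup>+y. (\<Sum>i=1..n. ?w y * ennreal (ln_rate v Q (fst y i))) \<partial>base n)"
    by (intro nn_integral_cong) (simp add: sum_distrib_left[symmetric] nn)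
  also have "\<dots> = (\<Sum>i=1..n. \<integral>\<^sup>+y. ?w y * ennreal (ln_rate v Q (fst y i)) \<partial>base n)"
    using t by (intro nn_integral_sum) measurable
  also have "\<dots> = (\<Sum>i=1..n. ennreal ?C)"
  proof (intro sum.cong refl)
    fix i assume i: "i \<in> {1..n}"
    have cgd1: "(\<integral>\<^sup>+z. ennreal (complex_gaussian_density (v *\<^sub>R mat 1) (z - c)) \<partial>lborel) = 1" for c :: "complex^'r"
      using nn_integral_lborel_translate[of "\<lambda>z. ennreal (complex_gaussian_density (v *\<^sub>R mat 1) z)" "- c"]
      by (simp add: nn_integral_cgd[OF cov.scalar[OF v]])
    have "(\<integral>\<^sup>+y. ?w y * ennreal (ln_rate v Q (fst y i)) \<partial>base n) = (\<integral>\<^sup>+g. ennreal (ln_rate v Q g) \<partial>(rayleigh :: (complex^'t^'r) measure))"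
      by (subst nn_integral_base_coordinate[OF \<alpha> v t i, where a="\<lambda>g z. ennreal (ln_rate v Q g)"])
         (measurable, simp add: nn_integral_multc cgd1)
    also have "\<dots> = ennreal ?C"
      using integrable_ln_rate[OF v Q] nn by (intro nn_integral_eq_integral) auto
    finally show "(\<integral>\<^sup>+y. ?w y * ennreal (ln_rate v Q (fst y i)) \<partial>base n) = ennreal ?C" .
  qed
  finally show ?thesis using C0 by (simp add: ennreal_of_nat_eq_real_of_nat ennreal_mult)
qed

text \<open>Instead of Fano's inequality, \<open>ln x \<le> x - 1\<close> is applied to the likelihood ratio of the true
  output law and the output law of the optimal Gaussian input, on and off the decoding region.\<close>

lemma converse_codeword:
  fixes L \<theta> :: real
  assumes \<alpha>: "0 \<le> \<alpha>" "\<alpha> < 1" and v: "0 < v" and p: "0 < p" and t: "t \<in> space (blocks n)"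
    and \<kappa>: "0 \<le> \<kappa>" "\<And>t. (\<integral>g. signal_quad v p t (g :: complex^'t^'r) \<partial>rayleigh) = \<kappa> * (norm (t :: complex^'t))\<^sup>2"
    and power: "(\<Sum>i=1..n. (norm (t i))\<^sup>2) \<le> real n * (p * real CARD('t))"
    and S [measurable]: "S \<in> sets (base n)" and L: "1 \<le> L"
    and good: "ennreal (1 - \<theta>) \<le> (\<integral>\<^sup>+y. ennreal (trans_dens n v t (fst y) (snd y)) * indicator S y \<partial>base n)" and \<theta>: "\<theta> \<le> 1"
  shows "ennreal ((1 - \<theta>) * ln L) \<le> ennreal (real n * (\<integral>g. ln_rate v (p *\<^sub>R mat 1) (g :: complex^'t^'r) \<partial>rayleigh)) +
    ennreal L * (\<integral>\<^sup>+y. ennreal (out_dens n v p (fst y) (snd y)) * indicator S y \<partial>base n)"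
proof -
  let ?C = "\<integral>g. ln_rate v (p *\<^sub>R mat 1) (g :: complex^'t^'r) \<partial>rayleigh"
  let ?w = "\<lambda>y. trans_dens n v t (fst y) (snd y)" and ?q = "\<lambda>y. out_dens n v p (fst y) (snd y)"
  let ?F = "\<lambda>y. \<Sum>i=1..n. ln_rate v (p *\<^sub>R mat 1) (fst y i :: complex^'t^'r)"
  let ?O = "\<lambda>y. out_sum n v p (fst y) (snd y)" and ?N = "\<lambda>y. noise_sum n v t (fst y) (snd y)"
  let ?c = "\<integral>\<^sup>+y. ennreal (?w y) * indicator S y \<partial>base n" and ?Q = "\<integral>\<^sup>+y. ennreal (?q y) * indicator S y \<partial>base n"
  let ?m = "\<Sum>i=1..n. \<kappa> * (norm (t i))\<^sup>2 + real CARD('r) - \<kappa> * p * real CARD('t)"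
  have psd: "hermitian_psd (p *\<^sub>R mat 1 :: complex^'t^'t)" using p by (intro hermitian_psd_scalar) simp
  have F0: "0 \<le> ?F y" for y by (intro sum_nonneg ln_rate_psd_nonneg v psd)
  have C0: "0 \<le> ?C" by (intro integral_nonneg_AE AE_I2 ln_rate_psd_nonneg v psd)
  note pos = trans_dens_pos[OF v, of n t] out_dens_pos[OF v, of n p] noise_sum_nonneg[OF v, of n t] out_sum_nonneg[OF v, of n p]
  have lnL: "0 \<le> ln L" using L by simp
  have m0: "0 \<le> ?m" using nn_integral_base_out_sum(2)[OF \<alpha> v p t \<kappa>] by (intro sum_nonneg)
  have tm: "(\<lambda>y. t) \<in> measurable (base n) (blocks n)" using t by simp
  note wm [measurable] = measurable_trans_dens[OF tm measurable_base, of v]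
  note qm [measurable] = measurable_out_dens(1,2)[OF v measurable_base, where p=p]
    measurable_out_dens(3)[OF v measurable_base, where Q="p *\<^sub>R mat 1"]
  have "(\<integral>\<^sup>+y. ennreal (ln L) * (ennreal (?w y) * indicator S y) + ennreal (?w y) + ennreal (?w y) * ennreal (?N y) \<partial>base n) \<le>
      (\<integral>\<^sup>+y. ennreal (?w y) * ennreal (?F y) + ennreal (?w y) * ennreal (?O y) + ennreal L * (ennreal (?q y) * indicator S y) + ennreal (?q y) \<partial>base n)"
  proof (intro nn_integral_mono)
    fix y
    \<comment> \<open>The reference density is weighted by \<open>L\<close> on the decoding region
      and by 1 off it. The logarithm then gains \<open>ln L\<close> on the region, at the price of
      \<open>L\<close> times the reference mass of the region.\<close>
    define x where "x = (if y \<in> S then L else 1)"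
    have x: "1 \<le> x" using L by (simp add: x_def)
    have eq: "ln (?w y) - ln (?q y) = ?F y + ?O y - ?N y"
      using ln_density_ratio[OF v less_imp_le[OF p], of n t "fst y" "snd y"] .
    have "ln (x * ?q y / ?w y) \<le> x * ?q y / ?w y - 1"
      using pos x by (intro ln_le_minus_one) (auto intro!: divide_pos_pos mult_pos_pos)
    moreover have "ln (x * ?q y / ?w y) = ln x + ln (?q y) - ln (?w y)"
      using pos(1,2)[of "fst y" "snd y"] x by (simp add: ln_div ln_mult)
    ultimately have "ln x + ?N y - ?F y - ?O y \<le> x * ?q y / ?w y - 1" using eq by linarith
    then have "?w y * (ln x + ?N y - ?F y - ?O y) \<le> ?w y * (x * ?q y / ?w y - 1)"
      using pos(1)[of "fst y" "snd y"] by (intro mult_left_mono) auto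
    \<comment> \<open>The terms are arranged so that every summand on either side is nonnegative;
      the inequality can then be integrated in \<open>ennreal\<close> without integrability.\<close>
    then have main: "?w y * ln x + ?w y + ?w y * ?N y \<le> ?w y * ?F y + ?w y * ?O y + x * ?q y"
      using pos(1)[of "fst y" "snd y"] by (simp add: algebra_simps)
    show "ennreal (ln L) * (ennreal (?w y) * indicator S y) + ennreal (?w y) + ennreal (?w y) * ennreal (?N y) \<le>
        ennreal (?w y) * ennreal (?F y) + ennreal (?w y) * ennreal (?O y) + ennreal L * (ennreal (?q y) * indicator S y) + ennreal (?q y)"
    proof (cases "y \<in> S")
      case True
      then have "ln L * ?w y + ?w y + ?w y * ?N y \<le> ?w y * ?F y + ?w y * ?O y + L * ?q y + ?q y"
        using main pos(2)[of "fst y" "snd y"] by (simp add: x_def mult.commute)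
      then have "ennreal (ln L * ?w y + ?w y + ?w y * ?N y) \<le> ennreal (?w y * ?F y + ?w y * ?O y + L * ?q y + ?q y)"
        by (rule ennreal_leI)
      then show ?thesis
        using True lnL L F0[of y] pos[of "fst y" "snd y"] by (simp add: ennreal_mult less_imp_le)
    next
      case False
      then have "?w y + ?w y * ?N y \<le> ?w y * ?F y + ?w y * ?O y + ?q y" using main by (simp add: x_def)
      then have "ennreal (?w y + ?w y * ?N y) \<le> ennreal (?w y * ?F y + ?w y * ?O y + ?q y)"
        by (rule ennreal_leI)
      then show ?thesis
        using False F0[of y] pos[of "fst y" "snd y"] by (simp add: ennreal_mult less_imp_le)
    qed
  qed
  also have "(\<integral>\<^sup>+y. ennreal (ln L) * (ennreal (?w y) * indicator S y) + ennreal (?w y) + ennreal (?w y) * ennreal (?N y) \<partial>base n) =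
      ennreal (ln L) * ?c + 1 + ennreal (real n * real CARD('r))"
    using nn_integral_base_trans_dens[OF v t] nn_integral_base_noise_sum[OF \<alpha> v t]
    by (simp add: nn_integral_add nn_integral_cmult)
  also have "(\<integral>\<^sup>+y. ennreal (?w y) * ennreal (?F y) + ennreal (?w y) * ennreal (?O y) + ennreal L * (ennreal (?q y) * indicator S y) + ennreal (?q y) \<partial>base n) =
      ennreal (real n * ?C) + ennreal ?m + ennreal L * ?Q + 1"
    using nn_integral_base_out_dens[OF v] nn_integral_base_rate_sum[OF \<alpha> v t psd] nn_integral_base_out_sum(1)[OF \<alpha> v p t \<kappa>]
    by (simp add: nn_integral_add nn_integral_cmult)
  finally have *: "ennreal (ln L) * ?c + 1 + ennreal (real n * real CARD('r)) \<le> ennreal (real n * ?C) + ennreal ?m + ennreal L * ?Q + 1" .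
  \<comment> \<open>The power constraint enters here: the mean of \<open>out_sum\<close> does not
    exceed that of \<open>noise_sum\<close>, so the two forms drop out of the bound.\<close>
  have m_le: "?m \<le> real n * real CARD('r)"
  proof -
    have "?m = \<kappa> * ((\<Sum>i=1..n. (norm (t i))\<^sup>2) - real n * (p * real CARD('t))) + real n * real CARD('r)"
      by (simp add: sum.distrib sum_subtractf sum_distrib_left[symmetric] algebra_simps)
    also have "\<dots> \<le> 0 + real n * real CARD('r)"
      using power \<kappa>(1) by (intro add_right_mono mult_nonneg_nonpos) auto
    finally show ?thesis by simp
  qed
  have "(1 + ennreal (real n * real CARD('r))) + ennreal (ln L) * ?c \<le>
      (1 + ennreal (real n * real CARD('r))) + (ennreal (real n * ?C) + ennreal L * ?Q)"
  proof -
    have "(1 + ennreal (real n * real CARD('r))) + ennreal (ln L) * ?c \<le> ennreal (real n * ?C) + ennreal ?m + ennreal L * ?Q + 1"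
      using * by (simp add: add_ac)
    also have "\<dots> \<le> ennreal (real n * ?C) + ennreal (real n * real CARD('r)) + ennreal L * ?Q + 1"
      using m_le by (intro add_mono order_refl ennreal_leI)
    finally show ?thesis by (simp add: add_ac)
  qed
  moreover have "1 + ennreal (real n * real CARD('r)) \<noteq> \<top>" by simp
  ultimately have "ennreal (ln L) * ?c \<le> ennreal (real n * ?C) + ennreal L * ?Q"
    unfolding ennreal_add_left_cancel_le by (simp add: infinity_ennreal_def)
  moreover have "ennreal ((1 - \<theta>) * ln L) \<le> ennreal (ln L) * ?c"
    using good \<theta> lnL by (simp add: ennreal_mult mult.commute[of "ennreal (1 - \<theta>)"] mult_left_mono)
  ultimately show ?thesis by (rule order_trans[rotated])
qed

text \<open>Codewords are arbitrary functions on all times, whereas measurability is stated for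
  blocks that are \<open>undefined\<close> outside \<open>{1..n}\<close>; this passes between the
  two.\<close>

lemma channel_law_restrict: "channel_law M \<xi> n g (restrict t {1..n}) = channel_law M \<xi> n g t"
  unfolding channel_law_def block_def by (simp cong: restrict_cong)

lemma restrict_in_blocks: "restrict t {1..n} \<in> space (blocks n)"
  by (simp add: space_PiM)

text \<open>\<open>converse_codeword\<close> with \<open>L\<close> the number of messages, summed
  over all messages. The reference masses of the disjoint regions sum to at most 1, and division by
  \<open>L\<close> leaves the summand 1.\<close>

lemma code_size_bound:
  fixes \<Gamma> :: "('t, 'r) code"
  assumes \<alpha>: "0 \<le> \<alpha>" "\<alpha> < 1" and \<sigma>: "0 < \<sigma>\<^sup>2" and P: "0 < P" and n: "1 \<le> n"
    and code: "is_code n P \<Gamma>" and err: "max_error M G \<xi> n \<Gamma> \<le> \<theta>" and \<theta>: "\<theta> \<le> 1"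
  shows "(1 - \<theta>) * ln (real (code_size \<Gamma>)) \<le>
    real n * (\<integral>g. ln_rate (\<sigma>\<^sup>2) ((P / real CARD('t)) *\<^sub>R mat 1) (g :: complex^'t^'r) \<partial>rayleigh) + 1"
proof -
  define p where "p = P / real CARD('t)"
  have p: "0 < p" using P by (simp add: p_def)
  let ?v = "\<sigma>\<^sup>2"
  let ?C = "\<integral>g. ln_rate ?v (p *\<^sub>R mat 1) (g :: complex^'t^'r) \<partial>rayleigh"
  let ?L = "code_size \<Gamma>"
  define t where "t l = restrict (codeword \<Gamma> l) {1..n}" for l
  define S where "S l = (SIGMA g : space (blocks n). decoding_region \<Gamma> l g)" for l
  let ?q = "\<lambda>y. ennreal (out_dens n ?v p (fst y) (snd y :: nat \<Rightarrow> complex^'r))"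
  let ?Q = "\<lambda>l. \<integral>\<^sup>+y. ?q y * indicator (S l) y \<partial>base n"
  obtain \<kappa> where \<kappa>: "0 \<le> \<kappa>" "\<And>t. (\<integral>g. signal_quad ?v p t (g :: complex^'t^'r) \<partial>rayleigh) = \<kappa> * (norm (t :: complex^'t))\<^sup>2"
    using integral_signal_quad[OF \<sigma> p] by metis
  have L: "1 \<le> ?L" using code by (simp add: is_code_def)
  have C0: "0 \<le> ?C" using p by (intro integral_nonneg_AE AE_I2 ln_rate_scalar_nonneg \<sigma>) simp
  have Sm: "S l \<in> sets (base n)" if "l \<in> {1..?L}" for l
    using code that by (simp add: is_code_def S_def sets_base)
  have bound: "ennreal ((1 - \<theta>) * ln (real ?L)) \<le> ennreal (real n * ?C) + ennreal (real ?L) * ?Q l" if l: "l \<in> {1..?L}" for l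
  proof -
    let ?e = "\<lambda>l. \<integral>\<omega>. measure (channel_law M \<xi> n (block n G \<omega>) (codeword \<Gamma> l))
               (space (blocks n) - decoding_region \<Gamma> l (block n G \<omega>)) \<partial>M"
    let ?c = "\<integral>\<^sup>+y. ennreal (trans_dens n ?v (t l) (fst y) (snd y)) * indicator (S l) y \<partial>base n"
    have tl: "t l \<in> space (blocks n)" unfolding t_def by (rule restrict_in_blocks)
    have Dm: "(SIGMA g : space (blocks n). decoding_region \<Gamma> l g) \<in> sets (blocks n \<Otimes>\<^sub>M blocks n)"
      and Ds: "\<And>g. g \<in> space (blocks n) \<Longrightarrow> decoding_region \<Gamma> l g \<subseteq> space (blocks n)"
      using code l by (auto simp: is_code_def)
    have "?e l \<le> max_error M G \<xi> n \<Gamma>"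
      unfolding max_error_def using l by (intro Max_ge) auto
    then have "?e l \<le> \<theta>" using err by simp
    moreover have "?e l = 1 - enn2real ?c"
      using error_probability(1)[OF \<sigma> n tl Dm Ds] unfolding S_def t_def channel_law_restrict by simp
    ultimately have "1 - \<theta> \<le> enn2real ?c" by simp
    then have "ennreal (1 - \<theta>) \<le> ennreal (enn2real ?c)" by (rule ennreal_leI)
    also have "ennreal (enn2real ?c) = ?c"
      using error_probability(2)[OF \<sigma> n tl Dm Ds] unfolding S_def by (intro ennreal_enn2real) (auto intro: le_less_trans)
    finally have good: "ennreal (1 - \<theta>) \<le> ?c" .
    have "(\<Sum>i=1..n. (norm (t l i))\<^sup>2) = (\<Sum>i=1..n. Re (cdot (codeword \<Gamma> l i) (codeword \<Gamma> l i)))"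
      by (intro sum.cong refl) (simp add: t_def Re_cdot_self)
    moreover have "(1 / real n) * (\<Sum>i=1..n. Re (cdot (codeword \<Gamma> l i) (codeword \<Gamma> l i))) \<le> P"
      using code l by (simp add: is_code_def)
    ultimately have "(\<Sum>i=1..n. (norm (t l i))\<^sup>2) \<le> real n * (p * real CARD('t))"
      using n by (simp add: p_def field_simps)
    then show ?thesis
      using converse_codeword[OF \<alpha> \<sigma> p tl \<kappa> _ Sm[OF l] _ good \<theta>] L by simp
  qed
  have qm: "?q \<in> borel_measurable (base n)"
    using measurable_out_dens(1)[OF \<sigma> measurable_base, where p=p] by measurable
  \<comment> \<open>The decoding regions, seen as sets of pairs, are disjoint, and \<open>?q\<close>
    is a probability density.\<close>
  have "(\<Sum>l\<in>{1..?L}. ?Q l) = (\<Sum>l\<in>{1..?L}. emeasure (density (base n) ?q) (S l))"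
    using Sm qm by (intro sum.cong refl) (simp add: emeasure_density)
  also have "\<dots> = emeasure (density (base n) ?q) (\<Union>l\<in>{1..?L}. S l)"
  proof (rule sum_emeasure)
    show "disjoint_family_on S {1..?L}"
      using code unfolding disjoint_family_on_def S_def is_code_def by blast
  qed (use Sm in auto)
  also have "\<dots> \<le> emeasure (density (base n) ?q) (space (density (base n) ?q))"
    by (rule emeasure_space)
  also have "\<dots> = 1"
    using qm nn_integral_base_out_dens[OF \<sigma>, of n p] by (simp add: emeasure_density cong: nn_integral_cong)
  finally have Q1: "(\<Sum>l\<in>{1..?L}. ?Q l) \<le> 1" .
  have "ennreal (real ?L * ((1 - \<theta>) * ln (real ?L))) = (\<Sum>l\<in>{1..?L}. ennreal ((1 - \<theta>) * ln (real ?L)))"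
    using \<theta> L by (simp add: ennreal_of_nat_eq_real_of_nat ennreal_mult)
  also have "\<dots> \<le> (\<Sum>l\<in>{1..?L}. ennreal (real n * ?C) + ennreal (real ?L) * ?Q l)"
    by (intro sum_mono bound)
  also have "\<dots> = ennreal (real ?L * (real n * ?C)) + ennreal (real ?L) * (\<Sum>l\<in>{1..?L}. ?Q l)"
    using C0 by (simp add: sum.distrib sum_distrib_left ennreal_of_nat_eq_real_of_nat ennreal_mult)
  also have "\<dots> \<le> ennreal (real ?L * (real n * ?C)) + ennreal (real ?L) * 1"
    using Q1 by (intro add_left_mono mult_left_mono) auto
  also have "\<dots> = ennreal (real ?L * (real n * ?C) + real ?L)"
    using C0 by simp
  finally have "real ?L * ((1 - \<theta>) * ln (real ?L)) \<le> real ?L * (real n * ?C) + real ?L"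
    by (rule ennreal_le_iff[THEN iffD1, rotated]) (intro add_nonneg_nonneg mult_nonneg_nonneg C0 of_nat_0_le_iff)
  then have "real ?L * ((1 - \<theta>) * ln (real ?L)) \<le> real ?L * (real n * ?C + 1)" by (simp add: algebra_simps)
  then have "(1 - \<theta>) * ln (real ?L) \<le> real n * ?C + 1"
    by (rule mult_left_le_imp_le) (use L in simp)
  then show ?thesis unfolding p_def .
qed

lemma achievable_rate_le:
  assumes \<alpha>: "0 \<le> \<alpha>" "\<alpha> < 1" and \<sigma>: "0 < \<sigma>\<^sup>2" and P: "0 < P" and R: "achievable_rate M G \<xi> P R"
  shows "R * ln 2 \<le> (\<integral>g. ln_rate (\<sigma>\<^sup>2) ((P / real CARD('t)) *\<^sub>R mat 1) (g :: complex^'t^'r) \<partial>rayleigh)"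
    (is "_ \<le> ?C")
proof -
  \<comment> \<open>The same \<open>e\<close> serves as error bound and as rate loss. The factor
    \<open>1 - e\<close> of the weak converse disappears in the limit
    \<open>e \<rightarrow> 0\<close>, as achievability provides codes for every positive
    error.\<close>
  have key: "(1 - e) * (R - e) * ln 2 \<le> ?C" if e: "0 < e" "e < 1" for e
  proof -
    obtain \<Gamma> :: "nat \<Rightarrow> ('t, 'r) code" where \<Gamma>: "\<forall>n\<ge>1. is_code n P (\<Gamma> n)"
      and ev: "\<forall>\<^sub>F n in sequentially. log 2 (real (code_size (\<Gamma> n))) / real n \<ge> R - e \<and> max_error M G \<xi> n (\<Gamma> n) \<le> e"
      using R[unfolded achievable_rate_def, rule_format, OF e(1) e(1)] by (elim exE conjE)
    have "\<forall>\<^sub>F n in sequentially. (1 - e) * (R - e) * ln 2 \<le> ?C + 1 / real n"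
      using ev eventually_ge_at_top[of 1]
    proof eventually_elim
      case (elim n)
      have L: "(1 - e) * ln (real (code_size (\<Gamma> n))) \<le> real n * ?C + 1"
        using code_size_bound[OF \<alpha> \<sigma> P elim(2), of "\<Gamma> n" e] \<Gamma> elim e by simp
      have "real n * (R - e) \<le> log 2 (real (code_size (\<Gamma> n)))"
        using elim by (simp add: field_simps)
      then have "real n * (R - e) * ln 2 \<le> ln (real (code_size (\<Gamma> n)))"
        by (simp add: log_def field_simps)
      then have "(1 - e) * (real n * (R - e) * ln 2) \<le> (1 - e) * ln (real (code_size (\<Gamma> n)))"
        using e by (intro mult_left_mono) auto
      then have "real n * ((1 - e) * (R - e) * ln 2) \<le> real n * ?C + 1"
        using L by (simp add: mult_ac)
      then show ?case using elim(2) by (simp add: field_simps)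
    qed
    moreover have "(\<lambda>n. ?C + 1 / real n) \<longlonglongrightarrow> ?C + 0"
      by (intro tendsto_add tendsto_const lim_const_over_n)
    ultimately show ?thesis
      by (intro tendsto_lowerbound[where f="\<lambda>n. ?C + 1 / real n" and x="?C" and F=sequentially]) auto
  qed
  have "(\<lambda>n. (1 - inverse (real (Suc n))) * (R - inverse (real (Suc n))) * ln 2) \<longlonglongrightarrow> (1 - 0) * (R - 0) * ln 2"
    by (intro tendsto_intros LIMSEQ_inverse_real_of_nat)
  moreover have "\<forall>\<^sub>F n in sequentially. (1 - inverse (real (Suc n))) * (R - inverse (real (Suc n))) * ln 2 \<le> ?C"
    using eventually_ge_at_top[of 1]
  proof eventually_elim
    case (elim n)
    then have "inverse (real (Suc n)) < 1" by (simp add: inverse_less_1_iff)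
    then show ?case by (intro key) auto
  qed
  ultimately show ?thesis
    by (intro tendsto_upperbound[where x="R * ln 2" and F=sequentially]) auto
qed


section \<open>Achievability\<close>

text \<open>Averaging the channel over the Gaussian input factorises over time, and each factor is
  an instance of \<open>cgd_convolution\<close>. This is the marginal identity that
  \<open>feinstein\<close> asks for.\<close>

lemma nn_integral_trans_dens_gaussian_input:
  assumes v: "0 < v" and p: "0 \<le> p"
  shows "(\<integral>\<^sup>+s. ennreal (gauss_prod n (\<lambda>_. mat 1) s) * ennreal (trans_dens n v (\<lambda>i\<in>{1..n}. sqrt p *\<^sub>R s i) (g :: nat \<Rightarrow> complex^'t^'r) z) \<partial>lebesgue_block n) =
    ennreal (out_dens n v p g z)"
proof -
  let ?K = "v *\<^sub>R mat 1 :: complex^'r^'r"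
  have K: "cov ?K" using v by (rule cov.scalar)
  have "ennreal (gauss_prod n (\<lambda>_. mat 1) s) * ennreal (trans_dens n v (\<lambda>i\<in>{1..n}. sqrt p *\<^sub>R s i) g z) =
      (\<Prod>i=1..n. ennreal (complex_gaussian_density (mat 1) (s i)) * ennreal (complex_gaussian_density ?K (z i - (sqrt p *\<^sub>R g i) *v s i)))" for s :: "nat \<Rightarrow> complex^'t"
    unfolding trans_dens_def gauss_prod_ennreal[OF K] gauss_prod_ennreal[OF cov_mat_1] prod.distrib[symmetric]
    by (intro prod.cong refl) (simp add: matrix_vector_scaleR scaleR_matrix_vector)
  then have "(\<integral>\<^sup>+s. ennreal (gauss_prod n (\<lambda>_. mat 1) s) * ennreal (trans_dens n v (\<lambda>i\<in>{1..n}. sqrt p *\<^sub>R s i) g z) \<partial>lebesgue_block n) =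
      (\<Prod>i=1..n. \<integral>\<^sup>+s. ennreal (complex_gaussian_density (mat 1) s) * ennreal (complex_gaussian_density ?K (z i - (sqrt p *\<^sub>R g i) *v s)) \<partial>lborel)"
    by (simp only:) (rule product_sigma_finite.product_nn_integral_prod[OF product_sigma_finite_lborel], auto)
  also have "\<dots> = (\<Prod>i=1..n. ennreal (complex_gaussian_density (out_cov v p (g i)) (z i)))"
    by (simp only: cgd_convolution[OF K] out_cov_def)
  also have "\<dots> = ennreal (out_dens n v p g z)"
    unfolding out_dens_def by (rule gauss_prod_ennreal[OF cov_out_cov[OF v], symmetric])
  finally show ?thesis .
qed

text \<open>\<open>feinstein\<close> is applied with pairs of gains and outputs as observations,
  standard Gaussian blocks scaled by \<open>sqrt p\<close> as inputs, and threshold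
  \<open>exp (real n * r)\<close>. What has to be shown is that the information density exceeds
  \<open>real n * r\<close> with high probability.\<close>

lemma achievability:
  assumes \<alpha>: "0 \<le> \<alpha>" "\<alpha> < 1" and \<sigma>: "0 < \<sigma>\<^sup>2" and p: "0 < p" "p * real CARD('t) < P"
    and r: "r < (\<integral>g. ln_rate (\<sigma>\<^sup>2) (p *\<^sub>R mat 1) (g :: complex^'t^'r) \<partial>rayleigh)" and \<theta>: "0 < \<theta>" "\<theta> < 1"
  shows "\<forall>\<^sub>F n in sequentially. \<exists>\<Gamma> :: ('t, 'r) code. is_code n P \<Gamma> \<and>
    \<theta> / 2 * exp (real n * r) \<le> real (code_size \<Gamma>) \<and> max_error M G \<xi> n \<Gamma> \<le> \<theta>"
proof -
  let ?v = "\<sigma>\<^sup>2"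
  let ?f = "ln_rate ?v (p *\<^sub>R mat 1) :: complex^'t^'r \<Rightarrow> real"
  let ?C = "\<integral>g. ?f g \<partial>rayleigh"
  let ?T = "real CARD('t)" and ?R = "real CARD('r)"
  \<comment> \<open>The gap is divided equally among three deviations: of the rate sum, of the
    output form and of the noise form.\<close>
  define \<delta> where "\<delta> = (?C - r) / 3"
  have \<delta>: "0 < \<delta>" "r = ?C - 3 * \<delta>" using r by (simp_all add: \<delta>_def field_simps)
  \<comment> \<open>The slack in power: a standard block with \<open>quad_sum\<close> below
    \<open>real n * (?T + \<eta>)\<close> has average power below \<open>P\<close> after scaling by
    \<open>sqrt p\<close>.\<close>
  define \<eta> where "\<eta> = P / p - ?T"
  have \<eta>: "0 < \<eta>" "?T + \<eta> = P / p" using p by (simp_all add: \<eta>_def field_simps)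
  \<comment> \<open>Four tail events of probability \<open>\<epsilon>\<close> lose
    \<open>\<theta> / 4\<close> in all. The regions already chosen cost at most
    \<open>\<theta> / 2\<close>, so the strict inequality in \<open>feinstein\<close> keeps a margin
    of \<open>\<theta> / 4\<close>.\<close>
  define \<epsilon> where "\<epsilon> = \<theta> / 16"
  have \<epsilon>: "0 < \<epsilon>" using \<theta> by (simp add: \<epsilon>_def)
  have psd: "hermitian_psd (p *\<^sub>R mat 1 :: complex^'t^'t)" using p by (intro hermitian_psd_scalar) simp
  obtain \<rho>0 where \<rho>0: "0 < \<rho>0" "\<rho>0 < 1" "\<And>n (K :: nat \<Rightarrow> complex^'t^'t) a. (\<forall>i. cov (K i)) \<Longrightarrow>
    (\<integral>\<^sup>+z. ennreal (gauss_prod n K (\<lambda>i. z i - a i)) * indicator {z. real n * (?T + \<eta>) \<le> quad_sum n K (\<lambda>i. z i - a i)} z \<partial>lebesgue_block n) \<le> ennreal (\<rho>0 ^ n)"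
    using gauss_prod_upper_tail[OF \<eta>(1), where 'n='t] by blast
  obtain \<rho>1 where \<rho>1: "0 < \<rho>1" "\<rho>1 < 1" "\<And>n (K :: nat \<Rightarrow> complex^'r^'r) a. (\<forall>i. cov (K i)) \<Longrightarrow>
    (\<integral>\<^sup>+z. ennreal (gauss_prod n K (\<lambda>i. z i - a i)) * indicator {z. quad_sum n K (\<lambda>i. z i - a i) \<le> real n * (?R - \<delta>)} z \<partial>lebesgue_block n) \<le> ennreal (\<rho>1 ^ n)"
    using gauss_prod_lower_tail[OF \<delta>(1), where 'n='r] by blast
  obtain \<rho>2 where \<rho>2: "0 < \<rho>2" "\<rho>2 < 1" "\<And>n (K :: nat \<Rightarrow> complex^'r^'r) a. (\<forall>i. cov (K i)) \<Longrightarrow>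
    (\<integral>\<^sup>+z. ennreal (gauss_prod n K (\<lambda>i. z i - a i)) * indicator {z. real n * (?R + \<delta>) \<le> quad_sum n K (\<lambda>i. z i - a i)} z \<partial>lebesgue_block n) \<le> ennreal (\<rho>2 ^ n)"
    using gauss_prod_upper_tail[OF \<delta>(1), where 'n='r] by blast
  have pow: "\<forall>\<^sub>F n in sequentially. \<rho> ^ n \<le> \<epsilon>" if "0 < \<rho>" "\<rho> < 1" for \<rho>
  proof -
    have "(\<lambda>n. \<rho> ^ n) \<longlonglongrightarrow> 0" using that by (intro LIMSEQ_power_zero) auto
    then have "\<forall>\<^sub>F n in sequentially. \<rho> ^ n < \<epsilon>" using \<epsilon> by (rule order_tendstoD)
    then show ?thesis by eventually_elim simp
  qed
  have lln: "\<forall>\<^sub>F n in sequentially. prob {\<omega>\<in>space M. (\<Sum>i=1..n. ?f (G i \<omega>)) \<le> real n * (?C - \<delta>)} \<le> \<epsilon>"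
    using ln_rate_psd_nonneg[OF \<sigma> psd] \<delta>(1) \<epsilon>
    by (intro gains_weak_law_lower[OF \<alpha> continuous_ln_rate[OF \<sigma> psd] _ integrable_ln_rate[OF \<sigma> psd]]) auto
  from pow[OF \<rho>0(1,2)] pow[OF \<rho>1(1,2)] pow[OF \<rho>2(1,2)] lln eventually_ge_at_top[of 1]
  show ?thesis
  proof eventually_elim
    case (elim n)
    note n = elim(5)
    define \<gamma> where "\<gamma> = exp (real n * r)"
    have \<gamma>: "0 < \<gamma>" by (simp add: \<gamma>_def)
    define \<Phi> where "\<Phi> = density (lebesgue_block n) (\<lambda>s :: nat \<Rightarrow> complex^'t. ennreal (gauss_prod n (\<lambda>_. mat 1) s))"
    define enc where "enc s = (\<lambda>i\<in>{1..n}. sqrt p *\<^sub>R s i)" for s :: "nat \<Rightarrow> complex^'t"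
    define w where "w s y = ennreal (trans_dens n ?v (enc s) (fst y) (snd y))" for s :: "nat \<Rightarrow> complex^'t" and y :: "(nat \<Rightarrow> complex^'t^'r) \<times> (nat \<Rightarrow> complex^'r)"
    define q where "q y = ennreal (out_dens n ?v p (fst y) (snd y))" for y :: "(nat \<Rightarrow> complex^'t^'r) \<times> (nat \<Rightarrow> complex^'r)"
    define F where "F = {s \<in> space (blocks n). quad_sum n (\<lambda>_. mat 1 :: complex^'t^'t) s < real n * (?T + \<eta>)}"
    have gm: "gauss_prod n (\<lambda>_. mat 1 :: complex^'t^'t) \<in> borel_measurable (lebesgue_block n)"
      using measurable_gauss_prod[of n "\<lambda>_. mat 1 :: complex^'t^'t" "\<lambda>_. 0"] by simp
    have qsm: "quad_sum n (\<lambda>_. mat 1 :: complex^'t^'t) \<in> borel_measurable (lebesgue_block n)"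
      using measurable_quad_sum[of n "\<lambda>_. mat 1 :: complex^'t^'t" "\<lambda>_. 0"] by simp
    have sets\<Phi> [measurable_cong]: "sets \<Phi> = sets (blocks n)" by (simp add: \<Phi>_def sets_lebesgue_block)
    have space\<Phi>: "space \<Phi> = space (blocks n)" by (simp add: \<Phi>_def space_lebesgue_block)
    have encm [measurable]: "enc \<in> measurable (blocks n) (blocks n)"
      unfolding enc_def[abs_def]
      by (intro measurable_restrict borel_measurable_scaleR borel_measurable_const measurable_component_singleton)
    have enc_space: "enc s \<in> space (blocks n)" for s
      unfolding enc_def by (rule restrict_in_blocks)
    have "emeasure \<Phi> (space \<Phi>) = 1"
      using nn_integral_gauss_prod[of "\<lambda>_. mat 1 :: complex^'t^'t" n "\<lambda>_. 0"] gm
      by (simp add: \<Phi>_def emeasure_density cong: nn_integral_cong)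
    then interpret \<Phi>: prob_space \<Phi> by (rule prob_spaceI)
    interpret \<beta>: sigma_finite_measure "base n" by (rule sigma_finite_base)
    interpret pair_sigma_finite \<Phi> "base n" ..
    have nn\<Phi>: "(\<integral>\<^sup>+s. h s \<partial>\<Phi>) = (\<integral>\<^sup>+s. ennreal (gauss_prod n (\<lambda>_. mat 1) s) * h s \<partial>lebesgue_block n)"
      if "h \<in> borel_measurable \<Phi>" for h
      unfolding \<Phi>_def using gm that
      by (intro nn_integral_density) (auto simp: measurable_cong_sets[OF sets\<Phi> refl] measurable_cong_sets[OF sets_lebesgue_block refl])
    have wt: "w s \<in> borel_measurable (base n)" for s
      unfolding w_def
      using measurable_trans_dens(1)[OF measurable_const[OF enc_space] measurable_base] by measurable
    have wp: "(\<lambda>(s, y). w s y) \<in> borel_measurable (\<Phi> \<Otimes>\<^sub>M base n)"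
    proof -
      have a: "(\<lambda>x. enc (fst x)) \<in> measurable (\<Phi> \<Otimes>\<^sub>M base n) (blocks n)"
        by (rule measurable_compose[OF _ encm]) measurable
      have b: "(\<lambda>x. fst (snd x)) \<in> measurable (\<Phi> \<Otimes>\<^sub>M base n) (blocks n)" "(\<lambda>x. snd (snd x)) \<in> measurable (\<Phi> \<Otimes>\<^sub>M base n) (blocks n)"
        by (rule measurable_compose[OF measurable_snd measurable_base(1)], rule measurable_compose[OF measurable_snd measurable_base(2)])
      from measurable_trans_dens(1)[OF a b, where v="?v"]
      show ?thesis unfolding w_def case_prod_unfold by measurable
    qed
    have qm: "q \<in> borel_measurable (base n)"
      unfolding q_def using measurable_out_dens(1)[OF \<sigma> measurable_base, where p=p] by measurable
    have Fm: "F \<in> sets \<Phi>"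
      unfolding F_def sets\<Phi> using qsm by (simp add: measurable_cong_sets[OF sets_lebesgue_block refl]) measurable
    have marginal: "(\<integral>\<^sup>+s. w s y \<partial>\<Phi>) = q y" if y: "y \<in> space (base n)" for y
    proof -
      have "(\<lambda>s. w s y) \<in> borel_measurable \<Phi>"
        using measurable_compose[OF measurable_Pair2'[OF y] wp] by simp
      then show ?thesis
        unfolding w_def q_def enc_def using p by (subst nn\<Phi>) (simp_all add: nn_integral_trans_dens_gaussian_input[OF \<sigma>])
    qed
    have total: "(\<integral>\<^sup>+y. w s y \<partial>base n) = 1" for s
      unfolding w_def by (rule nn_integral_base_trans_dens[OF \<sigma> enc_space])
    \<comment> \<open>The exceptional sets: rate sum too small, output form too small, noise form
      too large. The first two do not depend on the codeword.\<close>
    define B1 where "B1 = {y \<in> space (base n). (\<Sum>i=1..n. ?f (fst y i)) \<le> real n * (?C - \<delta>)}"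
    define B2 where "B2 = {y \<in> space (base n). out_sum n ?v p (fst y) (snd y) \<le> real n * (?R - \<delta>)}"
    define B3 where "B3 s = {y \<in> space (base n). real n * (?R + \<delta>) \<le> noise_sum n ?v (enc s) (fst y) (snd y)}" for s
    have B1m: "B1 \<in> sets (base n)"
      unfolding B1_def using measurable_out_dens(3)[OF \<sigma> measurable_base, where Q="p *\<^sub>R mat 1"] by measurable
    have B2m: "B2 \<in> sets (base n)"
      unfolding B2_def using measurable_out_dens(2)[OF \<sigma> measurable_base, where p=p] by measurable
    have B3m: "B3 s \<in> sets (base n)" for s
      unfolding B3_def using measurable_trans_dens(2)[OF measurable_const[OF enc_space] measurable_base, where v="?v"] by measurable
    note [measurable] = wt wp qm Fm B1m B2m B3m
    have F_tail: "(\<integral>\<^sup>+s. indicator (- F) s \<partial>\<Phi>) \<le> ennreal \<epsilon>"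
    proof -
      have "(\<lambda>s. indicator (- F) s :: ennreal) \<in> borel_measurable \<Phi>" by measurable
      then have "(\<integral>\<^sup>+s. indicator (- F) s \<partial>\<Phi>) = (\<integral>\<^sup>+s. ennreal (gauss_prod n (\<lambda>_. mat 1) s) * indicator (- F) s \<partial>lebesgue_block n)"
        by (rule nn\<Phi>)
      also have "\<dots> = (\<integral>\<^sup>+s. ennreal (gauss_prod n (\<lambda>_. mat 1 :: complex^'t^'t) (\<lambda>i. s i - 0)) *
          indicator {s. real n * (?T + \<eta>) \<le> quad_sum n (\<lambda>_. mat 1) (\<lambda>i. s i - 0)} s \<partial>lebesgue_block n)"
        by (intro nn_integral_cong) (auto simp: indicator_def F_def space_lebesgue_block)
      also have "\<dots> \<le> ennreal (\<rho>0 ^ n)" by (rule \<rho>0(3)) simp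
      also have "\<dots> \<le> ennreal \<epsilon>" using elim(1) by (rule ennreal_leI)
      finally show ?thesis .
    qed
    have B1_tail: "(\<integral>\<^sup>+y. w s y * indicator B1 y \<partial>base n) \<le> ennreal \<epsilon>" for s
    proof -
      let ?E = "{\<omega>\<in>space M. (\<Sum>i=1..n. ?f (G i \<omega>)) \<le> real n * (?C - \<delta>)}"
      let ?A = "{g \<in> space (blocks n). (\<Sum>i=1..n. ?f (g i)) \<le> real n * (?C - \<delta>)}"
      have mf: "(\<lambda>g. \<Sum>i=1..n. ?f (g i)) \<in> borel_measurable (blocks n)"
        by (intro borel_measurable_sum) measurable
      then have Am: "?A \<in> sets (blocks n)" by measurable
      have "(\<integral>\<^sup>+y. w s y * indicator B1 y \<partial>base n) = (\<integral>\<^sup>+g. (\<integral>\<^sup>+z. w s (g, z) * indicator B1 (g, z) \<partial>lebesgue_block n) \<partial>gain_law n)"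
        by (rule nn_integral_base) measurable
      also have "\<dots> = (\<integral>\<^sup>+g. indicator ?A g \<partial>gain_law n)"
      proof (intro nn_integral_cong)
        fix g assume g: "g \<in> space (gain_law n)"
        have "(\<integral>\<^sup>+z. w s (g, z) * indicator B1 (g, z) \<partial>lebesgue_block n) = (\<integral>\<^sup>+z. ennreal (trans_dens n ?v (enc s) g z) * indicator ?A g \<partial>lebesgue_block n)"
          using g by (intro nn_integral_cong) (auto simp: w_def B1_def indicator_def space_base space_lebesgue_block)
        also have "\<dots> = indicator ?A g"
          by (cases "g \<in> ?A") (simp_all add: nn_integral_trans_dens[OF \<sigma>] del: mem_Collect_eq)
        finally show "(\<integral>\<^sup>+z. w s (g, z) * indicator B1 (g, z) \<partial>lebesgue_block n) = indicator ?A g" .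
      qed
      also have "\<dots> = emeasure M ?E"
      proof -
        have "(\<Sum>i=1..n. ?f (block n G \<omega> i)) = (\<Sum>i=1..n. ?f (G i \<omega>))" for \<omega>
          by (intro sum.cong refl) (simp only: block_gains_component)
        then have "block n G -` ?A \<inter> space M = ?E"
          using measurable_space[OF measurable_block_gains, of _ n] by auto
        then show ?thesis
          using Am by (simp add: gain_law_def emeasure_distr[OF measurable_block_gains Am])
      qed
      also have "\<dots> \<le> ennreal \<epsilon>" using elim(4) by (simp add: emeasure_eq_measure ennreal_leI)
      finally show ?thesis .
    qed
    have B3_tail: "(\<integral>\<^sup>+y. w s y * indicator (B3 s) y \<partial>base n) \<le> ennreal \<epsilon>" for s
    proof -
      have "(\<integral>\<^sup>+y. w s y * indicator (B3 s) y \<partial>base n) = (\<integral>\<^sup>+g. (\<integral>\<^sup>+z. w s (g, z) * indicator (B3 s) (g, z) \<partial>lebesgue_block n) \<partial>gain_law n)"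
        by (rule nn_integral_base) measurable
      also have "\<dots> \<le> (\<integral>\<^sup>+g. ennreal \<epsilon> \<partial>gain_law n)"
      proof (intro nn_integral_mono)
        fix g assume g: "g \<in> space (gain_law n)"
        have "(\<integral>\<^sup>+z. w s (g, z) * indicator (B3 s) (g, z) \<partial>lebesgue_block n) \<le>
            (\<integral>\<^sup>+z. ennreal (gauss_prod n (\<lambda>_. ?v *\<^sub>R mat 1) (\<lambda>i. z i - g i *v enc s i)) *
              indicator {z. real n * (?R + \<delta>) \<le> quad_sum n (\<lambda>_. ?v *\<^sub>R mat 1) (\<lambda>i. z i - g i *v enc s i)} z \<partial>lebesgue_block n)"
          by (intro nn_integral_mono) (auto simp: w_def trans_dens_def B3_def noise_sum_def indicator_def)
        also have "\<dots> \<le> ennreal (\<rho>2 ^ n)" by (rule \<rho>2(3)) (simp add: cov.scalar[OF \<sigma>])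
        also have "\<dots> \<le> ennreal \<epsilon>" using elim(3) by (rule ennreal_leI)
        finally show "(\<integral>\<^sup>+z. w s (g, z) * indicator (B3 s) (g, z) \<partial>lebesgue_block n) \<le> ennreal \<epsilon>" .
      qed
      also have "\<dots> = ennreal \<epsilon>"
        using prob_space.emeasure_space_1[OF prob_space_gain_law, of n] by simp
      finally show ?thesis .
    qed
    \<comment> \<open>For a fixed codeword the output is not distributed according to
      \<open>out_dens\<close>, so this tail is controlled only after averaging over the input; the
      others hold for each codeword.\<close>
    have B2_tail: "(\<integral>\<^sup>+s. (\<integral>\<^sup>+y. w s y * indicator B2 y \<partial>base n) \<partial>\<Phi>) \<le> ennreal \<epsilon>"
    proof -
      have "(\<integral>\<^sup>+s. (\<integral>\<^sup>+y. w s y * indicator B2 y \<partial>base n) \<partial>\<Phi>) = (\<integral>\<^sup>+y. (\<integral>\<^sup>+s. w s y * indicator B2 y \<partial>\<Phi>) \<partial>base n)"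
        by (rule Fubini'[symmetric]) measurable
      also have "\<dots> = (\<integral>\<^sup>+y. q y * indicator B2 y \<partial>base n)"
      proof (intro nn_integral_cong)
        fix y assume y: "y \<in> space (base n)"
        have "(\<lambda>s. w s y) \<in> borel_measurable \<Phi>"
          using measurable_compose[OF measurable_Pair2'[OF y] wp] by simp
        then show "(\<integral>\<^sup>+s. w s y * indicator B2 y \<partial>\<Phi>) = q y * indicator B2 y"
          by (simp add: nn_integral_multc marginal[OF y])
      qed
      also have "\<dots> = (\<integral>\<^sup>+g. (\<integral>\<^sup>+z. q (g, z) * indicator B2 (g, z) \<partial>lebesgue_block n) \<partial>gain_law n)"
        by (rule nn_integral_base) measurable
      also have "\<dots> \<le> (\<integral>\<^sup>+g. ennreal \<epsilon> \<partial>gain_law n)"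
      proof (intro nn_integral_mono)
        fix g assume g: "g \<in> space (gain_law n)"
        have "(\<integral>\<^sup>+z. q (g, z) * indicator B2 (g, z) \<partial>lebesgue_block n) \<le>
            (\<integral>\<^sup>+z. ennreal (gauss_prod n (\<lambda>i. out_cov ?v p (g i)) (\<lambda>i. z i - 0)) *
              indicator {z. quad_sum n (\<lambda>i. out_cov ?v p (g i)) (\<lambda>i. z i - 0) \<le> real n * (?R - \<delta>)} z \<partial>lebesgue_block n)"
          by (intro nn_integral_mono) (auto simp: q_def out_dens_def B2_def out_sum_def indicator_def)
        also have "\<dots> \<le> ennreal (\<rho>1 ^ n)" by (rule \<rho>1(3)) (simp add: cov_out_cov[OF \<sigma>])
        also have "\<dots> \<le> ennreal \<epsilon>" using elim(2) by (rule ennreal_leI)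
        finally show "(\<integral>\<^sup>+z. q (g, z) * indicator B2 (g, z) \<partial>lebesgue_block n) \<le> ennreal \<epsilon>" .
      qed
      also have "\<dots> = ennreal \<epsilon>"
        using prob_space.emeasure_space_1[OF prob_space_gain_law, of n] by simp
      finally show ?thesis .
    qed
    define A where "A s = {y. ennreal \<gamma> * q y \<le> w s y}" for s
    let ?X = "\<integral>\<^sup>+s. (\<integral>\<^sup>+y. w s y * indicator (A s) y \<partial>base n) * indicator F s \<partial>\<Phi>"
    have Am: "(\<lambda>(s, y). w s y * indicator (A s) y) \<in> borel_measurable (\<Phi> \<Otimes>\<^sub>M base n)"
    proof -
      have "(\<lambda>x. indicator {x \<in> space (\<Phi> \<Otimes>\<^sub>M base n). ennreal \<gamma> * q (snd x) \<le> (\<lambda>(s, y). w s y) x} x :: ennreal) \<in> borel_measurable (\<Phi> \<Otimes>\<^sub>M base n)"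
        by measurable
      then have "(\<lambda>x. (\<lambda>(s, y). w s y) x * indicator {x \<in> space (\<Phi> \<Otimes>\<^sub>M base n). ennreal \<gamma> * q (snd x) \<le> (\<lambda>(s, y). w s y) x} x) \<in> borel_measurable (\<Phi> \<Otimes>\<^sub>M base n)"
        by (intro borel_measurable_times_ennreal wp)
      then show ?thesis
        by (rule measurable_cong[THEN iffD1, rotated]) (auto simp: A_def indicator_def)
    qed
    have As: "(\<lambda>y. w s y * indicator (A s) y) \<in> borel_measurable (base n)" for s
    proof -
      have "{y \<in> space (base n). ennreal \<gamma> * q y \<le> w s y} \<in> sets (base n)" by measurable
      then have "(\<lambda>y. w s y * indicator {y \<in> space (base n). ennreal \<gamma> * q y \<le> w s y} y) \<in> borel_measurable (base n)"
        by measurable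
      then show ?thesis by (rule measurable_cong[THEN iffD1, rotated]) (auto simp: A_def indicator_def)
    qed
    \<comment> \<open>Outside \<open>B1\<close>, \<open>B2\<close> and \<open>B3 s\<close> the
      information density exceeds \<open>n * (?C - \<delta>) + n * (?R - \<delta>) - n * (?R +
      \<delta>)\<close>, which is \<open>n * r\<close>; hence the observation lies in
      \<open>A s\<close>.\<close>
    have typical: "w s y \<le> w s y * indicator (A s) y + w s y * indicator B1 y + w s y * indicator B2 y + w s y * indicator (B3 s) y"
      if y: "y \<in> space (base n)" for s y
    proof (cases "y \<in> A s \<or> y \<in> B1 \<or> y \<in> B2 \<or> y \<in> B3 s")
      case True
      then show ?thesis by (auto simp: indicator_def add_increasing add_increasing2)
    next
      case False
      let ?w = "trans_dens n ?v (enc s) (fst y) (snd y)" and ?q = "out_dens n ?v p (fst y) (snd y)"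
      have pos: "0 < ?w" "0 < ?q" by (rule trans_dens_pos[OF \<sigma>], rule out_dens_pos[OF \<sigma>])
      have "\<not> ennreal (\<gamma> * ?q) \<le> ennreal ?w" using False \<gamma> pos by (simp add: A_def w_def q_def ennreal_mult)
      then have "?w < \<gamma> * ?q" by (meson ennreal_leI not_le)
      then have "ln ?w < ln (\<gamma> * ?q)" using pos \<gamma> by simp
      also have "\<dots> = real n * r + ln ?q" using pos by (simp add: \<gamma>_def ln_mult)
      finally have "(\<Sum>i=1..n. ?f (fst y i)) + out_sum n ?v p (fst y) (snd y) - noise_sum n ?v (enc s) (fst y) (snd y) < real n * r"
        using ln_density_ratio[OF \<sigma> less_imp_le[OF p(1)], of n "enc s" "fst y" "snd y"] by linarith
      moreover have "real n * (?C - \<delta>) < (\<Sum>i=1..n. ?f (fst y i))" "real n * (?R - \<delta>) < out_sum n ?v p (fst y) (snd y)"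
        "noise_sum n ?v (enc s) (fst y) (snd y) < real n * (?R + \<delta>)"
        using False y by (auto simp: B1_def B2_def B3_def not_le)
      moreover have "real n * r = real n * (?C - \<delta>) + real n * (?R - \<delta>) - real n * (?R + \<delta>)"
        by (simp add: \<delta>(2) algebra_simps)
      ultimately show ?thesis by linarith
    qed
    have one: "1 \<le> (\<integral>\<^sup>+y. w s y * indicator (A s) y \<partial>base n) * indicator F s + indicator (- F) s + ennreal (2 * \<epsilon>) +
        (\<integral>\<^sup>+y. w s y * indicator B2 y \<partial>base n)" for s
    proof (cases "s \<in> F")
      case True
      have "1 = (\<integral>\<^sup>+y. w s y \<partial>base n)" by (simp add: total)
      also have "\<dots> \<le> (\<integral>\<^sup>+y. w s y * indicator (A s) y + w s y * indicator B1 y + w s y * indicator B2 y + w s y * indicator (B3 s) y \<partial>base n)"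
        by (intro nn_integral_mono typical)
      also have "\<dots> = (\<integral>\<^sup>+y. w s y * indicator (A s) y \<partial>base n) + (\<integral>\<^sup>+y. w s y * indicator B1 y \<partial>base n) +
          (\<integral>\<^sup>+y. w s y * indicator B2 y \<partial>base n) + (\<integral>\<^sup>+y. w s y * indicator (B3 s) y \<partial>base n)"
        using As[of s] by (simp add: nn_integral_add)
      also have "\<dots> \<le> (\<integral>\<^sup>+y. w s y * indicator (A s) y \<partial>base n) + ennreal \<epsilon> + (\<integral>\<^sup>+y. w s y * indicator B2 y \<partial>base n) + ennreal \<epsilon>"
        by (intro add_mono order_refl B1_tail B3_tail)
      also have "\<dots> = (\<integral>\<^sup>+y. w s y * indicator (A s) y \<partial>base n) + (ennreal \<epsilon> + ennreal \<epsilon>) + (\<integral>\<^sup>+y. w s y * indicator B2 y \<partial>base n)"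
        by (simp only: add_ac)
      also have "ennreal \<epsilon> + ennreal \<epsilon> = ennreal (2 * \<epsilon>)" using \<epsilon> by (simp add: ennreal_plus[symmetric] del: ennreal_plus)
      finally show ?thesis using True by simp
    next
      case False
      then show ?thesis by (simp add: add_increasing2)
    qed
    have Xm: "(\<lambda>s. (\<integral>\<^sup>+y. w s y * indicator (A s) y \<partial>base n) * indicator F s) \<in> borel_measurable \<Phi>"
      using \<beta>.borel_measurable_nn_integral[OF Am] by measurable
    have X2m: "(\<lambda>s. \<integral>\<^sup>+y. w s y * indicator B2 y \<partial>base n) \<in> borel_measurable \<Phi>"
      by (rule \<beta>.borel_measurable_nn_integral) measurable
    have "1 = (\<integral>\<^sup>+s. 1 \<partial>\<Phi>)" by (simp add: \<Phi>.emeasure_space_1)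
    also have "\<dots> \<le> (\<integral>\<^sup>+s. (\<integral>\<^sup>+y. w s y * indicator (A s) y \<partial>base n) * indicator F s + indicator (- F) s + ennreal (2 * \<epsilon>) +
        (\<integral>\<^sup>+y. w s y * indicator B2 y \<partial>base n) \<partial>\<Phi>)"
      by (intro nn_integral_mono one)
    also have "\<dots> = ?X + (\<integral>\<^sup>+s. indicator (- F) s \<partial>\<Phi>) + ennreal (2 * \<epsilon>) + (\<integral>\<^sup>+s. (\<integral>\<^sup>+y. w s y * indicator B2 y \<partial>base n) \<partial>\<Phi>)"
    proof -
      have Fc: "(\<lambda>s. indicator (- F) s :: ennreal) \<in> borel_measurable \<Phi>" by measurable
      show ?thesis
        by (subst nn_integral_add[OF _ X2m], use Xm Fc in measurable)
           (subst nn_integral_add, use Xm Fc in measurable, subst nn_integral_add[OF Xm Fc], simp add: \<Phi>.emeasure_space_1)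
    qed
    also have "\<dots> \<le> ?X + ennreal \<epsilon> + ennreal (2 * \<epsilon>) + ennreal \<epsilon>"
      by (intro add_mono order_refl F_tail B2_tail)
    also have "\<dots> = ?X + ennreal (\<theta> / 4)"
      using \<epsilon> by (simp add: add.assoc ennreal_plus[symmetric] \<epsilon>_def del: ennreal_plus)
    finally have X: "1 \<le> ?X + ennreal (\<theta> / 4)" .
    \<comment> \<open>The floor keeps the cost \<open>real k / \<gamma>\<close> at most
      \<open>\<theta> / 2\<close>, while the \<open>k + 1\<close> codewords number more than
      \<open>\<gamma> * \<theta> / 2\<close>.\<close>
    define k where "k = nat \<lfloor>\<gamma> * \<theta> / 2\<rfloor>"
    have gt0: "0 \<le> \<gamma> * \<theta> / 2" using \<gamma> \<theta> by simp
    have k: "real k \<le> \<gamma> * \<theta> / 2" "\<gamma> * \<theta> / 2 < real k + 1"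
      using gt0 by (simp_all add: k_def of_nat_nat) linarith
    have large: "ennreal (1 - \<theta> + real k / \<gamma>) < ?X"
    proof (rule ccontr)
      assume "\<not> ?thesis"
      then have "?X \<le> ennreal (1 - \<theta> + real k / \<gamma>)" by simp
      also have "\<dots> \<le> ennreal (1 - \<theta> / 2)"
        using k(1) \<gamma> by (intro ennreal_leI) (simp add: field_simps)
      finally have "1 \<le> ennreal (1 - \<theta> / 2) + ennreal (\<theta> / 4)" using X by (meson add_right_mono order_trans)
      also have "\<dots> = ennreal (1 - \<theta> / 4)" using \<theta> by (simp add: ennreal_plus[symmetric] del: ennreal_plus)
      also have "\<dots> < 1" using \<theta> by (simp add: ennreal_less_one_iff)
      finally show False by simp
    qed
    obtain c D where c: "\<And>l. l \<in> {1..k + 1} \<Longrightarrow> c l \<in> F" and Dm: "\<And>l. l \<in> {1..k + 1} \<Longrightarrow> D l \<in> sets (base n)"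
      and good: "\<And>l. l \<in> {1..k + 1} \<Longrightarrow> ennreal (1 - \<theta>) \<le> (\<integral>\<^sup>+y. w (c l) y * indicator (D l) y \<partial>base n)"
      and disj: "\<And>l j. l \<in> {1..k + 1} \<Longrightarrow> j \<in> {1..k + 1} \<Longrightarrow> l \<noteq> j \<Longrightarrow> D l \<inter> D j = {}"
      using feinstein[OF \<Phi>.prob_space_axioms \<beta>.sigma_finite_measure_axioms wp qm Fm marginal total \<gamma> \<theta> large[unfolded A_def]]
      by blast
    \<comment> \<open>The region for gains \<open>g\<close> is the section of \<open>D l\<close> at
      \<open>g\<close>. The codewords do not involve the gains, as the sender does not know
      them.\<close>
    define \<Gamma> :: "('t, 'r) code" where
      "\<Gamma> = \<lparr>code_size = k + 1, codeword = (\<lambda>l i. sqrt p *\<^sub>R c l i), decoding_region = (\<lambda>l g. {z. (g, z) \<in> D l})\<rparr>"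
    have Dsp: "D l \<subseteq> space (blocks n) \<times> space (blocks n)" if "l \<in> {1..k + 1}" for l
      using sets.sets_into_space[OF Dm[OF that]] by (simp add: space_base)
    have sig: "(SIGMA g : space (blocks n). {z. (g, z) \<in> D l}) = D l" if "l \<in> {1..k + 1}" for l
      using Dsp[OF that] by auto
    have "is_code n P \<Gamma>"
      unfolding is_code_def
    proof (intro conjI ballI impI)
      fix l assume "l \<in> {1..code_size \<Gamma>}"
      then have l: "l \<in> {1..k + 1}" by (simp add: \<Gamma>_def)
      have "(\<Sum>i=1..n. Re (cdot (codeword \<Gamma> l i) (codeword \<Gamma> l i))) = p * quad_sum n (\<lambda>_. mat 1) (c l)"
        using p by (simp add: \<Gamma>_def quad_sum_def quad_mat_1 Re_cdot_self power_mult_distrib sum_distrib_left)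
      also have "\<dots> \<le> p * (real n * (?T + \<eta>))"
        using c[OF l] p by (intro mult_left_mono) (auto simp: F_def)
      also have "\<dots> = real n * P" using p by (simp add: \<eta>(2))
      finally show "(1 / real n) * (\<Sum>i=1..n. Re (cdot (codeword \<Gamma> l i) (codeword \<Gamma> l i))) \<le> P"
        using n by (simp add: field_simps)
      show "decoding_region \<Gamma> l g \<subseteq> space (blocks n)" for g
        using Dsp[OF l] by (auto simp: \<Gamma>_def)
      show "(SIGMA g : space (blocks n). decoding_region \<Gamma> l g) \<in> sets (blocks n \<Otimes>\<^sub>M blocks n)"
        using Dm[OF l] sig[OF l] by (simp add: \<Gamma>_def sets_base)
      fix j g assume "j \<in> {1..code_size \<Gamma>}" "l \<noteq> j"
      then show "decoding_region \<Gamma> l g \<inter> decoding_region \<Gamma> j g = {}"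
        using disj[OF l, of j] by (auto simp: \<Gamma>_def)
    qed (simp add: \<Gamma>_def)
    moreover have "\<theta> / 2 * exp (real n * r) \<le> real (code_size \<Gamma>)"
      using k(2) by (simp add: \<Gamma>_def \<gamma>_def mult.commute)
    moreover have "max_error M G \<xi> n \<Gamma> \<le> \<theta>"
      unfolding max_error_def
    proof (intro Max.boundedI)
      fix x assume "x \<in> (\<lambda>l. \<integral>\<omega>. measure (channel_law M \<xi> n (block n G \<omega>) (codeword \<Gamma> l))
               (space (blocks n) - decoding_region \<Gamma> l (block n G \<omega>)) \<partial>M) ` {1..code_size \<Gamma>}"
      then obtain l where l: "l \<in> {1..k + 1}" and x: "x = (\<integral>\<omega>. measure (channel_law M \<xi> n (block n G \<omega>) (codeword \<Gamma> l))
               (space (blocks n) - decoding_region \<Gamma> l (block n G \<omega>)) \<partial>M)"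
        by (auto simp: \<Gamma>_def)
      let ?c = "\<integral>\<^sup>+y. w (c l) y * indicator (D l) y \<partial>base n"
      have cw: "restrict (codeword \<Gamma> l) {1..n} = enc (c l)" by (simp add: \<Gamma>_def enc_def)
      have chan: "channel_law M \<xi> n g (codeword \<Gamma> l) = channel_law M \<xi> n g (enc (c l))" for g
        using channel_law_restrict[of n g "codeword \<Gamma> l"] by (simp only: cw)
      note ep = error_probability[OF \<sigma> n enc_space, of "decoding_region \<Gamma> l" "c l"]
      have Sm: "(SIGMA g : space (blocks n). decoding_region \<Gamma> l g) \<in> sets (blocks n \<Otimes>\<^sub>M blocks n)"
        and Ss: "\<And>g. g \<in> space (blocks n) \<Longrightarrow> decoding_region \<Gamma> l g \<subseteq> space (blocks n)"
        using Dm[OF l] sig[OF l] Dsp[OF l] by (auto simp: \<Gamma>_def sets_base)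
      have S: "(SIGMA g : space (blocks n). decoding_region \<Gamma> l g) = D l" using sig[OF l] by (simp add: \<Gamma>_def)
      have "x = 1 - enn2real ?c"
        using ep(1)[OF Sm Ss] by (simp only: x chan S w_def)
      moreover have "?c \<le> 1" using ep(2)[OF Sm Ss] by (simp only: S w_def)
      then have "?c = ennreal (enn2real ?c)" by (intro ennreal_enn2real[symmetric]) (auto intro: le_less_trans)
      then have "ennreal (1 - \<theta>) \<le> ennreal (enn2real ?c)" using good[OF l] by simp
      then have "1 - \<theta> \<le> enn2real ?c" by (subst (asm) ennreal_le_iff) auto
      ultimately show "x \<le> \<theta>" by simp
    qed (simp_all add: \<Gamma>_def)
    ultimately show ?case by blast
  qed
qed

text \<open>Achievability demands a code at every length; this one fills the lengths at which no
  good code is available.\<close>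

definition trivial_code :: "nat \<Rightarrow> ('t, 'r) code" where
  "trivial_code n = \<lparr>code_size = 1, codeword = (\<lambda>_ _. 0), decoding_region = (\<lambda>_ _. space (blocks n))\<rparr>"

lemma is_code_trivial_code:
  assumes "0 \<le> P" shows "is_code n P (trivial_code n)"
proof -
  have "space (blocks n) \<times> space (blocks n) \<in> sets ((blocks n :: (nat \<Rightarrow> complex^'t^'r) measure) \<Otimes>\<^sub>M (blocks n :: (nat \<Rightarrow> complex^'r) measure))"
    by (intro pair_measureI sets.top)
  then show ?thesis
    using assms by (simp add: is_code_def trivial_code_def)
qed

lemma achievable_rate_capacity:
  assumes \<alpha>: "0 \<le> \<alpha>" "\<alpha> < 1" and \<sigma>: "0 < \<sigma>\<^sup>2" and P: "0 < P"
  shows "achievable_rate M G \<xi> P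
    ((\<integral>g. ln_rate (\<sigma>\<^sup>2) ((P / real CARD('t)) *\<^sub>R mat 1) (g :: complex^'t^'r) \<partial>rayleigh) / ln 2)"
  unfolding achievable_rate_def
proof (intro allI impI)
  fix \<theta>0 \<delta> :: real assume \<theta>0: "0 < \<theta>0" and \<delta>: "0 < \<delta>"
  let ?v = "\<sigma>\<^sup>2" and ?R = "real CARD('r)"
  let ?I = "\<lambda>p. \<integral>g. ln_rate ?v (p *\<^sub>R mat 1) (g :: complex^'t^'r) \<partial>rayleigh"
  define p' where "p' = P / real CARD('t)"
  have p': "0 < p'" "p' * real CARD('t) = P" using P by (simp_all add: p'_def)
  let ?C = "?I p'"
  define \<theta> where "\<theta> = min \<theta>0 (1 / 2)"
  have \<theta>: "0 < \<theta>" "\<theta> < 1" "\<theta> \<le> \<theta>0" using \<theta>0 by (auto simp: \<theta>_def)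
  \<comment> \<open>Lowering the power by the factor \<open>exp (- x)\<close> costs at most
    \<open>?R * x\<close>, which is \<open>\<delta> * ln 2 / 4\<close> nats.\<close>
  define x where "x = \<delta> * ln 2 / (4 * ?R)"
  have x: "0 < x" using \<delta> by (simp add: x_def)
  define p where "p = p' * exp (- x)"
  have p: "0 < p" "p < p'" using p'(1) x by (simp_all add: p_def)
  have pP: "p * real CARD('t) < P" using p(2) p'(2) by (metis mult_strict_right_mono of_nat_0_less_iff zero_less_card_finite)
  interpret R: prob_space "rayleigh :: (complex^'t^'r) measure" by (rule prob_space_rayleigh)
  have int: "integrable rayleigh (ln_rate ?v (a *\<^sub>R mat 1) :: complex^'t^'r \<Rightarrow> real)" if "0 < a" for a
    using that by (intro integrable_ln_rate[OF \<sigma>] hermitian_psd_scalar) simp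
  have "p' / p = exp x" using p'(1) by (simp add: p_def exp_minus field_simps)
  then have lx: "ln (p' / p) = x" by simp
  have "?C - ?R * x = (\<integral>g. ln_rate ?v (p' *\<^sub>R mat 1) (g :: complex^'t^'r) - ?R * x \<partial>rayleigh)"
    using int[OF p'(1)] R.prob_space by simp
  also have "\<dots> \<le> ?I p"
    using int[OF p'(1)] int[OF p(1)] ln_rate_scalar_lower[OF \<sigma> p(1) less_imp_le[OF p(2)]] unfolding lx
    by (intro integral_mono) auto
  finally have "?C - \<delta> * ln 2 / 4 \<le> ?I p" by (simp add: x_def)
  moreover have "0 < \<delta> * ln 2" using \<delta> by simp
  ultimately have r: "?C - \<delta> * ln 2 / 2 < ?I p" by linarith
  \<comment> \<open>In bits this gives up \<open>\<delta> / 2\<close>; the other half of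
    \<open>\<delta>\<close> absorbs the factor \<open>\<theta> / 2\<close> in the code size, whose
    logarithm divided by \<open>n\<close> tends to 0.\<close>
  define r where "r = ?C - \<delta> * ln 2 / 2"
  define good where "good n \<Gamma> \<longleftrightarrow> is_code n P \<Gamma> \<and> \<theta> / 2 * exp (real n * r) \<le> real (code_size \<Gamma>) \<and> max_error M G \<xi> n \<Gamma> \<le> \<theta>"
    for n and \<Gamma> :: "('t, 'r) code"
  have ev: "\<forall>\<^sub>F n in sequentially. \<exists>\<Gamma>. good n \<Gamma>"
    unfolding good_def r_def by (rule achievability[OF \<alpha> \<sigma> p(1) pP r \<theta>(1,2)])
  define \<Gamma> where "\<Gamma> n = (if \<exists>\<Gamma>. good n \<Gamma> then SOME \<Gamma>. good n \<Gamma> else trivial_code n)" for n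
  have good: "good n (\<Gamma> n)" if "\<exists>\<Gamma>. good n \<Gamma>" for n
    using someI_ex[OF that] that by (simp add: \<Gamma>_def)
  have code: "is_code n P (\<Gamma> n)" for n
  proof (cases "\<exists>\<Gamma>. good n \<Gamma>")
    case True
    then show ?thesis using good[of n] by (simp add: good_def)
  next
    case False
    then show ?thesis using P by (simp add: \<Gamma>_def is_code_trivial_code)
  qed
  have "(\<lambda>n. log 2 (\<theta> / 2) / real n) \<longlonglongrightarrow> 0" by (rule lim_const_over_n)
  then have "\<forall>\<^sub>F n in sequentially. - (\<delta> / 2) < log 2 (\<theta> / 2) / real n"
    using \<delta> by (intro order_tendstoD(1)) auto
  with ev eventually_ge_at_top[of 1]
  have "\<forall>\<^sub>F n in sequentially. log 2 (real (code_size (\<Gamma> n))) / real n \<ge> ?C / ln 2 - \<delta> \<and> max_error M G \<xi> n (\<Gamma> n) \<le> \<theta>0"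
  proof eventually_elim
    case (elim n)
    have g: "\<theta> / 2 * exp (real n * r) \<le> real (code_size (\<Gamma> n))" "max_error M G \<xi> n (\<Gamma> n) \<le> \<theta>"
      using good[OF elim(1)] by (simp_all add: good_def)
    have "log 2 (\<theta> / 2 * exp (real n * r)) \<le> log 2 (real (code_size (\<Gamma> n)))"
      using g(1) \<theta>(1) by (intro log_mono) auto
    moreover have "log 2 (\<theta> / 2 * exp (real n * r)) = log 2 (\<theta> / 2) + real n * (r / ln 2)"
      using \<theta>(1) by (simp add: log_def ln_mult ln_div add_divide_distrib diff_divide_distrib)
    ultimately have "(log 2 (\<theta> / 2) + real n * (r / ln 2)) / real n \<le> log 2 (real (code_size (\<Gamma> n))) / real n"
      by (intro divide_right_mono) auto
    moreover have "(log 2 (\<theta> / 2) + real n * (r / ln 2)) / real n = log 2 (\<theta> / 2) / real n + r / ln 2"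
      using elim(2) by (simp add: add_divide_distrib)
    moreover have "r / ln 2 = ?C / ln 2 - \<delta> / 2" by (simp add: r_def diff_divide_distrib)
    ultimately show ?case using elim(3) g(2) \<theta>(3) by linarith
  qed
  then show "\<exists>\<Gamma> :: nat \<Rightarrow> ('t, 'r) code. (\<forall>n\<ge>1. is_code n P (\<Gamma> n)) \<and>
      (\<forall>\<^sub>F n in sequentially. log 2 (real (code_size (\<Gamma> n))) / real n \<ge>
        (\<integral>g. ln_rate (\<sigma>\<^sup>2) ((P / real CARD('t)) *\<^sub>R mat 1) (g :: complex^'t^'r) \<partial>rayleigh) / ln 2 - \<delta> \<and> max_error M G \<xi> n (\<Gamma> n) \<le> \<theta>0)"
    using code unfolding p'_def by blast
qed

lemma capacity_eq:
  assumes "0 \<le> \<alpha>" "\<alpha> < 1" "0 < \<sigma>\<^sup>2" "0 < P"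
  shows "capacity M G \<xi> P =
    ereal ((\<integral>g. ln_rate (\<sigma>\<^sup>2) ((P / real CARD('t)) *\<^sub>R mat 1) (g :: complex^'t^'r) \<partial>rayleigh) / ln 2)"
  unfolding capacity_def
proof (rule antisym)
  show "(SUP R\<in>{R. achievable_rate M G \<xi> P R}. ereal R) \<le>
      ereal ((\<integral>g. ln_rate (\<sigma>\<^sup>2) ((P / real CARD('t)) *\<^sub>R mat 1) (g :: complex^'t^'r) \<partial>rayleigh) / ln 2)"
    by (intro SUP_least) (use achievable_rate_le[OF assms] in \<open>simp add: pos_le_divide_eq\<close>)
  show "ereal ((\<integral>g. ln_rate (\<sigma>\<^sup>2) ((P / real CARD('t)) *\<^sub>R mat 1) (g :: complex^'t^'r) \<partial>rayleigh) / ln 2) \<le>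
      (SUP R\<in>{R. achievable_rate M G \<xi> P R}. ereal R)"
    by (intro SUP_upper) (use achievable_rate_capacity[OF assms] in simp)
qed

end

theorem theorem1:
  fixes M :: "'w measure" and N :: "'v measure"
    and \<alpha> \<sigma> P :: real
    and G W :: "nat \<Rightarrow> 'w \<Rightarrow> complex^'t^'r"
    and \<xi> :: "nat \<Rightarrow> 'w \<Rightarrow> complex^'r"
    and H :: "'v \<Rightarrow> complex^'t^'r"
  assumes "P > 0" and "\<sigma>\<^sup>2 > 0" and "0 \<le> \<alpha>" and "\<alpha> < 1"
    and "gauss_markov_channel M \<alpha> \<sigma> G W \<xi>"
    and "prob_space N" and "rayleigh_matrix N H"
  shows "(\<forall>Q\<in>power_covariances P. integrable N (\<lambda>\<omega>. log_det_rate \<sigma> Q (H \<omega>))) \<and>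
    (\<exists>Q\<in>power_covariances P.
       (\<forall>Q'\<in>power_covariances P.
          (\<integral>\<omega>. log_det_rate \<sigma> Q' (H \<omega>) \<partial>N) \<le> (\<integral>\<omega>. log_det_rate \<sigma> Q (H \<omega>) \<partial>N)) \<and>
       capacity M G \<xi> P = ereal (\<integral>\<omega>. log_det_rate \<sigma> Q (H \<omega>) \<partial>N))"
proof -
  interpret gauss_markov_channel M \<alpha> \<sigma> G W \<xi> by fact
  have H: "H \<in> borel_measurable N" "distr N borel H = rayleigh"
    using rayleigh_matrix_law[OF assms(7)] by auto
  \<comment> \<open>The expectation depends on \<open>H\<close> through its law alone, which is that
    of every gain of the channel.\<close>
  have rate: "(\<integral>\<omega>. log_det_rate \<sigma> Q (H \<omega>) \<partial>N) = (\<integral>g. ln_rate (\<sigma>\<^sup>2) Q (g :: complex^'t^'r) \<partial>rayleigh) / ln 2" for Q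
    unfolding log_det_rate_ln_rate H(2)[symmetric] using H(1) by (simp add: integral_distr)
  have int: "integrable N (\<lambda>\<omega>. log_det_rate \<sigma> Q (H \<omega>))" if "hermitian_psd Q" for Q
  proof -
    have "integrable (distr N borel H) (ln_rate (\<sigma>\<^sup>2) Q)"
      unfolding H(2) by (rule integrable_ln_rate[OF assms(2) that])
    then show ?thesis
      unfolding log_det_rate_ln_rate using H(1) by (simp add: integrable_distr_eq)
  qed
  define p where "p = P / real CARD('t)"
  have p: "0 < p" "p * real CARD('t) = P" using assms(1) by (simp_all add: p_def)
  let ?Q = "p *\<^sub>R mat 1 :: complex^'t^'t"
  have "?Q \<in> power_covariances P"
    using p by (simp add: power_covariances_def hermitian_psd_scalar trace_scaleR trace_I)
  moreover have "(\<integral>\<omega>. log_det_rate \<sigma> Q' (H \<omega>) \<partial>N) \<le> (\<integral>\<omega>. log_det_rate \<sigma> ?Q (H \<omega>) \<partial>N)"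
    if "Q' \<in> power_covariances P" for Q'
    unfolding rate using that p(2)
    by (intro divide_right_mono integral_ln_rate_le_scalar[OF assms(2) p(1)]) (auto simp: power_covariances_def)
  moreover have "capacity M G \<xi> P = ereal (\<integral>\<omega>. log_det_rate \<sigma> ?Q (H \<omega>) \<partial>N)"
    unfolding rate p_def by (rule capacity_eq[OF assms(3,4,2,1)])
  ultimately show ?thesis
    using int by (auto simp: power_covariances_def)
qed

end
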